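(* Consider either the variational or the discretised control approach, with corresponding estimator $\eta$ and distance function $\mathbf d$. There exist $\rho\in(0,1)$ and a constant $\Lambda_2>0$, independent of the mesh size, such that for every triangulation $\mathcal T\in\mathbb T$ and every refinement $\widehat{\mathcal T}\in\mathbb T(\mathcal T)$, $$\widehat\eta(\widehat{\mathcal T}\setminus\mathcal T)\le\rho\,\eta(\mathcal T\setminus\widehat{\mathcal T})+\Lambda_2\,\mathbf d(\mathcal T,\widehat{\mathcal T}).$$
   Context: Data: $\Omega\subset\mathbb R^2$ is a bounded polygonal domain, $\mathbf f,\mathbf y_d\in\mathbf L^2(\Omega):=[L^2(\Omega)]^2$, $\alpha>0$ fixed, $\mathbf u_a,\mathbf u_b\in\mathbb R^2$, $\mathbf U_{\rm ad}=\{\mathbf u\in\mathbf L^2(\Omega):\mathbf u_a\le\mathbf u(x)\le\mathbf u_b\text{ a.e.}\}$ (componentwise). $\|\cdot\|$, $(\cdot,\cdot)$: $L^2(\Omega)$ norm and inner product; $\|\cdot\|_R$: $L^2(R)$ norm. Meshes: $\mathbb T$ is the set of admissible (conforming), shape-regular triangulations of $\Omega$ into triangles obtained from an initial one by newest vertex bisection (NVB); $\mathbb T(\mathcal T)$ is the set of admissible NVB refinements of $\mathcal T$; $h_K=|K|^{1/2}$; $\mathcal E_K$ is the set of edges of $K$. Discrete problem on $\mathcal T$: $\mathcal P_0(\mathcal T)$ are the piecewise constants; $\mathbf V_h$ is the lowest-order Crouzeix–Raviart space (vector fields in $\mathbf L^2(\Omega)$, affine on each triangle, continuous at midpoints of interior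 edges, zero at midpoints of boundary edges); $Q_h=\{q\in\mathcal P_0(\mathcal T):\int_\Omega q\,dx=0\}$. $a_h(\mathbf w,\mathbf v)=\sum_K\int_K\nabla\mathbf w:\nabla\mathbf v\,dx$, $b_h(\mathbf v,q)=\sum_K\int_Kq\,{\rm div}\,\mathbf v\,dx$, $|||\mathbf v|||_{\rm pw}^2=\sum_K\int_K|\nabla\mathbf v|^2dx$ (sum over the finer mesh when two meshes are involved), $\nabla_h$ is the piecewise gradient. The discrete solution $(\bar{\mathbf y}_h,\bar r_h,\bar{\mathbf p}_h,\bar s_h,\bar{\mathbf u}_h)\in\mathbf V_h\times Q_h\times\mathbf V_h\times Q_h\times\mathbf U_h$ satisfies, for all $(\mathbf v_h,q_h)\in\mathbf V_h\times Q_h$, $a_h(\bar{\mathbf y}_h,\mathbf v_h)-b_h(\mathbf v_h,\bar r_h)=(\mathbf f+\bar{\mathbf u}_h,\mathbf v_h)$, $b_h(\bar{\mathbf y}_h,q_h)=0$, $a_h(\bar{\mathbf p}_h,\mathbf v_h)+b_h(\mathbf v_h,\bar s_h)=(\bar{\mathbf y}_h-\mathbf y_d,\mathbf v_h)$, $b_h(\bar{\mathbf p}_h,q_h)=0$, and $(\alpha\bar{\mathbf u}_h+\bar{\mathbf p}_h,\mathbf z_h-\bar{\mathbf u}_h)\ge0$ for all $\mathbf z_h\in\mathbf U_h$. Variational approach: $\mathbf U_h=\mathbf U_{\rm ad}$; discretised approach: $\mathbf U_h=\mathbf U_{\rm ad}\cap[\mathcal P_0(\mathcal T)]^2$. Hats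 denote the solution on $\widehat{\mathcal T}$. Estimators: $\mu_{S,K}^2=h_K^2\|\mathbf f+\bar{\mathbf u}_h\|_K^2$, $\rho_{S,\mathcal E(K)}^2=\sum_{E\in\mathcal E_K}h_K\|[\nabla_h\bar{\mathbf y}_h\,t_E]\|_E^2$, $\mu_{A,K}^2=h_K^2\|\bar{\mathbf y}_h-\mathbf y_d\|_K^2$, $\rho_{A,\mathcal E(K)}^2=\sum_{E\in\mathcal E_K}h_K\|[\nabla_h\bar{\mathbf p}_h\,t_E]\|_E^2$, $\eta_{C,K}^2=h_K^2\|\nabla_h(\bar{\mathbf u}_h-\alpha^{-1}\bar{\mathbf p}_h)\|_K^2$, with $t_E$ a unit tangent of $E$ and $[\cdot]$ the jump across $E$ (the trace if $E\subset\partial\Omega$). For $\mathcal M\subseteq\mathcal T$, $\eta^2(\mathcal M)=\sum_{K\in\mathcal M}(\mu_{S,K}^2+\rho_{S,\mathcal E(K)}^2+\mu_{A,K}^2+\rho_{A,\mathcal E(K)}^2)$ in the variational approach, with $\eta_{C,K}^2$ added to each summand in the discretised approach. $\widehat\eta$ is the same quantity defined with $\widehat{\mathcal T}$ and the solution on $\widehat{\mathcal T}$. Distance: $\mathbf d^2(\mathcal T,\widehat{\mathcal T})=|||\widehat{\bar{\mathbf y}}_h-\bar{\mathbf y}_h|||_{\rm pw}^2+|||\widehat{\bar{\mathbf p}}_h-\bar{\mathbf p}_h|||_{\rm pw}^2$ (variational); with the additional term $\|\widehat{\bar{\mathbf u}}_h-\bar{\mathbf u}_h\|^2$ (discretised).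 *)

theory Defs
  imports "HOL-Analysis.Analysis"
begin

type_synonym point = "real^2"
type_synonym field = "real^2 \<Rightarrow> real^2"

text \<open>A bounded domain whose boundary consists of finitely many (nondegenerate) line segments.\<close>

definition polygonal_domain :: "point set \<Rightarrow> bool" where
  "polygonal_domain \<Omega> \<longleftrightarrow>
     open \<Omega> \<and> connected \<Omega> \<and> bounded \<Omega> \<and> \<Omega> \<noteq> {} \<and>
     (\<exists>S. finite S \<and> (\<forall>(a, b) \<in> S. a \<noteq> b) \<and> frontier \<Omega> = (\<Union>(a, b) \<in> S. closed_segment a b))"


section \<open>Triangulations and newest vertex bisection\<close>

text \<open>The triple \<open>(a, b, c)\<close> is the triangle with these vertices whose newest vertex is \<open>a\<close>,
  so that its refinement edge is the one from \<open>b\<close> to \<open>c\<close>.\<close>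

type_synonym tri = "point \<times> point \<times> point"
type_synonym mesh = "tri set"

fun vertices :: "tri \<Rightarrow> point set" where
  "vertices (a, b, c) = {a, b, c}"

definition region :: "tri \<Rightarrow> point set" where
  "region K = convex hull (vertices K)"

definition meshsize :: "tri \<Rightarrow> real" where
  "meshsize K = sqrt (measure lebesgue (region K))"

type_synonym edge = "point \<times> point"

fun edges :: "tri \<Rightarrow> edge set" where
  "edges (a, b, c) = {(a, b), (b, c), (c, a)}"

fun segment :: "edge \<Rightarrow> point set" where
  "segment (a, b) = closed_segment a b"

fun edge_midpoint :: "edge \<Rightarrow> point" where
  "edge_midpoint (a, b) = midpoint a b"

fun tangent :: "edge \<Rightarrow> point" where
  "tangent (a, b) = (1 / dist a b) *\<^sub>R (b - a)"

text \<open>Conforming triangulations of \<open>\<Omega>\<close>: two different triangles meet in nothing, in a common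
  vertex or in a common edge. The last two conditions say that the triangulation resolves the
  boundary; they are automatic if \<open>\<Omega> = interior (closure \<Omega>)\<close>.\<close>

definition conforming_triangulation :: "point set \<Rightarrow> mesh \<Rightarrow> bool" where
  "conforming_triangulation \<Omega> T \<longleftrightarrow>
     finite T \<and>
     (\<forall>K\<in>T. card (vertices K) = 3 \<and> \<not> collinear (vertices K)) \<and>
     (\<Union>K\<in>T. region K) = closure \<Omega> \<and>
     (\<forall>K\<in>T. \<forall>K'\<in>T. K \<noteq> K' \<longrightarrow>
        vertices K \<noteq> vertices K' \<and>
        region K \<inter> region K' = convex hull (vertices K \<inter> vertices K')) \<and>
     (\<forall>K\<in>T. interior (region K) \<subseteq> \<Omega>) \<and>
     (\<forall>K\<in>T. \<forall>(a, b)\<in>edges K. closed_segment a b \<subseteq> frontier \<Omega> \<or> open_segment a b \<subseteq> \<Omega>)"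

fun children :: "tri \<Rightarrow> tri set" where
  "children (a, b, c) = {(midpoint b c, a, b), (midpoint b c, c, a)}"

definition bisects :: "mesh \<Rightarrow> mesh \<Rightarrow> bool" where
  "bisects T T' \<longleftrightarrow> (\<exists>K\<in>T. T' = (T - {K}) \<union> children K)"

text \<open>The conforming newest-vertex-bisection refinements of \<open>T\<close>; intermediate meshes may have
  hanging nodes. Shape regularity is a consequence of the bisection rule. In the bisection forest
  of a fixed triangulation a region determines its triple, so that the difference of two meshes
  is the difference of the corresponding sets of unlabelled triangles.\<close>

definition refinements :: "point set \<Rightarrow> mesh \<Rightarrow> mesh set" where
  "refinements \<Omega> T = {T'. bisects\<^sup>*\<^sup>* T T' \<and> conforming_triangulation \<Omega> T'}"


section \<open>Lebesgue and discrete spaces\<close>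

definition L2 :: "point set \<Rightarrow> (point \<Rightarrow> 'a::euclidean_space) set" where
  "L2 S = {g. g \<in> borel_measurable (lebesgue_on S) \<and>
              integrable (lebesgue_on S) (\<lambda>x. (norm (g x))\<^sup>2)}"

definition L2_inner :: "point set \<Rightarrow> (point \<Rightarrow> 'a::euclidean_space) \<Rightarrow> (point \<Rightarrow> 'a) \<Rightarrow> real" where
  "L2_inner S g h = integral\<^sup>L (lebesgue_on S) (\<lambda>x. g x \<bullet> h x)"

definition L2_norm :: "point set \<Rightarrow> (point \<Rightarrow> 'a::euclidean_space) \<Rightarrow> real" where
  "L2_norm S g = sqrt (L2_inner S g g)"

text \<open>The \<open>L2\<close> norm on an edge with respect to arc length.\<close>

fun edge_norm :: "edge \<Rightarrow> (point \<Rightarrow> 'a::euclidean_space) \<Rightarrow> real" where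
  "edge_norm (a, b) g =
     sqrt (dist a b * integral\<^sup>L (lebesgue_on {0..1}) (\<lambda>t. (norm (g (linepath a b t)))\<^sup>2))"

text \<open>The trace on the boundary of a triangle, taken from its interior. Piecewise polynomial
  functions are described by their values in the interiors of the triangles; their values on the
  edges, a null set, are irrelevant.\<close>

definition inner_trace :: "tri \<Rightarrow> (point \<Rightarrow> 'a::euclidean_space) \<Rightarrow> point \<Rightarrow> 'a" where
  "inner_trace K g x = Lim (at x within interior (region K)) g"

definition neighbour :: "mesh \<Rightarrow> tri \<Rightarrow> edge \<Rightarrow> tri" where
  "neighbour T K E = (THE K'. K' \<in> T \<and> K' \<noteq> K \<and> segment E \<in> segment ` edges K')"

text \<open>The jump across an edge \<open>E\<close> of \<open>K\<close>, oriented from \<open>K\<close>; only its norm is used below, which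
  depends neither on this orientation nor on that of the tangent.\<close>

definition jump :: "point set \<Rightarrow> mesh \<Rightarrow> tri \<Rightarrow> edge \<Rightarrow> (point \<Rightarrow> 'a::euclidean_space) \<Rightarrow> point \<Rightarrow> 'a" where
  "jump \<Omega> T K E g x =
     (if segment E \<subseteq> frontier \<Omega> then inner_trace K g x
      else inner_trace K g x - inner_trace (neighbour T K E) g x)"

text \<open>In the interiors of the triangles the Jacobian of a piecewise affine field is its piecewise
  gradient. The inner product and the norm of \<^typ>\<open>real^2^2\<close> are the Frobenius ones.\<close>

definition grad :: "field \<Rightarrow> point \<Rightarrow> real^2^2" where
  "grad v x = jacobian v (at x)"

definition divergence :: "field \<Rightarrow> point \<Rightarrow> real" where
  "divergence v x = trace (grad v x)"

definition P0 :: "mesh \<Rightarrow> (point \<Rightarrow> 'a) set" where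
  "P0 T = {q. \<forall>K\<in>T. \<exists>c. \<forall>x\<in>interior (region K). q x = c}"

definition crouzeix_raviart :: "point set \<Rightarrow> mesh \<Rightarrow> field set" where
  "crouzeix_raviart \<Omega> T = {v \<in> L2 \<Omega>.
     (\<forall>K\<in>T. \<exists>A c. \<forall>x\<in>interior (region K). v x = A *v x + c) \<and>
     (\<forall>K\<in>T. \<forall>E\<in>edges K. jump \<Omega> T K E v (edge_midpoint E) = 0)}"

definition pressures :: "point set \<Rightarrow> mesh \<Rightarrow> (point \<Rightarrow> real) set" where
  "pressures \<Omega> T = {q \<in> L2 \<Omega>. q \<in> P0 T \<and> integral\<^sup>L (lebesgue_on \<Omega>) q = 0}"

definition a_h :: "mesh \<Rightarrow> field \<Rightarrow> field \<Rightarrow> real" where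
  "a_h T w v = (\<Sum>K\<in>T. integral\<^sup>L (lebesgue_on (region K)) (\<lambda>x. grad w x \<bullet> grad v x))"

definition b_h :: "mesh \<Rightarrow> field \<Rightarrow> (point \<Rightarrow> real) \<Rightarrow> real" where
  "b_h T v q = (\<Sum>K\<in>T. integral\<^sup>L (lebesgue_on (region K)) (\<lambda>x. q x * divergence v x))"

definition pw_norm :: "mesh \<Rightarrow> field \<Rightarrow> real" where
  "pw_norm T v = sqrt (\<Sum>K\<in>T. integral\<^sup>L (lebesgue_on (region K)) (\<lambda>x. (norm (grad v x))\<^sup>2))"


section \<open>The discrete optimal control problem\<close>

datatype approach = Variational | Discretised

definition U_ad :: "point set \<Rightarrow> point \<Rightarrow> point \<Rightarrow> field set" where
  "U_ad \<Omega> ua ub = {u \<in> L2 \<Omega>. AE x in lebesgue_on \<Omega>. \<forall>i. ua $ i \<le> u x $ i \<and> u x $ i \<le> ub $ i}"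

definition U_h :: "approach \<Rightarrow> point set \<Rightarrow> point \<Rightarrow> point \<Rightarrow> mesh \<Rightarrow> field set" where
  "U_h ap \<Omega> ua ub T =
     (case ap of Variational \<Rightarrow> U_ad \<Omega> ua ub | Discretised \<Rightarrow> U_ad \<Omega> ua ub \<inter> P0 T)"

record discrete_fields =
  state :: field
  pressure :: "point \<Rightarrow> real"
  adjoint_state :: field
  adjoint_pressure :: "point \<Rightarrow> real"
  control :: field

definition discrete_solution ::
  "approach \<Rightarrow> point set \<Rightarrow> field \<Rightarrow> field \<Rightarrow> real \<Rightarrow> point \<Rightarrow> point \<Rightarrow> mesh \<Rightarrow> discrete_fields \<Rightarrow> bool"
  where
  "discrete_solution ap \<Omega> f yd \<alpha> ua ub T X \<longleftrightarrow>
     state X \<in> crouzeix_raviart \<Omega> T \<and> pressure X \<in> pressures \<Omega> T \<and>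
     adjoint_state X \<in> crouzeix_raviart \<Omega> T \<and> adjoint_pressure X \<in> pressures \<Omega> T \<and>
     control X \<in> U_h ap \<Omega> ua ub T \<and>
     (\<forall>v\<in>crouzeix_raviart \<Omega> T.
        a_h T (state X) v - b_h T v (pressure X) = L2_inner \<Omega> (\<lambda>x. f x + control X x) v) \<and>
     (\<forall>q\<in>pressures \<Omega> T. b_h T (state X) q = 0) \<and>
     (\<forall>v\<in>crouzeix_raviart \<Omega> T.
        a_h T (adjoint_state X) v + b_h T v (adjoint_pressure X)
          = L2_inner \<Omega> (\<lambda>x. state X x - yd x) v) \<and>
     (\<forall>q\<in>pressures \<Omega> T. b_h T (adjoint_state X) q = 0) \<and>
     (\<forall>z\<in>U_h ap \<Omega> ua ub T.
        0 \<le> L2_inner \<Omega> (\<lambda>x. \<alpha> *\<^sub>R control X x + adjoint_state X x) (\<lambda>x. z x - control X x))"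


section \<open>Error estimator and distance\<close>

definition volume_term :: "field \<Rightarrow> tri \<Rightarrow> real" where
  "volume_term g K = (meshsize K)\<^sup>2 * (L2_norm (region K) g)\<^sup>2"

definition jump_term :: "point set \<Rightarrow> mesh \<Rightarrow> field \<Rightarrow> tri \<Rightarrow> real" where
  "jump_term \<Omega> T v K =
     (\<Sum>E\<in>edges K. meshsize K * (edge_norm E (jump \<Omega> T K E (\<lambda>x. grad v x *v tangent E)))\<^sup>2)"

definition control_term :: "real \<Rightarrow> discrete_fields \<Rightarrow> tri \<Rightarrow> real" where
  "control_term \<alpha> X K =
     (meshsize K)\<^sup>2 *
     (L2_norm (region K) (grad (\<lambda>x. control X x - (1 / \<alpha>) *\<^sub>R adjoint_state X x)))\<^sup>2"

definition estimator ::
  "approach \<Rightarrow> point set \<Rightarrow> field \<Rightarrow> field \<Rightarrow> real \<Rightarrow> mesh \<Rightarrow> discrete_fields \<Rightarrow> tri set \<Rightarrow> real" where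
  "estimator ap \<Omega> f yd \<alpha> T X M =
     sqrt (\<Sum>K\<in>M.
       volume_term (\<lambda>x. f x + control X x) K + jump_term \<Omega> T (state X) K +
       volume_term (\<lambda>x. state X x - yd x) K + jump_term \<Omega> T (adjoint_state X) K +
       (case ap of Variational \<Rightarrow> 0 | Discretised \<Rightarrow> control_term \<alpha> X K))"

text \<open>In the distance \<open>X\<close> is the solution on the coarse mesh and \<open>X'\<close> the one on the fine mesh
  \<open>T'\<close>, whose piecewise norm is used.\<close>

definition mesh_distance ::
  "approach \<Rightarrow> point set \<Rightarrow> mesh \<Rightarrow> discrete_fields \<Rightarrow> discrete_fields \<Rightarrow> real" where
  "mesh_distance ap \<Omega> T' X X' =
     sqrt ((pw_norm T' (\<lambda>x. state X' x - state X x))\<^sup>2 +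
           (pw_norm T' (\<lambda>x. adjoint_state X' x - adjoint_state X x))\<^sup>2 +
           (case ap of Variational \<Rightarrow> 0
            | Discretised \<Rightarrow> (L2_norm \<Omega> (\<lambda>x. control X' x - control X x))\<^sup>2))"

end

theory Submission
  imports Defs
begin

text \<open>
  On the new triangles the fine solution \<open>X'\<close> is compared with the coarse solution \<open>X\<close>, evaluated on
  the fine mesh. Young's inequality bounds each square in the fine estimator by \<open>1 + \<delta>\<close> times the
  same quantity for \<open>X\<close> plus a multiple of the same quantity for \<open>X' - X\<close>
  (\<open>local_estimator_young\<close>).

  The quantity for \<open>X\<close> contracts. A new triangle has at most half the area of the coarse triangle
  that contains it, so the volume terms lose a factor \<open>1/2\<close> (\<open>volume_reduction\<close>). The gradient of a
  coarse field does not jump across new edges inside a coarse triangle, and on pieces of old edges its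
  jump is unchanged while the mesh size loses a factor \<open>1/sqrt 2\<close> (\<open>jump_reduction\<close>). Since
  \<open>(1 + \<delta>)/sqrt 2 \<le> 3/4\<close> for \<open>\<delta> = 1/20\<close>, the factor \<open>\<rho> = sqrt (3/4)\<close> is admissible.

  The quantity for \<open>X' - X\<close> has to be bounded by the distance. For the jumps this is shape regularity
  (\<open>jump_energy\<close>). In the variational approach the two variational inequalities bound the change of
  the control by that of the adjoint state (\<open>control_stability\<close>). What remains is to bound the
  \<open>L2\<close> norm of \<open>y' - y\<close> and of \<open>p' - p\<close> by the piecewise gradient. The difference belongs to no
  Crouzeix-Raviart space of a single mesh, so this is a Friedrichs inequality across two meshes
  (\<open>friedrichs\<close>).

  That inequality rests on edge means. Let \<open>E\<close> be an edge of a triangle \<open>K\<close> and \<open>P\<close> the vertex opposite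
  to it. The field \<open>x - P\<close> has a constant normal component on \<open>E\<close> and none on the other two edges;
  hence, for affine \<open>v\<close>, the mean of \<open>v\<close> over \<open>E\<close> is the mean over \<open>K\<close> of \<open>v + (1/2) \<nabla>v (x - P)\<close>. If \<open>K\<close> is
  a union of smaller triangles and \<open>v\<close> is piecewise affine with jumps of mean zero, then the same
  volume mean still gives the mean over \<open>E\<close>, because all inner fluxes cancel (\<open>flux_cancel\<close>). In this form
  the two children of a triangle of the bisection forest over the initial mesh \<open>T0\<close> have the same mean on
  their common edge, for Crouzeix-Raviart fields of the fine mesh and, since the volume mean of an affine
  function is insensitive to further bisection, also for those of the coarse mesh
  (\<open>mean_continuous_fine\<close>, \<open>mean_continuous_coarse\<close>). The property is linear, hence inherited by the
  difference. It suffices for a Poincare inequality on every triangle of \<open>T0\<close>: the size halves with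
  each bisection, so the contributions of the levels form a geometric series (\<open>tree_poincare\<close>). The
  remaining means, one for each triangle of the fixed mesh \<open>T0\<close>, are controlled from the boundary,
  because every nonempty set of triangles has an edge that leads out of it (\<open>exposed_edge\<close>).
\<close>

section \<open>Triangles in barycentric form\<close>

definition cross2 :: "point \<Rightarrow> point \<Rightarrow> real" where
  "cross2 u v = u $ 1 * v $ 2 - u $ 2 * v $ 1"

text \<open>Twice the signed area. Bisection preserves the sign, so that all triangles of a bisection tree are
  oriented like its root.\<close>

fun tri_det :: "tri \<Rightarrow> real" where
  "tri_det (a, b, c) = cross2 (b - a) (c - a)"

definition area :: "tri \<Rightarrow> real" where
  "area K = \<bar>tri_det K\<bar> / 2"

fun edge_det :: "edge \<Rightarrow> point \<Rightarrow> real" where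
  "edge_det (p, q) x = cross2 (q - p) (x - p)"

text \<open>Twice the area of the triangle spanned by \<open>E\<close> and \<open>x\<close>, positive on the side of \<open>K\<close>. Divided by
  the length of \<open>E\<close> it is the distance to the line through \<open>E\<close>; divided by \<open>\<bar>tri_det K\<bar>\<close> it is a
  barycentric coordinate; and its value at \<open>P\<close> is the flux through \<open>E\<close>, out of \<open>K\<close>, of the vector field \<open>x - P\<close>.\<close>

definition edge_height :: "tri \<Rightarrow> edge \<Rightarrow> point \<Rightarrow> real" where
  "edge_height K E x = sgn (tri_det K) * edge_det E x"

fun centroid :: "tri \<Rightarrow> point" where
  "centroid (a, b, c) = (1/3) *\<^sub>R (a + b + c)"

text \<open>A squared diameter up to constants. This particular choice is exactly halved by bisection.\<close>

fun size2 :: "tri \<Rightarrow> real" where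
  "size2 (a, b, c) = (norm (b - a))\<^sup>2 + (norm (c - a))\<^sup>2"

declare tri_det.simps [simp del] edge_det.simps [simp del]

lemmas det_defs = cross2_def tri_det.simps edge_det.simps

lemmas coords2 = vec_eq_iff forall_2 vector_add_component vector_minus_component
  vector_scaleR_component vector_uminus_component zero_index

lemma norm_sq2: "(norm (x::real^2))\<^sup>2 = (x$1)\<^sup>2 + (x$2)\<^sup>2"
  unfolding power2_norm_eq_inner by (simp add: inner_vec_def sum_2 power2_eq_square)

lemma midpoint_nth: "midpoint p q $ i = (p $ i + q $ i) / 2" for p q :: point
  by (simp add: midpoint_def)

lemma edge_det_affine:
  "edge_det E ((1 - t) *\<^sub>R x + t *\<^sub>R y) = (1 - t) * edge_det E x + t * edge_det E y"
  by (cases E) (simp add: det_defs algebra_simps)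

lemma edge_height_affine:
  "edge_height K E ((1 - t) *\<^sub>R x + t *\<^sub>R y) = (1 - t) * edge_height K E x + t * edge_height K E y"
  unfolding edge_height_def edge_det_affine by (simp add: algebra_simps)

lemma edge_height_midpoint:
  "edge_height K E (midpoint x y) = (edge_height K E x + edge_height K E y) / 2"
  using edge_height_affine[of K E "1/2" x y]
  by (simp add: midpoint_def scaleR_add_right divide_simps)

lemma sgn_mult_tri_det: "sgn (tri_det K) * tri_det K = \<bar>tri_det K\<bar>"
  by (simp add: abs_sgn mult.commute)

lemma edge_height_vertices:
  assumes "K = (a, b, c)"
  shows "edge_height K (a, b) a = 0" "edge_height K (a, b) b = 0" "edge_height K (a, b) c = \<bar>tri_det K\<bar>"
    "edge_height K (b, c) b = 0" "edge_height K (b, c) c = 0" "edge_height K (b, c) a = \<bar>tri_det K\<bar>"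
    "edge_height K (c, a) c = 0" "edge_height K (c, a) a = 0" "edge_height K (c, a) b = \<bar>tri_det K\<bar>"
  unfolding assms edge_height_def sgn_mult_tri_det[symmetric]
  by (auto simp: det_defs algebra_simps)

lemma edge_height_sum:
  "edge_height (a, b, c) (a, b) x + edge_height (a, b, c) (b, c) x + edge_height (a, b, c) (c, a) x
     = \<bar>tri_det (a, b, c)\<bar>"
  unfolding edge_height_def sgn_mult_tri_det[symmetric] distrib_left[symmetric]
  by (simp add: det_defs algebra_simps)

lemma barycentric:
  assumes "tri_det (a, b, c) \<noteq> 0"
  defines "d \<equiv> tri_det (a, b, c)"
  shows "x = a + (edge_det (c, a) x / d) *\<^sub>R (b - a) + (edge_det (a, b) x / d) *\<^sub>R (c - a)"
proof -
  have d: "d \<noteq> 0" using assms by simp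
  have "d *\<^sub>R (x - a) = edge_det (c, a) x *\<^sub>R (b - a) + edge_det (a, b) x *\<^sub>R (c - a)"
    unfolding d_def by (simp add: coords2 det_defs algebra_simps)
  then have "(1/d) *\<^sub>R (d *\<^sub>R (x - a)) = (1/d) *\<^sub>R (edge_det (c, a) x *\<^sub>R (b - a) + edge_det (a, b) x *\<^sub>R (c - a))"
    by simp
  then show ?thesis using d by (simp add: algebra_simps scaleR_diff_right divide_inverse)
qed

lemma edge_det_comb:
  "edge_det (a, b) (a + u *\<^sub>R (b - a) + v *\<^sub>R (c - a)) = v * tri_det (a, b, c)"
  "edge_det (c, a) (a + u *\<^sub>R (b - a) + v *\<^sub>R (c - a)) = u * tri_det (a, b, c)"
  "edge_det (b, c) (a + u *\<^sub>R (b - a) + v *\<^sub>R (c - a)) = (1 - u - v) * tri_det (a, b, c)"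
  by (simp_all add: det_defs algebra_simps)

lemma region_eq:
  assumes "tri_det K \<noteq> 0"
  shows "region K = {x. \<forall>E\<in>edges K. 0 \<le> edge_height K E x}"
proof -
  obtain a b c where K: "K = (a, b, c)" by (cases K)
  define d where "d = tri_det K"
  have d: "d \<noteq> 0" using assms d_def by simp
  have h: "edge_height K E x = \<bar>d\<bar> * (edge_det E x / d)" for E x
    using d by (simp add: edge_height_def d_def sgn_if)
  have pos: "(0 \<le> edge_height K E x) \<longleftrightarrow> 0 \<le> edge_det E x / d" for E x
    unfolding h using d zero_le_mult_iff[of "\<bar>d\<bar>" "edge_det E x / d"] by auto
  show ?thesis
  proof (intro set_eqI iffI)
    fix x assume "x \<in> region K"
    then obtain u v where "x = a + u *\<^sub>R (b - a) + v *\<^sub>R (c - a)" "0 \<le> u" "0 \<le> v" "u + v \<le> 1"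
      unfolding region_def K vertices.simps convex_hull_3_alt by auto
    then have "edge_det (a,b) x / d = v" "edge_det (c,a) x / d = u" "edge_det (b,c) x / d = 1 - u - v"
      using d edge_det_comb[where a = a and b = b and c = c and u = u and v = v] unfolding d_def K by auto
    then show "x \<in> {x. \<forall>E\<in>edges K. 0 \<le> edge_height K E x}"
      using \<open>0 \<le> u\<close> \<open>0 \<le> v\<close> \<open>u + v \<le> 1\<close> unfolding mem_Collect_eq pos unfolding K by auto
  next
    fix x assume "x \<in> {x. \<forall>E\<in>edges K. 0 \<le> edge_height K E x}"
    then have *: "0 \<le> edge_det (a,b) x / d" "0 \<le> edge_det (c,a) x / d" "0 \<le> edge_det (b,c) x / d"
      unfolding mem_Collect_eq pos unfolding K by auto
    have x: "x = a + (edge_det (c, a) x / d) *\<^sub>R (b - a) + (edge_det (a, b) x / d) *\<^sub>R (c - a)"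
      using barycentric[of a b c x] assms unfolding d_def K by simp
    have "edge_det (b,c) x / d = 1 - edge_det (c, a) x / d - edge_det (a, b) x / d"
      using d edge_det_comb(3)[of b c a "edge_det (c, a) x / d" "edge_det (a, b) x / d"] x
      unfolding d_def K by auto
    then have "edge_det (c, a) x / d + edge_det (a, b) x / d \<le> 1" using * by linarith
    then show "x \<in> region K"
      unfolding region_def K vertices.simps convex_hull_3_alt using * x by blast
  qed
qed

lemma collinear_tri_det: "collinear {a, b, c} \<longleftrightarrow> tri_det (a, b, c) = 0"
proof
  assume "collinear {a, b, c}"
  then consider "a = c" | u where "b = u *\<^sub>R a + (1 - u) *\<^sub>R c"
    unfolding collinear_3_expand by blast
  then show "tri_det (a, b, c) = 0"
  proof cases
    case 2
    show ?thesis unfolding 2 by (simp add: det_defs algebra_simps)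
  qed (simp add: det_defs)
next
  assume z: "tri_det (a, b, c) = 0"
  show "collinear {a, b, c}"
  proof (cases "a = c")
    case True then show ?thesis by (simp add: collinear_3_expand)
  next
    case False
    define d where "d = c - a"
    define e where "e = b - a"
    have ce: "e $ 1 * d $ 2 = e $ 2 * d $ 1" using z by (simp add: det_defs d_def e_def)
    have "\<exists>t. e = t *\<^sub>R d"
    proof (cases "d $ 1 = 0")
      case True
      then have "d $ 2 \<noteq> 0" using False by (auto simp: d_def coords2)
      then show ?thesis using ce True by (intro exI[of _ "e$2 / d$2"]) (auto simp: coords2 field_simps)
    next
      case False
      then show ?thesis using ce by (intro exI[of _ "e$1 / d$1"]) (auto simp: coords2 field_simps)
    qed
    then obtain t where "b - a = t *\<^sub>R (c - a)" unfolding d_def e_def by blast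
    then have "b = (1 - t) *\<^sub>R a + (1 - (1 - t)) *\<^sub>R c" by (simp add: algebra_simps)
    then show ?thesis unfolding collinear_3_expand by blast
  qed
qed

lemma open_heights: "open {x. \<forall>E\<in>edges K. 0 < edge_height K E x}"
proof -
  obtain a b c where K: "K = (a, b, c)" by (cases K)
  have *: "open {x. 0 < edge_height K E x}" for E
    unfolding edge_height_def
    by (cases E) (auto simp: det_defs intro!: open_Collect_less continuous_intros)
  have "{x. \<forall>E\<in>edges K. 0 < edge_height K E x} = (\<Inter>E\<in>edges K. {x. 0 < edge_height K E x})" by auto
  also have "open \<dots>" using * by (intro open_INT) (auto simp: K)
  finally show ?thesis .
qed

lemma interior_region:
  assumes "tri_det K \<noteq> 0"
  shows "interior (region K) = {x. \<forall>E\<in>edges K. 0 < edge_height K E x}"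
proof
  obtain a b c where K: "K = (a, b, c)" by (cases K)
  show "{x. \<forall>E\<in>edges K. 0 < edge_height K E x} \<subseteq> interior (region K)"
    using open_heights unfolding region_eq[OF assms]
    by (intro interior_maximal) (auto simp: less_imp_le)
  show "interior (region K) \<subseteq> {x. \<forall>E\<in>edges K. 0 < edge_height K E x}"
  proof
    fix v assume "v \<in> interior (region K)"
    moreover have "\<not> collinear {a, b, c}" using assms unfolding collinear_tri_det K by simp
    ultimately obtain x y z where v: "0 < x" "0 < y" "0 < z" "x + y + z = 1" "v = x *\<^sub>R a + y *\<^sub>R b + z *\<^sub>R c"
      using interior_convex_hull_3_minimal[of a b c] unfolding region_def K vertices.simps by auto
    have x: "x = 1 - y - z" using v(4) by simp
    have "v = a + y *\<^sub>R (b - a) + z *\<^sub>R (c - a)" unfolding v(5) x by (simp add: algebra_simps)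
    note e = edge_det_comb[where a = a and b = b and c = c and u = y and v = z, folded this]
    show "v \<in> {x. \<forall>E\<in>edges K. 0 < edge_height K E x}"
      using v(1-4) assms unfolding K edges.simps edge_height_def ball_simps mem_Collect_eq e x
      by (auto simp: sgn_if mult_less_0_iff zero_less_mult_iff)
  qed
qed

lemma area_pos: "tri_det K \<noteq> 0 \<Longrightarrow> 0 < area K"
  by (simp add: area_def)

lemma measure_region: "measure lebesgue (region K) = area K"
proof -
  obtain a b c where K: "K = (a, b, c)" by (cases K)
  have "compact (region K)" unfolding region_def K by (simp add: finite_imp_compact_convex_hull)
  then have "measure lebesgue (region K) = measure lborel (region K)"
    by (intro measure_completion) (simp add: borel_compact)
  also have "\<dots> = area K"
    unfolding region_def K vertices.simps content_triangle area_def
    by (simp add: det_defs algebra_simps abs_minus_commute)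
  finally show ?thesis .
qed

lemma meshsize_eq: "meshsize K = sqrt (area K)"
  by (simp add: meshsize_def measure_region)

lemma compact_region: "compact (region K)"
  unfolding region_def by (cases K) (simp add: finite_imp_compact_convex_hull)

lemma convex_region: "convex (region K)"
  unfolding region_def by simp

lemma vertices_subset_region: "vertices K \<subseteq> region K"
  unfolding region_def by (rule hull_subset)

lemma centroid_interior:
  assumes "tri_det K \<noteq> 0" shows "centroid K \<in> interior (region K)"
proof -
  obtain a b c where K: "K = (a, b, c)" by (cases K)
  have "centroid K = a + (1/3) *\<^sub>R (b - a) + (1/3) *\<^sub>R (c - a)" 
    unfolding K by (simp add: coords2 field_simps)
  note e = edge_det_comb[where a = a and b = b and c = c and u = "1/3" and v = "1/3", folded this]
  show ?thesis unfolding interior_region[OF assms] unfolding K edges.simps edge_height_def ball_simps mem_Collect_eq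
    e[unfolded K] using assms K by (auto simp: sgn_if)
qed

lemma closure_interior_region:
  assumes "tri_det K \<noteq> 0" shows "closure (interior (region K)) = region K"
  using convex_closure_interior[OF convex_region] centroid_interior[OF assms] compact_region
  by (metis closure_closed compact_imp_closed empty_iff)

lemma null_region_frontier:
  "region K - interior (region K) \<in> null_sets lebesgue"
proof -
  have "negligible (frontier (region K))" by (simp add: negligible_convex_frontier convex_region)
  moreover have "frontier (region K) = region K - interior (region K)"
    by (simp add: frontier_def compact_region compact_imp_closed)
  ultimately show ?thesis by (simp add: negligible_iff_null_sets)
qed

lemma segment_subset_region:
  assumes "E \<in> edges K" shows "segment E \<subseteq> region K"
proof -
  obtain a b c where K: "K = (a, b, c)" by (cases K)
  have "a \<in> region K" "b \<in> region K" "c \<in> region K" using vertices_subset_region[of K] K by auto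
  then have "closed_segment a b \<subseteq> region K" "closed_segment b c \<subseteq> region K" "closed_segment c a \<subseteq> region K"
    using convex_region[of K] by (auto simp: convex_contains_segment)
  then show ?thesis using assms unfolding K by auto
qed

lemma edge_distinct:
  assumes "tri_det K \<noteq> 0" "(p, q) \<in> edges K" shows "p \<noteq> q"
  using assms by (cases K) (auto simp: det_defs)

lemma edge_midpoint_in_segment: "edge_midpoint E \<in> segment E"
  by (cases E) simp

lemma apex_exists:
  assumes "E \<in> edges K"
  obtains P where "P \<in> vertices K" "edge_height K E P = \<bar>tri_det K\<bar>"
    "\<And>F. F \<in> edges K \<Longrightarrow> F \<noteq> E \<Longrightarrow> edge_height K F P = 0"
proof -
  obtain a b c where K: "K = (a, b, c)" by (cases K)
  consider "E = (a,b)" | "E = (b,c)" | "E = (c,a)" using assms K by auto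
  then show ?thesis
  proof cases
    case 1 show ?thesis by (rule that[of c]) (use 1 in \<open>auto simp: K edge_height_vertices[OF refl]\<close>)
  next
    case 2 show ?thesis by (rule that[of a]) (use 2 in \<open>auto simp: K edge_height_vertices[OF refl]\<close>)
  next
    case 3 show ?thesis by (rule that[of b]) (use 3 in \<open>auto simp: K edge_height_vertices[OF refl]\<close>)
  qed
qed

lemma edge_height_edge_ends:
  assumes "(p, q) \<in> edges K"
  shows "edge_height K (p, q) p = 0" "edge_height K (p, q) q = 0"
  by (auto simp: edge_height_def det_defs)

lemma other_edge_heights:
  assumes "tri_det K \<noteq> 0" "(p, q) \<in> edges K" "F \<in> edges K" "F \<noteq> (p, q)"
  shows "edge_height K F p + edge_height K F q = \<bar>tri_det K\<bar>" "0 \<le> edge_height K F p" "0 \<le> edge_height K F q"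
  using assms by (cases K, auto simp: edge_height_vertices[OF refl])+

lemma open_segment_heights:
  assumes K: "tri_det K \<noteq> 0" and e: "(p, q) \<in> edges K" and x: "x \<in> open_segment p q"
  shows "edge_height K (p, q) x = 0" "\<And>F. F \<in> edges K \<Longrightarrow> F \<noteq> (p, q) \<Longrightarrow> 0 < edge_height K F x"
proof -
  obtain t where t: "0 < t" "t < 1" "x = (1 - t) *\<^sub>R p + t *\<^sub>R q"
    using x by (auto simp: in_segment)
  show "edge_height K (p, q) x = 0" unfolding t(3) edge_height_affine edge_height_edge_ends[OF e] by simp
  fix F assume F: "F \<in> edges K" "F \<noteq> (p, q)"
  note o = other_edge_heights[OF K e F]
  have "0 < \<bar>tri_det K\<bar>" using K by simp
  then have "0 < edge_height K F p \<or> 0 < edge_height K F q" using o by linarith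
  then show "0 < edge_height K F x" unfolding t(3) edge_height_affine using o t
    by (auto intro: add_pos_nonneg add_nonneg_pos)
qed

text \<open>All other heights are positive on the open edge, hence nearby; only the height over the edge itself
  decides on which side a nearby point lies.\<close>

lemma near_edge_interior:
  assumes K: "tri_det K \<noteq> 0" and e: "(p, q) \<in> edges K" and x: "x \<in> open_segment p q"
  obtains r where "r > 0" "\<And>y. y \<in> ball x r \<Longrightarrow> 0 < edge_height K (p, q) y \<Longrightarrow> y \<in> interior (region K)"
proof -
  define U where "U = (\<Inter>F\<in>edges K - {(p,q)}. {y. 0 < edge_height K F y})"
  have "open {x. 0 < edge_height K E x}" for E
    unfolding edge_height_def
    by (cases E) (auto simp: det_defs intro!: open_Collect_less continuous_intros)
  then have "open U" unfolding U_def by (intro open_INT) (cases K, auto)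
  moreover have "x \<in> U" unfolding U_def using open_segment_heights[OF assms] by auto
  ultimately obtain r where "r > 0" "ball x r \<subseteq> U" by (meson open_contains_ball)
  then show ?thesis
    by (intro that[of r]) (auto simp: interior_region[OF K] U_def)
qed

lemma height_zero_segment:
  assumes K: "tri_det K \<noteq> 0" and e: "E \<in> edges K" and x: "x \<in> region K" "edge_height K E x = 0"
  shows "x \<in> segment E"
proof -
  have *: "x \<in> closed_segment a b" if K: "tri_det (a,b,c) \<noteq> 0" and "x \<in> region (a,b,c)" "edge_height (a,b,c) (a,b) x = 0"
    for a b c
  proof -
    define d where "d = tri_det (a,b,c)"
    have z: "edge_det (a,b) x = 0" using that by (simp add: edge_height_def sgn_eq_0_iff)
    have x: "x = a + (edge_det (c,a) x / d) *\<^sub>R (b - a)"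
      using barycentric[OF K, of x] z d_def by simp
    have "0 \<le> edge_height (a,b,c) (c,a) x" "edge_height (a,b,c) (c,a) x \<le> \<bar>d\<bar>"
      using that(2,3) edge_height_sum[of a b c x] unfolding region_eq[OF K] d_def by auto
    then have "0 \<le> edge_det (c,a) x / d" "edge_det (c,a) x / d \<le> 1"
      using K unfolding edge_height_def d_def[symmetric] by (auto simp: sgn_if field_simps split: if_splits)
    then show ?thesis using x unfolding in_segment
      by (intro exI[of _ "edge_det (c,a) x / d"]) (simp add: algebra_simps)
  qed
  obtain a b c where K': "K = (a, b, c)" by (cases K)
  have rot: "tri_det (b,c,a) = tri_det (a,b,c)" "tri_det (c,a,b) = tri_det (a,b,c)"
    by (simp_all add: det_defs algebra_simps)
  have "region (b,c,a) = region K" "region (c,a,b) = region K"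
    unfolding region_def K' by (simp_all add: insert_commute)
  moreover have "edge_height (b,c,a) F = edge_height K F" "edge_height (c,a,b) F = edge_height K F" for F
    unfolding edge_height_def K' rot by auto
  moreover have "E = (a,b) \<or> E = (b,c) \<or> E = (c,a)" using e K' by auto
  ultimately show ?thesis
    using *[of a b c] *[of b c a] *[of c a b] K x rot unfolding K' by auto
qed

text \<open>If the midpoint has height zero over some edge, then so do both end points, as heights are
  nonnegative on the triangle.\<close>

lemma segment_in_edge_or_interior:
  assumes K: "tri_det K \<noteq> 0" and pq: "p \<in> region K" "q \<in> region K"
  obtains F where "F \<in> edges K" "closed_segment p q \<subseteq> segment F" | "midpoint p q \<in> interior (region K)"
proof (cases "midpoint p q \<in> interior (region K)")
  case False
  then obtain F where F: "F \<in> edges K" "edge_height K F (midpoint p q) \<le> 0"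
    unfolding interior_region[OF K] by (auto simp: not_less)
  have "0 \<le> edge_height K F p" "0 \<le> edge_height K F q" using pq F(1) unfolding region_eq[OF K] by auto
  then have "edge_height K F p = 0" "edge_height K F q = 0" using F(2) unfolding edge_height_midpoint by auto
  then have "p \<in> segment F" "q \<in> segment F" using height_zero_segment[OF K F(1)] pq by auto
  then have "closed_segment p q \<subseteq> segment F" by (cases F) (simp add: subset_closed_segment)
  then show ?thesis using F that by blast
qed (use that in blast)

section \<open>Conforming triangulations and neighbours\<close>

lemma convex_zero_height: "convex {y. edge_height K E y = 0}"
  unfolding convex_alt by (auto simp: edge_height_affine)

lemma opposite_edge:
  assumes "tri_det K \<noteq> 0" "r \<in> vertices K"
  obtains F where "F \<in> edges K" "edge_height K F r \<noteq> 0" "\<And>y. y \<in> vertices K - {r} \<Longrightarrow> edge_height K F y = 0"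
proof -
  obtain a b c where K: "K = (a, b, c)" by (cases K)
  consider "r = a" | "r = b" | "r = c" using assms K by auto
  then show ?thesis
  proof cases
    case 1 show ?thesis by (rule that[of "(b,c)"]) (use 1 assms in \<open>auto simp: K edge_height_vertices[OF refl]\<close>)
  next
    case 2 show ?thesis by (rule that[of "(c,a)"]) (use 2 assms in \<open>auto simp: K edge_height_vertices[OF refl]\<close>)
  next
    case 3 show ?thesis by (rule that[of "(a,b)"]) (use 3 assms in \<open>auto simp: K edge_height_vertices[OF refl]\<close>)
  qed
qed

lemma height_zero_on_hull:
  assumes "tri_det K \<noteq> 0" "r \<in> vertices K" "V \<subseteq> vertices K - {r}"
  obtains F where "F \<in> edges K" "edge_height K F r \<noteq> 0" "\<And>x. x \<in> convex hull V \<Longrightarrow> edge_height K F x = 0"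
proof -
  obtain F where F: "F \<in> edges K" "edge_height K F r \<noteq> 0" "\<And>y. y \<in> vertices K - {r} \<Longrightarrow> edge_height K F y = 0"
    using opposite_edge[OF assms(1,2)] by blast
  have "convex hull V \<subseteq> {y. edge_height K F y = 0}"
    using assms(3) F(3) convex_zero_height by (intro hull_minimal) auto
  then show ?thesis using F that by blast
qed

context
  fixes \<Omega> T
  assumes conf: "conforming_triangulation \<Omega> T"
begin

lemma conf_finite: "finite T"
  using conf by (simp add: conforming_triangulation_def)

lemma conf_det: "K \<in> T \<Longrightarrow> tri_det K \<noteq> 0"
  using conf by (cases K) (auto simp: conforming_triangulation_def collinear_tri_det)

lemma conf_interior: "K \<in> T \<Longrightarrow> interior (region K) \<subseteq> \<Omega>"
  using conf by (auto simp: conforming_triangulation_def)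

lemma conf_cover: "closure \<Omega> = (\<Union>K\<in>T. region K)"
  using conf by (simp add: conforming_triangulation_def)

lemma conf_inter:
  assumes "K \<in> T" "N \<in> T" "K \<noteq> N"
  shows "region K \<inter> region N = convex hull (vertices K \<inter> vertices N)"
  using conf assms unfolding conforming_triangulation_def by blast

text \<open>The common vertices omit a vertex of \<open>K\<close>, so their hull lies on the opposite edge of \<open>K\<close>.\<close>

lemma conf_disjoint:
  assumes "K \<in> T" "N \<in> T" "x \<in> interior (region K)" "x \<in> region N"
  shows "K = N"
proof (rule ccontr)
  assume ne: "K \<noteq> N"
  have card: "card (vertices K) = 3" "card (vertices N) = 3" and vne: "vertices K \<noteq> vertices N"
    using conf assms(1,2) ne unfolding conforming_triangulation_def by blast+
  have "\<not> vertices K \<subseteq> vertices N"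
    using card vne card_subset_eq[of "vertices N" "vertices K"] by (metis card.infinite zero_neq_numeral)
  then obtain r where r: "r \<in> vertices K" "r \<notin> vertices N" by blast
  obtain F where F: "F \<in> edges K" "\<And>x. x \<in> convex hull (vertices K \<inter> vertices N) \<Longrightarrow> edge_height K F x = 0"
    using height_zero_on_hull[of K r "vertices K \<inter> vertices N"] conf_det assms(1) r by blast
  have "x \<in> region K" using assms(3) interior_subset by blast
  then have "edge_height K F x = 0" using conf_inter[OF assms(1,2) ne] F(2) assms(4) by blast
  then show False using assms(3) F(1) unfolding interior_region[OF conf_det[OF assms(1)]] by force
qed

text \<open>A point of the open edge is not in the hull of common vertices that omit \<open>p\<close> or \<open>q\<close>, because
  the height over the edge opposite to the omitted vertex is positive there.\<close>

lemma shared_ends: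
  assumes K: "K \<in> T" and N: "N \<in> T" and ne: "K \<noteq> N" and e: "(p, q) \<in> edges K"
    and x: "x \<in> open_segment p q" "x \<in> region N"
  shows "(p, q) \<in> edges N \<or> (q, p) \<in> edges N"
proof -
  note d = conf_det[OF K]
  have "x \<in> region K" using segment_subset_region[OF e] x(1) by (auto simp: open_segment_def)
  then have xh: "x \<in> convex hull (vertices K \<inter> vertices N)" using conf_inter[OF K N ne] x(2) by blast
  have "r \<in> vertices N" if r: "r = p \<or> r = q" for r
  proof (rule ccontr)
    assume "r \<notin> vertices N"
    moreover have "r \<in> vertices K" using e r by (cases K) auto
    ultimately obtain F where F: "F \<in> edges K" "edge_height K F r \<noteq> 0" "edge_height K F x = 0"
      using height_zero_on_hull[of K r "vertices K \<inter> vertices N"] d xh by blast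
    then have "F \<noteq> (p, q)" using edge_height_edge_ends[OF e] r by auto
    then show False using open_segment_heights(2)[OF d e x(1) F(1)] F(3) by simp
  qed
  then have "p \<in> vertices N" "q \<in> vertices N" by auto
  then show ?thesis using edge_distinct[OF d e] by (cases N) auto
qed

end

lemma side_points:
  assumes "E \<in> edges K" "tri_det K \<noteq> 0" "edge_height K E x = 0" "r > 0"
  obtains y z where "y \<in> ball x r" "edge_height K E y > 0" "z \<in> ball x r" "edge_height K E z < 0"
proof -
  obtain P where P: "edge_height K E P = \<bar>tri_det K\<bar>" using apex_exists[OF assms(1)] by metis
  \<comment> \<open>Move from \<open>x\<close> towards the opposite vertex, and away from it, by less than \<open>r\<close>.\<close>
  define t where "t = r / (norm (P - x) + 1)"
  have pos: "norm (P - x) + 1 > 0" by (simp add: add_nonneg_pos)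
  have t: "t > 0" unfolding t_def using assms(4) pos by simp
  have "t * norm (P - x) < t * (norm (P - x) + 1)" using t by simp
  also have "\<dots> = r" unfolding t_def using pos by simp
  finally have d: "t * norm (P - x) < r" .
  have dist: "dist x ((1 - s) *\<^sub>R x + s *\<^sub>R P) = \<bar>s\<bar> * norm (P - x)" for s
  proof -
    have "x - ((1 - s) *\<^sub>R x + s *\<^sub>R P) = (- s) *\<^sub>R (P - x)" by (simp add: algebra_simps)
    then show ?thesis unfolding dist_norm by simp
  qed
  show ?thesis
  proof (rule that)
    show "(1 - t) *\<^sub>R x + t *\<^sub>R P \<in> ball x r" "(1 - (-t)) *\<^sub>R x + (-t) *\<^sub>R P \<in> ball x r"
      unfolding mem_ball dist using d t by simp_all
    show "edge_height K E ((1 - t) *\<^sub>R x + t *\<^sub>R P) > 0" "edge_height K E ((1 - (-t)) *\<^sub>R x + (-t) *\<^sub>R P) < 0"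
      unfolding edge_height_affine assms(3) P using t assms(2) by simp_all
  qed
qed

lemma segment_eq_iff: "segment E = segment (p, q) \<longleftrightarrow> E = (p, q) \<or> E = (q, p)"
  by (cases E) (auto simp: closed_segment_eq doubleton_eq_iff)

lemma edges_segment_inj:
  assumes "tri_det K \<noteq> 0" "E \<in> edges K" "F \<in> edges K" "segment E = segment F"
  shows "E = F"
proof -
  obtain p q where F: "F = (p, q)" by (cases F)
  have "(p,q) \<in> edges K \<Longrightarrow> (q,p) \<in> edges K \<Longrightarrow> p = q" using assms(1) by (cases K) (auto simp: det_defs)
  then show ?thesis using assms segment_eq_iff[of E p q] edge_distinct[of K p q] unfolding F by auto
qed

lemma edge_midpoint_open:
  assumes "tri_det K \<noteq> 0" "(p, q) \<in> edges K" shows "edge_midpoint (p, q) \<in> open_segment p q"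
  using edge_distinct[OF assms] by simp

lemma opposite_heights_swap:
  assumes "segment E' = segment E" "tri_det K \<noteq> 0" "tri_det N \<noteq> 0"
  obtains s where "s = 1 \<or> s = -1" "\<And>x. edge_height N E' x = s * edge_height K E x" 
proof -
  obtain p q where E: "E = (p, q)" by (cases E)
  have sw: "edge_det (q, p) x = - edge_det (p, q) x" for x by (simp add: det_defs algebra_simps)
  define s where "s = (if E' = (p,q) then 1 else -1) * sgn (tri_det N) * sgn (tri_det K)"
  have "E' = (p, q) \<or> E' = (q, p)" using assms segment_eq_iff E by blast
  then have "edge_height N E' x = s * edge_height K E x" for x
    unfolding E edge_height_def s_def using assms by (auto simp: sw sgn_if)
  moreover have "s = 1 \<or> s = -1" unfolding s_def
    using assms by (auto simp: sgn_if)
  ultimately show ?thesis using that by blast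
qed

context
  fixes \<Omega> T
  assumes conf: "conforming_triangulation \<Omega> T"
begin

text \<open>Two triangles with a common edge lie on opposite sides of it, since otherwise their interiors
  would meet near its midpoint. Stated for heights, this is the cancellation of the fluxes of
  \<open>x - P\<close> through the edge, for every \<open>P\<close>, whatever the orientation of the triangles.\<close>

lemma opposite_heights:
  assumes K: "K \<in> T" and N: "N \<in> T" and ne: "K \<noteq> N" and e: "E \<in> edges K"
    and e': "E' \<in> edges N" and s: "segment E' = segment E"
  shows "edge_height N E' x = - edge_height K E x"
proof -
  note dK = conf_det[OF conf K] and dN = conf_det[OF conf N]
  obtain p q where E: "E = (p, q)" by (cases E)
  obtain s where s1: "s = 1 \<or> s = -1" and sh: "\<And>x. edge_height N E' x = s * edge_height K E x"
    using opposite_heights_swap[OF s dK dN] by metis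
  have "s \<noteq> 1"
  proof
    assume "s = 1"
    then have same: "edge_height N E' x = edge_height K E x" for x using sh by simp
    define m where "m = edge_midpoint (p, q)"
    have m: "m \<in> open_segment p q" using edge_midpoint_open[OF dK, of p q] e E m_def by simp
    obtain r where r: "r > 0" "\<And>y. y \<in> ball m r \<Longrightarrow> 0 < edge_height K (p, q) y \<Longrightarrow> y \<in> interior (region K)"
      using near_edge_interior[OF dK _ m] e E by blast
    obtain p' q' where E': "E' = (p', q')" by (cases E')
    have m': "m \<in> open_segment p' q'" using m s E E' segment_eq_iff[of E' p q] by (auto simp: open_segment_commute)
    obtain r' where r': "r' > 0" "\<And>y. y \<in> ball m r' \<Longrightarrow> 0 < edge_height N (p', q') y \<Longrightarrow> y \<in> interior (region N)"
      using near_edge_interior[OF dN _ m'] e' E' by blast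
    have "edge_height K E m = 0" using open_segment_heights(1)[OF dK _ m] e E by simp
    then obtain y where y: "y \<in> ball m (min r r')" "edge_height K E y > 0"
      using side_points[OF e dK, of m "min r r'"] r(1) r'(1) by auto
    then have "y \<in> interior (region K)" "y \<in> interior (region N)"
      using r(2) r'(2) same[of y] E E' by auto
    then show False using conf_disjoint[OF conf K N] ne interior_subset by blast
  qed
  then show ?thesis using s1 sh by auto
qed

text \<open>Of three triangles with a common edge, two would lie on the same side.\<close>

lemma neighbour_unique:
  assumes K: "K \<in> T" and e: "E \<in> edges K"
    and N: "N \<in> T" "N \<noteq> K" "segment E \<in> segment ` edges N"
    and N': "N' \<in> T" "N' \<noteq> K" "segment E \<in> segment ` edges N'"
  shows "N' = N"
proof (rule ccontr)
  assume ne: "N' \<noteq> N"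
  obtain F where F: "F \<in> edges N" "segment F = segment E" using N(3) by auto
  obtain F' where F': "F' \<in> edges N'" "segment F' = segment E" using N'(3) by auto
  obtain P where P: "edge_height K E P = \<bar>tri_det K\<bar>" using apex_exists[OF e] by metis
  have "edge_height N F P = - edge_height K E P"
    by (rule opposite_heights[OF K N(1) N(2)[symmetric] e F])
  moreover have "edge_height N' F' P = - edge_height K E P"
    by (rule opposite_heights[OF K N'(1) N'(2)[symmetric] e F'])
  moreover have "edge_height N' F' P = - edge_height N F P"
    by (rule opposite_heights[OF N(1) N'(1) ne[symmetric] F(1) F'(1)]) (simp add: F F')
  ultimately show False using P conf_det[OF conf K] by simp
qed

lemma neighbourI:
  assumes "K \<in> T" "E \<in> edges K" "N \<in> T" "N \<noteq> K" "segment E \<in> segment ` edges N"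
  shows "neighbour T K E = N"
  unfolding neighbour_def
proof (rule the_equality)
  show "N \<in> T \<and> N \<noteq> K \<and> segment E \<in> segment ` edges N" using assms(3-5) by blast
  show "N' = N" if "N' \<in> T \<and> N' \<noteq> K \<and> segment E \<in> segment ` edges N'" for N'
    by (rule neighbour_unique[OF assms]) (use that in blast)+
qed

lemma neighbour_meets:
  assumes "K \<in> T" "(p, q) \<in> edges K" "N \<in> T" "N \<noteq> K" "x \<in> open_segment p q" "x \<in> region N"
  shows "neighbour T K (p, q) = N"
proof -
  have "(p, q) \<in> edges N \<or> (q, p) \<in> edges N" using shared_ends[OF conf] assms by metis
  then have "segment (p, q) \<in> segment ` edges N"
    by (metis image_eqI segment_eq_iff)
  then show ?thesis using neighbourI assms by blast
qed

lemma interior_edge: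
  assumes "K \<in> T" "(p, q) \<in> edges K" "\<not> closed_segment p q \<subseteq> frontier \<Omega>"
  shows "open_segment p q \<subseteq> \<Omega>"
  using conf assms unfolding conforming_triangulation_def by blast

text \<open>The midpoint of the edge lies in \<open>\<Omega>\<close>, and so do nearby points beyond the edge. They are covered by
  triangles that contain the midpoint, as the union of the others is closed.\<close>

lemma neighbour_props:
  assumes op: "open \<Omega>" and K: "K \<in> T" and e: "E \<in> edges K" and nf: "\<not> segment E \<subseteq> frontier \<Omega>"
  defines "N \<equiv> neighbour T K E"
  shows "N \<in> T" "N \<noteq> K" "segment E \<in> segment ` edges N"
proof -
  note dK = conf_det[OF conf K]
  obtain p q where E: "E = (p, q)" by (cases E)
  have m: "edge_midpoint E \<in> open_segment p q" using edge_midpoint_open[OF dK, of p q] e E by simp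
  define m where "m = edge_midpoint E"
  have sub: "open_segment p q \<subseteq> \<Omega>" using interior_edge[OF K, of p q] e nf E by simp
  define C where "C = (\<Union>N\<in>{N\<in>T. m \<notin> region N}. region N)"
  have "closed C" unfolding C_def using conf_finite[OF conf] compact_region
    by (intro closed_UN) (auto intro: compact_imp_closed)
  then have "open (\<Omega> - C)" using op by (intro open_Diff)
  moreover have "m \<in> \<Omega> - C" using m sub unfolding m_def C_def by auto
  ultimately obtain r where r: "r > 0" "ball m r \<subseteq> \<Omega> - C" by (meson open_contains_ball)
  have "edge_height K E m = 0" using open_segment_heights(1)[OF dK _ m] e E m_def by simp
  then obtain y where y: "y \<in> ball m r" "edge_height K E y < 0"
    using side_points[OF e dK _ r(1)] by metis
  then have "y \<in> closure \<Omega>" "y \<notin> C" using r closure_subset by blast+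
  then obtain N' where N': "N' \<in> T" "y \<in> region N'" "m \<in> region N'"
    unfolding conf_cover[OF conf] C_def by blast
  have "0 \<le> edge_height K E y" if "y \<in> region K" using that e unfolding region_eq[OF dK] by blast
  then have "N' \<noteq> K" using y(2) N'(2) by auto
  have "neighbour T K (p, q) = N'"
    using neighbour_meets[OF K _ N'(1) \<open>N' \<noteq> K\<close> m] N'(3) e m_def E by simp
  then have N: "N = N'" unfolding N_def E by simp
  show "N \<in> T" "N \<noteq> K" using N N' \<open>N' \<noteq> K\<close> by auto
  have "(p, q) \<in> edges N' \<or> (q, p) \<in> edges N'"
    using shared_ends[OF conf K N'(1)] \<open>N' \<noteq> K\<close> e E m N'(3) m_def by metis
  then show "segment E \<in> segment ` edges N" unfolding N E by (metis image_eqI segment_eq_iff)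
qed

end

section \<open>Bisection trees\<close>

text \<open>The leaves of a finite bisection tree over the root. They need not form a conforming mesh, since the
  intermediate stages of a refinement may have hanging nodes.\<close>

inductive bis_tree :: "tri \<Rightarrow> tri set \<Rightarrow> bool" where
  leaf: "bis_tree K {K}"
| node: "bis_tree (midpoint b c, a, b) S1 \<Longrightarrow> bis_tree (midpoint b c, c, a) S2 \<Longrightarrow> bis_tree (a, b, c) (S1 \<union> S2)"

lemma tri_det_children:
  "tri_det (midpoint b c, a, b) = tri_det (a, b, c) / 2"
  "tri_det (midpoint b c, c, a) = tri_det (a, b, c) / 2"
  by (simp_all add: det_defs midpoint_nth field_simps)

text \<open>The parallelogram law. In the reference frame a child arises by a rotation through 45 degrees and
  scaling by \<open>1/sqrt 2\<close>, hence area and \<open>size2\<close> are both halved, and the shape is preserved exactly.\<close>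

lemma size2_children:
  "size2 (midpoint b c, a, b) = size2 (a, b, c) / 2"
  "size2 (midpoint b c, c, a) = size2 (a, b, c) / 2"
  unfolding size2.simps norm_sq2 by (simp_all add: midpoint_nth power2_eq_square field_simps)

lemma area_children:
  "area (midpoint b c, a, b) = area (a, b, c) / 2"
  "area (midpoint b c, c, a) = area (a, b, c) / 2"
  by (simp_all add: area_def tri_det_children)

lemma height_children:
  fixes a b c :: point
  defines "K \<equiv> (a, b, c)" and "m \<equiv> midpoint b c"
  defines "K1 \<equiv> (m, a, b)" and "K2 \<equiv> (m, c, a)"
  shows "edge_height K1 (m, a) x = (edge_height K (c, a) x - edge_height K (a, b) x) / 2"
    "edge_height K1 (a, b) x = edge_height K (a, b) x"
    "edge_height K1 (b, m) x = edge_height K (b, c) x / 2"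
    "edge_height K2 (m, c) x = edge_height K (b, c) x / 2"
    "edge_height K2 (c, a) x = edge_height K (c, a) x"
    "edge_height K2 (a, m) x = (edge_height K (a, b) x - edge_height K (c, a) x) / 2"
proof -
  have s: "sgn (tri_det K1) = sgn (tri_det K)" "sgn (tri_det K2) = sgn (tri_det K)"
    unfolding K1_def K2_def m_def K_def tri_det_children by (auto simp: sgn_if)
  show "edge_height K1 (m, a) x = (edge_height K (c, a) x - edge_height K (a, b) x) / 2"
    "edge_height K1 (a, b) x = edge_height K (a, b) x"
    "edge_height K1 (b, m) x = edge_height K (b, c) x / 2"
    "edge_height K2 (m, c) x = edge_height K (b, c) x / 2"
    "edge_height K2 (c, a) x = edge_height K (c, a) x"
    "edge_height K2 (a, m) x = (edge_height K (a, b) x - edge_height K (c, a) x) / 2"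
    unfolding edge_height_def s
    by (simp_all add: m_def det_defs midpoint_nth field_simps)
qed

lemma region_children:
  fixes a b c :: point
  assumes "tri_det (a, b, c) \<noteq> 0"
  defines "K1 \<equiv> (midpoint b c, a, b)" and "K2 \<equiv> (midpoint b c, c, a)"
  shows "region K1 \<union> region K2 = region (a, b, c)"
    "interior (region K1) \<inter> interior (region K2) = {}"
    "tri_det K1 \<noteq> 0" "tri_det K2 \<noteq> 0"
proof -
  show d: "tri_det K1 \<noteq> 0" "tri_det K2 \<noteq> 0"
    using assms(1) unfolding K1_def K2_def tri_det_children by auto
  show "region K1 \<union> region K2 = region (a, b, c)"
    unfolding region_eq[OF d(1)] region_eq[OF d(2)] region_eq[OF assms(1)]
    unfolding K1_def K2_def edges.simps ball_simps height_children by auto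
  show "interior (region K1) \<inter> interior (region K2) = {}"
    unfolding interior_region[OF d(1)] interior_region[OF d(2)]
    unfolding K1_def K2_def edges.simps ball_simps height_children by auto
qed

lemma tree_finite: "bis_tree K S \<Longrightarrow> finite S \<and> S \<noteq> {}"
  by (induction rule: bis_tree.induct) auto

lemma tree_det: "bis_tree K S \<Longrightarrow> tri_det K \<noteq> 0 \<Longrightarrow> L \<in> S \<Longrightarrow> tri_det L \<noteq> 0"
  by (induction rule: bis_tree.induct) (auto simp: tri_det_children)

text \<open>Shape regularity of newest vertex bisection: the ratio of \<open>size2\<close> to the area never changes.\<close>

lemma tree_shape: 
  assumes "bis_tree K S" "L \<in> S" shows "size2 L * area K = size2 K * area L"
  using assms
proof (induction rule: bis_tree.induct)
  case (node b c a S1 S2)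
  then show ?case unfolding Un_iff area_children size2_children by (auto simp: field_simps)
qed auto

lemma tree_area_le: "bis_tree K S \<Longrightarrow> L \<in> S \<Longrightarrow> area L \<le> area K"
proof (induction rule: bis_tree.induct)
  case (node b c a S1 S2)
  have "0 \<le> area (a, b, c)" by (simp add: area_def)
  then show ?case using node unfolding Un_iff area_children by force
qed auto

lemma tree_area_half:
  assumes "bis_tree K S" "L \<in> S" "L \<noteq> K" shows "area L \<le> area K / 2"
  using assms(1)
proof cases
  case (node b c a S1 S2)
  consider "L \<in> S1" | "L \<in> S2" using assms(2) node(2) by blast
  then show ?thesis
  proof cases
    case 1 then show ?thesis using tree_area_le[OF node(3) 1] unfolding node(1) area_children by simp
  next
    case 2 then show ?thesis using tree_area_le[OF node(4) 2] unfolding node(1) area_children by simp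
  qed
qed (use assms in auto)

lemma tree_region: 
  assumes "bis_tree K S" "tri_det K \<noteq> 0" shows "(\<Union>L\<in>S. region L) = region K"
  using assms
proof (induction rule: bis_tree.induct)
  case (node b c a S1 S2)
  then show ?case using region_children[OF node.prems] by (simp add: image_Un)
qed auto

lemma tree_interior_mono:
  assumes "bis_tree K S" "tri_det K \<noteq> 0" "L \<in> S"
  shows "region L \<subseteq> region K" "interior (region L) \<subseteq> interior (region K)"
proof -
  show "region L \<subseteq> region K" using tree_region[OF assms(1,2)] assms(3) by auto
  then show "interior (region L) \<subseteq> interior (region K)" by (rule interior_mono)
qed

lemma tree_disjoint_children:
  assumes d: "tri_det (a, b, c) \<noteq> 0"
    and t: "bis_tree (midpoint b c, a, b) S1" "bis_tree (midpoint b c, c, a) S2"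
    and L: "L \<in> S1" "L' \<in> S2"
  shows "interior (region L) \<inter> interior (region L') = {}"
  using region_children[OF d] tree_interior_mono(2)[OF t(1) _ L(1)] tree_interior_mono(2)[OF t(2) _ L(2)] by blast

lemma tree_children_disjoint:
  assumes d: "tri_det (a, b, c) \<noteq> 0"
    and t: "bis_tree (midpoint b c, a, b) S1" "bis_tree (midpoint b c, c, a) S2"
  shows "S1 \<inter> S2 = {}"
proof (rule ccontr)
  assume "S1 \<inter> S2 \<noteq> {}"
  then obtain L where L: "L \<in> S1" "L \<in> S2" by blast
  then have "interior (region L) = {}" using tree_disjoint_children[OF d t L] by simp
  moreover have "tri_det L \<noteq> 0" using tree_det[OF t(1) region_children(3)[OF d] L(1)] .
  ultimately show False using centroid_interior by blast
qed

lemma tree_disjoint: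
  assumes "bis_tree K S" "tri_det K \<noteq> 0" "L \<in> S" "L' \<in> S" "L \<noteq> L'"
  shows "interior (region L) \<inter> interior (region L') = {}"
  using assms
proof (induction rule: bis_tree.induct)
  case (node b c a S1 S2)
  note d = node.prems(1)
  show ?case
    using node.IH node.prems region_children(3,4)[OF d] 
      tree_disjoint_children[OF d node.hyps, of L L'] tree_disjoint_children[OF d node.hyps, of L' L]
    by (auto simp: Int_commute)
qed auto

lemma tree_subst:
  assumes "bis_tree K R" "\<And>r. r \<in> R \<Longrightarrow> bis_tree r (\<sigma> r)"
  shows "bis_tree K (\<Union>r\<in>R. \<sigma> r)"
  using assms
proof (induction rule: bis_tree.induct)
  case (node b c a S1 S2)
  then show ?case by (auto simp: UN_Un intro!: bis_tree.node)
qed auto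

lemma tree_children: "bis_tree K (children K)"
proof (cases K)
  case (fields a b c)
  have "bis_tree (a, b, c) ({(midpoint b c, a, b)} \<union> {(midpoint b c, c, a)})"
    by (intro bis_tree.intros)
  then show ?thesis unfolding fields by (simp add: insert_commute)
qed

definition forest :: "mesh \<Rightarrow> mesh \<Rightarrow> (tri \<Rightarrow> tri set) \<Rightarrow> bool" where
  "forest T T' \<sigma> \<longleftrightarrow> (\<forall>K\<in>T. bis_tree K (\<sigma> K)) \<and> T' = (\<Union>K\<in>T. \<sigma> K)"

lemma bisects_forest:
  assumes "bisects\<^sup>*\<^sup>* T T'" shows "\<exists>\<sigma>. forest T T' \<sigma>"
  using assms
proof (induction rule: rtranclp_induct)
  case base
  show ?case unfolding forest_def by (intro exI[of _ "\<lambda>K. {K}"]) (auto intro: bis_tree.leaf)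
next
  case (step T1 T2)
  then obtain \<sigma> where \<sigma>: "\<forall>K\<in>T. bis_tree K (\<sigma> K)" "T1 = (\<Union>K\<in>T. \<sigma> K)" unfolding forest_def by blast
  obtain M where M: "M \<in> T1" "T2 = (T1 - {M}) \<union> children M" using step.hyps(2) unfolding bisects_def by blast
  define \<tau> where "\<tau> L = (if L = M then children M else {L})" for L
  have \<tau>: "bis_tree L (\<tau> L)" for L unfolding \<tau>_def using tree_children bis_tree.leaf by simp
  have "T2 = (\<Union>L\<in>T1. \<tau> L)" unfolding M(2) \<tau>_def using M(1) by (auto split: if_splits)
  also have "\<dots> = (\<Union>K\<in>T. \<Union>L\<in>\<sigma> K. \<tau> L)" unfolding \<sigma>(2) by blast
  finally have "forest T T2 (\<lambda>K. \<Union>L\<in>\<sigma> K. \<tau> L)" 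
    unfolding forest_def using \<sigma>(1) \<tau> by (auto intro!: tree_subst)
  then show ?case by blast
qed

text \<open>For a conforming mesh that refines \<open>K\<close> these are the leaves of the tree over \<open>K\<close> (\<open>tree_leaves\<close>), so that
  the tree is determined by its root and the mesh.\<close>

definition leaves :: "mesh \<Rightarrow> tri \<Rightarrow> mesh" where
  "leaves T' K = {L \<in> T'. region L \<subseteq> region K}"

context
  fixes \<Omega> T'
  assumes conf: "conforming_triangulation \<Omega> T'"
begin

text \<open>The leaves cover the root, and in a conforming mesh different triangles have disjoint interiors.\<close>

lemma tree_meets:
  assumes t: "bis_tree K S" "tri_det K \<noteq> 0" "S \<subseteq> T'" and L: "L \<in> T'" and x: "x \<in> interior (region L)" "x \<in> region K"
  shows "L \<in> S"
proof -
  obtain N where N: "N \<in> S" "x \<in> region N" using tree_region[OF t(1,2)] x(2) by blast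
  then have "L = N" using conf_disjoint[OF conf L _ x(1)] t(3) by blast
  then show ?thesis using N by simp
qed

lemma tree_meets':
  assumes t: "bis_tree K S" "tri_det K \<noteq> 0" "S \<subseteq> T'" and L: "L \<in> T'" and x: "x \<in> region L" "x \<in> interior (region K)"
  shows "L \<in> S"
proof -
  have "x \<in> closure (interior (region L))" using closure_interior_region[OF conf_det[OF conf L]] x(1) by simp
  then obtain y where "y \<in> interior (region L)" "y \<in> interior (region K)"
    using x(2) open_Int_closure_eq_empty[of "interior (region K)" "interior (region L)"] by blast
  then show ?thesis using tree_meets[OF t L] interior_subset by blast
qed

lemma tree_leaves:
  assumes t: "bis_tree K S" "tri_det K \<noteq> 0" "S \<subseteq> T'"
  shows "S = leaves T' K"
proof
  show "S \<subseteq> leaves T' K" unfolding leaves_def using t(3) tree_interior_mono(1)[OF t(1,2)] by blast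
  show "leaves T' K \<subseteq> S"
  proof
    fix L assume "L \<in> leaves T' K"
    then have L: "L \<in> T'" "region L \<subseteq> region K" by (auto simp: leaves_def)
    then show "L \<in> S" using tree_meets[OF t L(1) centroid_interior[OF conf_det[OF conf L(1)]]]
        centroid_interior[OF conf_det[OF conf L(1)]] interior_subset by blast
  qed
qed

end

section \<open>Piecewise affine fields and their traces\<close>

definition affine_on :: "field \<Rightarrow> tri \<Rightarrow> bool" where
  "affine_on v K \<longleftrightarrow> (\<exists>A c. \<forall>x\<in>interior (region K). v x = A *v x + c)"

definition slope :: "field \<Rightarrow> tri \<Rightarrow> real^2^2" where
  "slope v K = grad v (centroid K)"

text \<open>The affine extension of \<open>v\<close> from the interior of \<open>K\<close>, and hence its trace on the boundary of \<open>K\<close>.\<close>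

definition extension :: "field \<Rightarrow> tri \<Rightarrow> point \<Rightarrow> point" where
  "extension v K x = v (centroid K) + slope v K *v (x - centroid K)"

lemma grad_affine:
  assumes "\<forall>x\<in>interior (region K). v x = A *v x + c" "x \<in> interior (region K)"
  shows "grad v x = A"
proof -
  have "((\<lambda>x. A *v x + c) has_derivative (\<lambda>h. A *v h)) (at x)"
    by (auto intro!: derivative_eq_intros bounded_linear_imp_has_derivative matrix_vector_mul_bounded_linear)
  then have "(v has_derivative (\<lambda>h. A *v h)) (at x)"
    using assms by (elim has_derivative_transform_within_open[where s = "interior (region K)"]) auto
  then have "frechet_derivative v (at x) = (\<lambda>h. A *v h)" by (metis frechet_derivative_at)
  then show ?thesis by (simp add: grad_def jacobian_def)
qed

lemma affine_data:
  assumes K: "tri_det K \<noteq> 0" and v: "\<forall>x\<in>interior (region K). v x = A *v x + c"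
  shows "slope v K = A" "extension v K x = A *v x + c"
proof -
  show s: "slope v K = A" unfolding slope_def using grad_affine[OF v] centroid_interior[OF K] .
  show "extension v K x = A *v x + c" unfolding extension_def s using v centroid_interior[OF K] 
    by (simp add: matrix_vector_mult_diff_distrib)
qed

lemma affine_ext:
  assumes K: "tri_det K \<noteq> 0" and v: "affine_on v K" and x: "x \<in> interior (region K)"
  shows "v x = extension v K x" "grad v x = slope v K"
proof -
  obtain A c where A: "\<forall>x\<in>interior (region K). v x = A *v x + c" using v unfolding affine_on_def by blast
  show "v x = extension v K x" "grad v x = slope v K" using affine_data[OF K A] grad_affine[OF A x] A x by auto
qed

lemma ext_diff: "extension v K x - extension v K y = slope v K *v (x - y)"
  by (simp add: extension_def matrix_vector_mult_diff_distrib)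

lemma affine_on_subset:
  assumes K: "tri_det K \<noteq> 0" "tri_det L \<noteq> 0" and v: "affine_on v K" and sub: "region L \<subseteq> region K"
  shows "affine_on v L" "slope v L = slope v K" "extension v L x = extension v K x"
proof -
  obtain A c where A: "\<forall>x\<in>interior (region K). v x = A *v x + c" using v unfolding affine_on_def by blast
  then have A': "\<forall>x\<in>interior (region L). v x = A *v x + c" using interior_mono[OF sub] by auto
  then show "affine_on v L" unfolding affine_on_def by blast
  show "slope v L = slope v K" "extension v L x = extension v K x" using affine_data[OF K(1) A] affine_data[OF K(2) A'] by auto
qed

lemma affine_on_comb:
  fixes r :: real
  assumes K: "tri_det K \<noteq> 0" and u: "affine_on u K" and v: "affine_on v K"
  defines "w \<equiv> \<lambda>x. u x - r *\<^sub>R v x"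
  shows "affine_on w K" "slope w K = slope u K - r *\<^sub>R slope v K" "extension w K x = extension u K x - r *\<^sub>R extension v K x"
proof -
  obtain A c where A: "\<forall>x\<in>interior (region K). u x = A *v x + c" using u unfolding affine_on_def by blast
  obtain B d where B: "\<forall>x\<in>interior (region K). v x = B *v x + d" using v unfolding affine_on_def by blast
  have W: "\<forall>x\<in>interior (region K). w x = (A - r *\<^sub>R B) *v x + (c - r *\<^sub>R d)"
    using A B by (simp add: w_def matrix_vector_mult_diff_rdistrib scaleR_matrix_vector_assoc[symmetric] scaleR_add_right)
  then show "affine_on w K" unfolding affine_on_def by blast
  show "slope w K = slope u K - r *\<^sub>R slope v K" "extension w K x = extension u K x - r *\<^sub>R extension v K x"
    using affine_data[OF K A] affine_data[OF K B] affine_data[OF K W]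
    by (auto simp: matrix_vector_mult_diff_rdistrib scaleR_matrix_vector_assoc[symmetric] scaleR_add_right)
qed

lemma affine_on_diff:
  assumes K: "tri_det K \<noteq> 0" and u: "affine_on u K" and v: "affine_on v K"
  shows "affine_on (\<lambda>x. u x - v x) K" "slope (\<lambda>x. u x - v x) K = slope u K - slope v K"
    "extension (\<lambda>x. u x - v x) K x = extension u K x - extension v K x"
  using affine_on_comb[OF assms, of 1] by simp_all

lemma inner_trace_eq:
  assumes K: "tri_det K \<noteq> 0" and g: "\<And>y. y \<in> interior (region K) \<Longrightarrow> g y = h y"
    and h: "isCont h x" and x: "x \<in> region K"
  shows "inner_trace K g x = h x"
proof -
  have "x \<in> closure (interior (region K))" using closure_interior_region[OF K] x by simp
  then have "x islimpt interior (region K)"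
    using interior_limit_point[of x "interior (region K)"] unfolding closure_def by auto
  then have nb: "at x within interior (region K) \<noteq> bot" by (simp add: trivial_limit_within)
  have "(h \<longlongrightarrow> h x) (at x within interior (region K))"
    using h by (simp add: isCont_def tendsto_within_subset[where S = UNIV])
  moreover have "\<forall>\<^sub>F y in at x within interior (region K). h y = g y"
    using g by (simp add: eventually_at_filter)
  ultimately have "(g \<longlongrightarrow> h x) (at x within interior (region K))"
    by (rule Lim_transform_eventually)
  then show ?thesis unfolding inner_trace_def using nb by (rule tendsto_Lim[rotated])
qed

lemma isCont_ext: "isCont (extension v K) x"
proof -
  have "extension v K = (\<lambda>x. v (centroid K) + (slope v K *v x - slope v K *v centroid K))"
    by (simp add: extension_def matrix_vector_mult_diff_distrib fun_eq_iff)
  then show ?thesis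
    by (simp add: continuous_intros linear_continuous_at[OF matrix_vector_mul_bounded_linear])
qed

lemma inner_trace_affine:
  assumes "tri_det K \<noteq> 0" "affine_on v K" "x \<in> region K"
  shows "inner_trace K v x = extension v K x"
  using inner_trace_eq[OF assms(1) _ isCont_ext assms(3)] affine_ext(1)[OF assms(1,2)] by blast

lemma inner_trace_grad:
  assumes "tri_det K \<noteq> 0" "affine_on v K" "x \<in> region K"
  shows "inner_trace K (\<lambda>x. grad v x *v t) x = slope v K *v t"
  using inner_trace_eq[OF assms(1) _ _ assms(3), of "\<lambda>x. grad v x *v t" "\<lambda>x. slope v K *v t"]
    affine_ext(2)[OF assms(1,2)] by simp

text \<open>The Crouzeix-Raviart conditions in terms of affine extensions. As the jump across an edge is affine
  along the edge, its value at the midpoint is its mean.\<close>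

definition weakly_continuous :: "point set \<Rightarrow> mesh \<Rightarrow> field \<Rightarrow> bool" where
  "weakly_continuous \<Omega> T v \<longleftrightarrow> (\<forall>K\<in>T. affine_on v K) \<and>
     (\<forall>K\<in>T. \<forall>E\<in>edges K.
        (segment E \<subseteq> frontier \<Omega> \<longrightarrow> extension v K (edge_midpoint E) = 0) \<and>
        (\<not> segment E \<subseteq> frontier \<Omega> \<longrightarrow> extension v (neighbour T K E) (edge_midpoint E) = extension v K (edge_midpoint E)))"

lemma crouzeix_raviart_weakly_continuous:
  assumes conf: "conforming_triangulation \<Omega> T" and op: "open \<Omega>" and v: "v \<in> crouzeix_raviart \<Omega> T"
  shows "weakly_continuous \<Omega> T v"
  unfolding weakly_continuous_def
proof (intro conjI ballI impI)
  have aff: "affine_on v K" if "K \<in> T" for K using v that unfolding crouzeix_raviart_def affine_on_def by blast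
  then show "affine_on v K" if "K \<in> T" for K using that .
  fix K E assume KE: "K \<in> T" "E \<in> edges K"
  have j: "jump \<Omega> T K E v (edge_midpoint E) = 0" using v KE unfolding crouzeix_raviart_def by blast
  have m: "edge_midpoint E \<in> region K" using segment_subset_region[OF KE(2)] edge_midpoint_in_segment by blast
  show "extension v K (edge_midpoint E) = 0" if "segment E \<subseteq> frontier \<Omega>"
    using j that inner_trace_affine[OF conf_det[OF conf KE(1)] aff[OF KE(1)] m] by (simp add: jump_def)
  assume nf: "\<not> segment E \<subseteq> frontier \<Omega>"
  note N = neighbour_props[OF conf op KE nf]
  obtain E' where E': "E' \<in> edges (neighbour T K E)" "segment E' = segment E" using N(3) by auto
  then have "edge_midpoint E \<in> region (neighbour T K E)"
    using segment_subset_region[OF E'(1)] edge_midpoint_in_segment[of E] by auto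
  then show "extension v (neighbour T K E) (edge_midpoint E) = extension v K (edge_midpoint E)"
    using j nf inner_trace_affine[OF conf_det[OF conf KE(1)] aff[OF KE(1)] m]
      inner_trace_affine[OF conf_det[OF conf N(1)] aff[OF N(1)]] by (simp add: jump_def)
qed

section \<open>A discrete divergence theorem\<close>

text \<open>The integral over \<open>L\<close> of \<open>v + (1/2) \<nabla>v (x - P)\<close>, by the centroid rule.\<close>

definition tri_moment :: "field \<Rightarrow> tri \<Rightarrow> point \<Rightarrow> point" where
  "tri_moment v L P = area L *\<^sub>R (v (centroid L) + (1/2) *\<^sub>R (slope v L *v (centroid L - P)))"

definition moment :: "field \<Rightarrow> tri set \<Rightarrow> point \<Rightarrow> point" where
  "moment v S P = (\<Sum>L\<in>S. tri_moment v L P)"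

lemma sum_edges:
  assumes "tri_det (a, b, c) \<noteq> 0"
  shows "(\<Sum>E\<in>edges (a, b, c). f E) = f (a, b) + f (b, c) + f (c, a)"
proof -
  have "a \<noteq> b" "b \<noteq> c" "c \<noteq> a" using assms by (auto simp: det_defs)
  then show ?thesis by (simp add: add.assoc)
qed

text \<open>The divergence theorem for \<open>(x - P) v\<close>: the normal component of \<open>x - P\<close> is constant on each edge, and
  the mean of \<open>v\<close> over an edge is its value at the midpoint.\<close>

lemma tri_moment_flux:
  assumes "tri_det L \<noteq> 0"
  shows "tri_moment v L P = (1/2) *\<^sub>R (\<Sum>E\<in>edges L. edge_height L E P *\<^sub>R extension v L (edge_midpoint E))"
proof -
  obtain a b c where L: "L = (a, b, c)" by (cases L)
  obtain A w where Aw: "A = slope v L" "w = v (centroid L)" by blast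
  have one: "tri_det L = edge_det (a, b) P + edge_det (b, c) P + edge_det (c, a) P"
    unfolding L by (simp add: det_defs algebra_simps)
  have "edge_det (a, b) P *\<^sub>R (midpoint a b - centroid L) + edge_det (b, c) P *\<^sub>R (midpoint b c - centroid L) +
      edge_det (c, a) P *\<^sub>R (midpoint c a - centroid L) = (tri_det L / 2) *\<^sub>R (centroid L - P)"
    unfolding L centroid.simps by (simp add: coords2 det_defs midpoint_nth field_simps)
  then have "tri_det L *\<^sub>R w + A *v ((tri_det L / 2) *\<^sub>R (centroid L - P)) =
      (edge_det (a, b) P + edge_det (b, c) P + edge_det (c, a) P) *\<^sub>R w +
      A *v (edge_det (a, b) P *\<^sub>R (midpoint a b - centroid L) + edge_det (b, c) P *\<^sub>R (midpoint b c - centroid L) +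
      edge_det (c, a) P *\<^sub>R (midpoint c a - centroid L))"
    unfolding one[symmetric] by simp
  then have "tri_det L *\<^sub>R (w + (1/2) *\<^sub>R (A *v (centroid L - P))) =
      edge_det (a, b) P *\<^sub>R (w + A *v (midpoint a b - centroid L)) +
      edge_det (b, c) P *\<^sub>R (w + A *v (midpoint b c - centroid L)) +
      edge_det (c, a) P *\<^sub>R (w + A *v (midpoint c a - centroid L))"
    by (simp only: matrix_vector_right_distrib matrix_vector_mult_scaleR scaleR_add_right scaleR_add_left add_ac scaleR_scaleR) simp
  then have "(sgn (tri_det L) / 2) *\<^sub>R (tri_det L *\<^sub>R (w + (1/2) *\<^sub>R (A *v (centroid L - P)))) =
      (sgn (tri_det L) / 2) *\<^sub>R (edge_det (a, b) P *\<^sub>R (w + A *v (midpoint a b - centroid L)) +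
      edge_det (b, c) P *\<^sub>R (w + A *v (midpoint b c - centroid L)) +
      edge_det (c, a) P *\<^sub>R (w + A *v (midpoint c a - centroid L)))"
    by simp
  then show ?thesis
    unfolding tri_moment_def extension_def Aw[symmetric] area_def sgn_mult_tri_det[symmetric] edge_height_def
    unfolding L sum_edges[OF assms[unfolded L]] edge_midpoint.simps
    by (simp add: scaleR_add_right)
qed

text \<open>Each moment is a sum of fluxes through the edges of its triangle. Grouped by edges, the fluxes cancel if
  across each edge with a nonvanishing flux the weighted heights are opposite and the traces at the
  midpoint agree.\<close>

lemma flux_cancel:
  fixes \<beta> :: "tri \<Rightarrow> real" and Pt :: "tri \<Rightarrow> point"
  assumes conf: "conforming_triangulation \<Omega> T" and op: "open \<Omega>" and S: "S \<subseteq> T"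
    and H: "\<And>L E. L \<in> S \<Longrightarrow> E \<in> edges L \<Longrightarrow> edge_height L E (Pt L) \<noteq> 0 \<Longrightarrow> extension v L (edge_midpoint E) \<noteq> 0 \<Longrightarrow>
      \<not> segment E \<subseteq> frontier \<Omega> \<and> neighbour T L E \<in> S \<and>
      extension v (neighbour T L E) (edge_midpoint E) = extension v L (edge_midpoint E) \<and>
      (\<forall>E'\<in>edges (neighbour T L E). segment E' = segment E \<longrightarrow>
          \<beta> (neighbour T L E) * edge_height (neighbour T L E) E' (Pt (neighbour T L E)) = - (\<beta> L * edge_height L E (Pt L)))"
  shows "(\<Sum>L\<in>S. \<beta> L *\<^sub>R tri_moment v L (Pt L)) = 0"
proof -
  define X where "X = Sigma S edges"
  define \<phi> where "\<phi> = (\<lambda>(L, E). (\<beta> L * edge_height L E (Pt L)) *\<^sub>R extension v L (edge_midpoint E))"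
  define key where "key = (\<lambda>(L::tri, E). segment E)"
  have det: "tri_det L \<noteq> 0" if "L \<in> S" for L using conf_det[OF conf] S that by blast
  have finS: "finite S" using conf_finite[OF conf] S finite_subset by blast
  have finE: "finite (edges L)" for L by (cases L) auto
  have finX: "finite X" unfolding X_def using finS finE by blast
  have fiber: "(\<Sum>x\<in>{x\<in>X. key x = s}. \<phi> x) = 0" for s
  proof (cases "\<exists>x\<in>X. key x = s \<and> \<phi> x \<noteq> 0")
    case False
    then show ?thesis by (intro sum.neutral) auto
  next
    case True
    then obtain L E where LE: "L \<in> S" "E \<in> edges L" "segment E = s" "\<phi> (L, E) \<noteq> 0"
      unfolding X_def key_def by auto
    define N where "N = neighbour T L E"
    have nf: "\<not> segment E \<subseteq> frontier \<Omega>" and NS: "N \<in> S"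
      and en: "extension v N (edge_midpoint E) = extension v L (edge_midpoint E)"
      and fl: "\<And>E'. E' \<in> edges N \<Longrightarrow> segment E' = segment E \<Longrightarrow> \<beta> N * edge_height N E' (Pt N) = - (\<beta> L * edge_height L E (Pt L))"
      using H[OF LE(1,2)] LE(4) unfolding N_def \<phi>_def by auto
    have LT: "L \<in> T" using LE S by blast
    have ne: "N \<noteq> L" and seg: "segment E \<in> segment ` edges N"
      using neighbour_props[OF conf op LT LE(2) nf] unfolding N_def by auto
    obtain E' where E': "E' \<in> edges N" "segment E' = segment E" using seg by auto
    have mid: "edge_midpoint E' = edge_midpoint E"
    proof -
      obtain p q where E: "E = (p, q)" by (cases E)
      then have "E' = (p, q) \<or> E' = (q, p)" using E'(2) segment_eq_iff[of E' p q] by simp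
      then show ?thesis using E by (auto simp: midpoint_sym)
    qed
    have "{x\<in>X. key x = s} = {(L, E), (N, E')}"
    proof (intro set_eqI iffI)
      fix x assume "x \<in> {x\<in>X. key x = s}"
      then obtain M F where x: "x = (M, F)" "M \<in> S" "F \<in> edges M" "segment F = segment E"
        unfolding X_def key_def using LE(3) by auto
      show "x \<in> {(L, E), (N, E')}"
      proof (cases "M = L")
        case True
        then show ?thesis using edges_segment_inj[OF det[OF LE(1)]] x LE by auto
      next
        case False
        have "segment E \<in> segment ` edges M" using x by (metis image_eqI)
        then have "neighbour T L E = M" using neighbourI[OF conf LT LE(2)] x(2) S False by blast
        then have "M = N" unfolding N_def by simp
        then show ?thesis using edges_segment_inj[OF det[OF NS] _ E'(1)] x E' by auto
      qed
    qed (use LE E' NS in \<open>auto simp: X_def key_def\<close>)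
    moreover have "\<phi> (N, E') = - \<phi> (L, E)" unfolding \<phi>_def using fl[OF E'] mid en by simp
    ultimately show ?thesis using ne by simp
  qed
  have "(\<Sum>L\<in>S. \<beta> L *\<^sub>R tri_moment v L (Pt L)) = (\<Sum>L\<in>S. (1/2) *\<^sub>R (\<Sum>E\<in>edges L. \<phi> (L, E)))"
  proof (rule sum.cong[OF refl])
    fix L assume "L \<in> S"
    show "\<beta> L *\<^sub>R tri_moment v L (Pt L) = (1/2) *\<^sub>R (\<Sum>E\<in>edges L. \<phi> (L, E))"
      unfolding tri_moment_flux[OF det[OF \<open>L \<in> S\<close>]] \<phi>_def by (simp add: scaleR_sum_right mult.assoc mult.left_commute)
  qed
  also have "\<dots> = (1/2) *\<^sub>R (\<Sum>x\<in>X. \<phi> x)"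
    unfolding X_def scaleR_sum_right[symmetric] using finS finE by (subst sum.Sigma) auto
  also have "(\<Sum>x\<in>X. \<phi> x) = (\<Sum>s\<in>key ` X. \<Sum>x\<in>{x\<in>X. key x = s}. \<phi> x)"
    using sum.group[OF finX finite_imageI[OF finX] subset_refl, of \<phi> key] by simp
  also have "\<dots> = 0" using fiber by simp
  finally show ?thesis by simp
qed

section \<open>Edge means on unions of triangles\<close>

text \<open>\<open>P\<close> is the vertex of \<open>K\<close> opposite to \<open>E\<close>: the field \<open>x - P\<close> flows through \<open>E\<close> only.\<close>

definition apex :: "tri \<Rightarrow> edge \<Rightarrow> point \<Rightarrow> bool" where
  "apex K E P \<longleftrightarrow> P \<in> vertices K \<and> edge_height K E P = \<bar>tri_det K\<bar> \<and> (\<forall>F\<in>edges K. F \<noteq> E \<longrightarrow> edge_height K F P = 0)"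

lemma subsegment_midpoint:
  fixes p q p' q' :: point
  assumes "p' \<in> closed_segment p q" "q' \<in> closed_segment p q" "p' \<noteq> q'" 
  shows "midpoint p' q' \<in> open_segment p q"
proof -
  obtain s t where s: "0 \<le> s" "s \<le> 1" "p' = (1 - s) *\<^sub>R p + s *\<^sub>R q"
    and t: "0 \<le> t" "t \<le> 1" "q' = (1 - t) *\<^sub>R p + t *\<^sub>R q" using assms(1,2) unfolding in_segment by blast
  have "s \<noteq> t" using s t assms(3) by auto
  then have "0 < (s + t) / 2" "(s + t) / 2 < 1" using s t by auto
  moreover have "midpoint p' q' = (1 - (s + t) / 2) *\<^sub>R p + ((s + t) / 2) *\<^sub>R q"
    unfolding s(3) t(3)
    by (rule vec_eq_iff[THEN iffD2], rule allI)
      (simp only: midpoint_nth vector_add_component vector_scaleR_component, simp add: field_simps)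
  moreover have "p \<noteq> q" using assms by auto
  ultimately show ?thesis unfolding in_segment by blast
qed

lemma subsegment_det:
  assumes "p' \<in> closed_segment p q" "q' \<in> closed_segment p q"
  obtains k where "\<And>x. edge_det (p', q') x = k * edge_det (p, q) x" "q' - p' = k *\<^sub>R (q - p)"
proof -
  obtain s t where s: "p' = (1 - s) *\<^sub>R p + s *\<^sub>R q" and t: "q' = (1 - t) *\<^sub>R p + t *\<^sub>R q"
    using assms(1,2) unfolding in_segment by blast
  have "edge_det (p', q') x = (t - s) * edge_det (p, q) x" for x
    unfolding s t by (simp add: det_defs algebra_simps)
  moreover have "q' - p' = (t - s) *\<^sub>R (q - p)" unfolding s t by (simp add: algebra_simps)
  ultimately show ?thesis using that by blast
qed

text \<open>On a piece of an edge, seen from a smaller triangle inside, the flux of \<open>x - P\<close> is a positive multiple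
  (the ratio of the lengths) of the flux through the whole edge.\<close>

lemma subedge_heights:
  assumes K: "tri_det K \<noteq> 0" and L: "tri_det L \<noteq> 0" and sub: "region L \<subseteq> region K"
    and E: "E \<in> edges L" and F: "F \<in> edges K" and EF: "segment E \<subseteq> segment F"
  obtains \<kappa> where "\<kappa> > 0" "\<And>x. edge_height L E x = \<kappa> * edge_height K F x"
proof -
  obtain p q where pq: "F = (p, q)" by (cases F)
  obtain p' q' where pq': "E = (p', q')" by (cases E)
  have "p' \<in> closed_segment p q" "q' \<in> closed_segment p q" using EF unfolding pq pq' by auto
  then obtain k where k: "\<And>x. edge_det E x = k * edge_det F x"
    using subsegment_det[of p' p q q'] unfolding pq pq' by blast
  define \<kappa> where "\<kappa> = k * sgn (tri_det L) * sgn (tri_det K)"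
  have h: "edge_height L E x = \<kappa> * edge_height K F x" for x
    unfolding edge_height_def k \<kappa>_def using K by (simp add: sgn_if)
  obtain P where P: "P \<in> vertices L" "edge_height L E P = \<bar>tri_det L\<bar>" using apex_exists[OF E] by metis
  have "P \<in> region K" using P(1) vertices_subset_region sub by blast
  then have "0 \<le> edge_height K F P" using F unfolding region_eq[OF K] by blast
  moreover have "0 < \<kappa> * edge_height K F P" using P(2) L h by (metis zero_less_abs_iff)
  ultimately have "\<kappa> > 0" by (simp add: zero_less_mult_iff)
  then show ?thesis using that h by blast
qed

context
  fixes \<Omega> T
  assumes conf: "conforming_triangulation \<Omega> T" and op: "open \<Omega>"
begin

lemma not_frontier: "x \<in> \<Omega> \<Longrightarrow> x \<in> segment E \<Longrightarrow> \<not> segment E \<subseteq> frontier \<Omega>"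
  using op by (auto simp: frontier_def interior_open)

lemma neighbour_in_tree:
  assumes t: "bis_tree K S" "tri_det K \<noteq> 0" "S \<subseteq> T" "interior (region K) \<subseteq> \<Omega>"
    and L: "L \<in> S" "E \<in> edges L" "edge_midpoint E \<in> interior (region K)"
  shows "\<not> segment E \<subseteq> frontier \<Omega>" "neighbour T L E \<in> S"
proof -
  show nf: "\<not> segment E \<subseteq> frontier \<Omega>" 
    using L(3) t(4) edge_midpoint_in_segment by (intro not_frontier[of "edge_midpoint E"]) auto
  have "L \<in> T" using L(1) t(3) by blast
  note N = neighbour_props[OF conf op this L(2) nf]
  obtain E' where E': "E' \<in> edges (neighbour T L E)" "segment E' = segment E" using N(3) by auto
  have "edge_midpoint E \<in> region (neighbour T L E)"
    using segment_subset_region[OF E'(1)] edge_midpoint_in_segment[of E] unfolding E'(2) by blast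
  then show "neighbour T L E \<in> S" using tree_meets'[OF conf t(1-3) N(1) _ L(3)] by blast
qed

text \<open>If the edge \<open>E\<close> lies on a common edge of two triangles \<open>K1\<close> and \<open>K2\<close>, both refined by \<open>T\<close>, then the neighbour
  of a leaf of \<open>K1\<close> across \<open>E\<close> is a leaf of \<open>K2\<close>, because near the midpoint of \<open>E\<close> it lies on the side of
  \<open>K2\<close>.\<close>

lemma neighbour_across:
  assumes t1: "bis_tree K1 S1" "tri_det K1 \<noteq> 0" "S1 \<subseteq> T"
    and t2: "bis_tree K2 S2" "tri_det K2 \<noteq> 0" "S2 \<subseteq> T"
    and s: "s1 \<in> edges K1" "s2 \<in> edges K2" "segment s1 = segment s2"
    and opp: "\<And>x. edge_height K2 s2 x = - edge_height K1 s1 x"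
    and ins: "\<forall>p q. s1 = (p, q) \<longrightarrow> open_segment p q \<subseteq> \<Omega>"
    and L: "L \<in> S1" "E \<in> edges L" "segment E \<subseteq> segment s1"
  shows "\<not> segment E \<subseteq> frontier \<Omega>" "neighbour T L E \<in> S2"
proof -
  note dL = tree_det[OF t1(1,2) L(1)]
  obtain p q where pq: "E = (p, q)" by (cases E)
  obtain p2 q2 where pq2: "s2 = (p2, q2)" by (cases s2)
  have ne: "p \<noteq> q" using edge_distinct[OF dL, of p q] L(2) pq by simp
  define m where "m = edge_midpoint E"
  have "p \<in> closed_segment p2 q2" "q \<in> closed_segment p2 q2" using L(3) unfolding s(3) pq pq2 by auto
  then have m2: "m \<in> open_segment p2 q2" unfolding m_def pq using subsegment_midpoint ne by simp
  moreover have "open_segment p2 q2 \<subseteq> \<Omega>"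
  proof (cases s1)
    case (Pair p1 q1)
    then have "s1 = (p2, q2) \<or> s1 = (q2, p2)" using segment_eq_iff[of s1 p2 q2] s(3) pq2 by simp
    then show ?thesis using ins by (auto simp: open_segment_commute)
  qed
  ultimately have "m \<in> \<Omega>" by blast
  then show nf: "\<not> segment E \<subseteq> frontier \<Omega>" 
    using edge_midpoint_in_segment not_frontier unfolding m_def by blast
  have LT: "L \<in> T" using L(1) t1(3) by blast
  define N where "N = neighbour T L E"
  note N = neighbour_props[OF conf op LT L(2) nf, folded N_def]
  note dN = conf_det[OF conf N(1)]
  obtain E' where E': "E' \<in> edges N" "segment E' = segment E" using N(3) by auto
  obtain p' q' where pq': "E' = (p', q')" by (cases E')
  have "m \<in> open_segment p q" unfolding m_def pq using ne by simp
  then have m': "m \<in> open_segment p' q'"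
    using E'(2) segment_eq_iff[of E' p q] unfolding pq pq' by (auto simp: open_segment_commute)
  obtain r' where r': "r' > 0" "\<And>y. y \<in> ball m r' \<Longrightarrow> 0 < edge_height N E' y \<Longrightarrow> y \<in> interior (region N)"
    using near_edge_interior[OF dN E'(1)[unfolded pq'] m'] unfolding pq' by blast
  obtain r2 where r2: "r2 > 0" "\<And>y. y \<in> ball m r2 \<Longrightarrow> 0 < edge_height K2 s2 y \<Longrightarrow> y \<in> interior (region K2)"
    using near_edge_interior[OF t2(2) s(2)[unfolded pq2] m2] unfolding pq2 by blast
  obtain \<kappa> where \<kappa>: "\<kappa> > 0" "\<And>x. edge_height L E x = \<kappa> * edge_height K1 s1 x"
    using subedge_heights[OF t1(2) dL tree_interior_mono(1)[OF t1(1,2) L(1)] L(2) s(1) L(3)] by blast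
  have hN: "edge_height N E' x = \<kappa> * edge_height K2 s2 x" for x
    unfolding opposite_heights[OF conf LT N(1) N(2)[symmetric] L(2) E'] \<kappa> opp by simp
  have z: "edge_height N E' m = 0" using open_segment_heights(1)[OF dN _ m'] E'(1) pq' by simp
  have "0 < min r' r2" using r' r2 by simp
  then obtain y where y: "y \<in> ball m (min r' r2)" "edge_height N E' y > 0"
    using side_points[OF E'(1) dN z] by metis
  then have "edge_height K2 s2 y > 0" using hN[of y] \<kappa>(1) by (simp add: zero_less_mult_iff)
  then have "y \<in> interior (region N)" "y \<in> interior (region K2)" using y r'(2) r2(2) by auto
  then show "neighbour T L E \<in> S2" using tree_meets[OF conf t2 N(1)] interior_subset unfolding N_def by blast
qed

text \<open>An edge of a leaf that is not inside \<open>K\<close> lies on an edge of \<open>K\<close>, and there the field \<open>x - P\<close> is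
  tangential unless that edge is opposite to \<open>P\<close>.\<close>

lemma flux_cases:
  assumes t: "bis_tree K S" "tri_det K \<noteq> 0"
    and ap: "apex K s P" and L: "L \<in> S" "E \<in> edges L" and nz: "edge_height L E P \<noteq> 0"
  shows "segment E \<subseteq> segment s \<and> s \<in> edges K \<or> edge_midpoint E \<in> interior (region K)"
proof -
  obtain p q where pq: "E = (p, q)" by (cases E)
  note sub = tree_interior_mono(1)[OF t L(1)]
  have "closed_segment p q \<subseteq> region K" using segment_subset_region[OF L(2)] sub pq by auto
  then have pqK: "p \<in> region K" "q \<in> region K" by auto
  show ?thesis
  proof (rule segment_in_edge_or_interior[OF t(2) pqK])
    fix F assume F: "F \<in> edges K" "closed_segment p q \<subseteq> segment F"
    have "segment E \<subseteq> segment F" using F(2) pq by simp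
    then obtain \<kappa> where \<kappa>: "\<And>x. edge_height L E x = \<kappa> * edge_height K F x"
      using subedge_heights[OF t(2) tree_det[OF t L(1)] sub L(2) F(1)] by blast
    have "F = s" using ap F(1) nz \<kappa>[of P] unfolding apex_def by auto
    then show ?thesis using F pq by simp
  qed (simp add: pq)
qed

text \<open>The mean over a boundary edge vanishes: inner fluxes cancel, and the traces vanish at the midpoints of the
  pieces of the boundary edge.\<close>

lemma edge_mean_boundary:
  assumes v: "weakly_continuous \<Omega> T v"
    and t: "bis_tree K S" "tri_det K \<noteq> 0" "S \<subseteq> T" "interior (region K) \<subseteq> \<Omega>"
    and ap: "apex K s P" and s: "segment s \<subseteq> frontier \<Omega>"
  shows "moment v S P = 0"
proof -
  have "(\<Sum>L\<in>S. 1 *\<^sub>R tri_moment v L P) = 0"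
  proof (rule flux_cancel[OF conf op t(3), where \<beta> = "\<lambda>L. 1" and Pt = "\<lambda>L. P"])
    fix L E assume L: "L \<in> S" "E \<in> edges L" and nz: "edge_height L E P \<noteq> 0" "extension v L (edge_midpoint E) \<noteq> 0"
    have LT: "L \<in> T" using L t by blast
    have "\<not> segment E \<subseteq> segment s" using v LT L(2) nz(2) s unfolding weakly_continuous_def by blast
    then have m: "edge_midpoint E \<in> interior (region K)" using flux_cases[OF t(1,2) ap L nz(1)] by blast
    note nb = neighbour_in_tree[OF t L m]
    note N = neighbour_props[OF conf op LT L(2) nb(1)]
    show "\<not> segment E \<subseteq> frontier \<Omega> \<and> neighbour T L E \<in> S \<and>
      extension v (neighbour T L E) (edge_midpoint E) = extension v L (edge_midpoint E) \<and>
      (\<forall>E'\<in>edges (neighbour T L E). segment E' = segment E \<longrightarrow>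
          1 * edge_height (neighbour T L E) E' P = - (1 * edge_height L E P))"
      using nb v LT L(2) opposite_heights[OF conf LT N(1) N(2)[symmetric] L(2)]
      unfolding weakly_continuous_def by auto
  qed
  then show ?thesis by (simp add: moment_def)
qed

text \<open>Two adjacent triangles, each a union of leaves, have the same mean on their common edge. The fluxes
  are those of the field \<open>(x - P1) / area K1\<close> on \<open>K1\<close> and \<open>-(x - P2) / area K2\<close> on \<open>K2\<close>, a lowest order
  Raviart-Thomas function: its normal component is continuous across the common edge and vanishes on
  the rest of the boundary.\<close>

lemma edge_mean_match:
  assumes v: "weakly_continuous \<Omega> T v"
    and t1: "bis_tree K1 S1" "tri_det K1 \<noteq> 0" "S1 \<subseteq> T" "interior (region K1) \<subseteq> \<Omega>"
    and t2: "bis_tree K2 S2" "tri_det K2 \<noteq> 0" "S2 \<subseteq> T" "interior (region K2) \<subseteq> \<Omega>"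
    and s: "s1 \<in> edges K1" "s2 \<in> edges K2" "segment s1 = segment s2"
    and opp: "\<And>x. edge_height K2 s2 x = - edge_height K1 s1 x"
    and ins: "s1 = (p, q)" "open_segment p q \<subseteq> \<Omega>"
    and ap: "apex K1 s1 P1" "apex K2 s2 P2"
  shows "(1 / area K1) *\<^sub>R moment v S1 P1 = (1 / area K2) *\<^sub>R moment v S2 P2"
proof -
  have ins1: "\<forall>p q. s1 = (p, q) \<longrightarrow> open_segment p q \<subseteq> \<Omega>" using ins by simp
  have "s2 = (p, q) \<or> s2 = (q, p)" using s(3) ins(1) segment_eq_iff[of s2 p q] by simp
  then have ins2: "\<forall>p q. s2 = (p, q) \<longrightarrow> open_segment p q \<subseteq> \<Omega>" using ins(2) by (auto simp: open_segment_commute)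
  have opp': "edge_height K1 s1 x = - edge_height K2 s2 x" for x using opp by simp
  have disj: "S1 \<inter> S2 = {}"
  proof (rule ccontr)
    assume "S1 \<inter> S2 \<noteq> {}"
    then obtain L where L: "L \<in> S1" "L \<in> S2" by blast
    have "centroid L \<in> interior (region K1)" "centroid L \<in> interior (region K2)"
      using centroid_interior[OF tree_det[OF t1(1,2) L(1)]]
        tree_interior_mono(2)[OF t1(1,2) L(1)] tree_interior_mono(2)[OF t2(1,2) L(2)] by auto
    then have "0 < edge_height K1 s1 (centroid L)" "0 < edge_height K2 s2 (centroid L)"
      using s unfolding interior_region[OF t1(2)] interior_region[OF t2(2)] by auto
    then show False using opp by simp
  qed
  \<comment> \<open>The weights and centres of the Raviart-Thomas field.\<close>
  define \<beta> where "\<beta> L = (if L \<in> S1 then 1 / area K1 else - 1 / area K2)" for L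
  define Pt where "Pt L = (if L \<in> S1 then P1 else P2)" for L
  have side: "\<not> segment E \<subseteq> frontier \<Omega> \<and> (neighbour T L E \<in> S \<and> (\<forall>E'\<in>edges (neighbour T L E). segment E' = segment E \<longrightarrow>
          edge_height (neighbour T L E) E' P = - edge_height L E P)
      \<or> neighbour T L E \<in> S' \<and> (\<forall>E'\<in>edges (neighbour T L E). segment E' = segment E \<longrightarrow>
          (1 / area K') * edge_height (neighbour T L E) E' P' = (1 / area K) * edge_height L E P))"
    if t1: "bis_tree K S" "tri_det K \<noteq> 0" "S \<subseteq> T" "interior (region K) \<subseteq> \<Omega>"
      and t2: "bis_tree K' S'" "tri_det K' \<noteq> 0" "S' \<subseteq> T" "interior (region K') \<subseteq> \<Omega>"
      and s: "s \<in> edges K" "s' \<in> edges K'" "segment s = segment s'"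
      and opp: "\<And>x. edge_height K' s' x = - edge_height K s x"
      and ins: "\<forall>p q. s = (p, q) \<longrightarrow> open_segment p q \<subseteq> \<Omega>"
      and ap: "apex K s P" "apex K' s' P'"
      and L: "L \<in> S" "E \<in> edges L" and nz: "edge_height L E P \<noteq> 0"
    for K S K' S' s s' P P' L E
  proof (cases "edge_midpoint E \<in> interior (region K)")
    case True
    note nb = neighbour_in_tree[OF t1 L True]
    have LT: "L \<in> T" using L t1 by blast
    note N = neighbour_props[OF conf op LT L(2) nb(1)]
    show ?thesis using nb opposite_heights[OF conf LT N(1) N(2)[symmetric] L(2)] by blast
  next
    case False
    then have E: "segment E \<subseteq> segment s" using flux_cases[OF t1(1,2) ap(1) L nz] by blast
    note nb = neighbour_across[OF t1(1-3) t2(1-3) s opp ins L E]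
    have LT: "L \<in> T" using L t1 by blast
    note N = neighbour_props[OF conf op LT L(2) nb(1)]
    obtain \<kappa> where \<kappa>: "\<And>x. edge_height L E x = \<kappa> * edge_height K s x"
      using subedge_heights[OF t1(2) tree_det[OF t1(1,2) L(1)] tree_interior_mono(1)[OF t1(1,2) L(1)] L(2) s(1) E] by blast
    have "(1 / area K') * edge_height (neighbour T L E) E' P' = (1 / area K) * edge_height L E P"
      if E': "E' \<in> edges (neighbour T L E)" "segment E' = segment E" for E'
    proof -
      have "edge_height (neighbour T L E) E' P' = \<kappa> * edge_height K' s' P'"
        unfolding opposite_heights[OF conf LT N(1) N(2)[symmetric] L(2) E'] \<kappa> opp by simp
      moreover have "edge_height K' s' P' = 2 * area K'" "edge_height K s P = 2 * area K"
        using ap unfolding apex_def area_def by auto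
      ultimately show ?thesis unfolding \<kappa> using area_pos[OF t1(2)] area_pos[OF t2(2)] by simp
    qed
    then show ?thesis using nb by blast
  qed
  have "(\<Sum>L\<in>S1 \<union> S2. \<beta> L *\<^sub>R tri_moment v L (Pt L)) = 0"
  proof (rule flux_cancel[OF conf op])
    fix L E assume L: "L \<in> S1 \<union> S2" "E \<in> edges L" and nz: "edge_height L E (Pt L) \<noteq> 0" "extension v L (edge_midpoint E) \<noteq> 0"
    have LT: "L \<in> T" using L t1 t2 by blast
    have *: "\<not> segment E \<subseteq> frontier \<Omega> \<and> neighbour T L E \<in> S1 \<union> S2 \<and>
      (\<forall>E'\<in>edges (neighbour T L E). segment E' = segment E \<longrightarrow>
          \<beta> (neighbour T L E) * edge_height (neighbour T L E) E' (Pt (neighbour T L E)) = - (\<beta> L * edge_height L E (Pt L)))"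
    proof (cases "L \<in> S1")
      case True
      then have nz1: "edge_height L E P1 \<noteq> 0" using nz(1) by (simp add: Pt_def)
      have n2: "neighbour T L E \<in> S2 \<Longrightarrow> neighbour T L E \<notin> S1" using disj by blast
      show ?thesis using side[OF t1 t2 s opp ins1 ap True L(2) nz1] True n2 unfolding \<beta>_def Pt_def by auto
    next
      case False
      then have L2: "L \<in> S2" using L by blast
      have nz1: "edge_height L E P2 \<noteq> 0" using nz(1) False by (simp add: Pt_def)
      have n2: "neighbour T L E \<in> S2 \<Longrightarrow> neighbour T L E \<notin> S1" using disj by blast
      show ?thesis using side[OF t2 t1 s(2,1) s(3)[symmetric] opp' ins2 ap(2,1) L2 L(2) nz1] False n2
        unfolding \<beta>_def Pt_def by auto
    qed
    then show "\<not> segment E \<subseteq> frontier \<Omega> \<and> neighbour T L E \<in> S1 \<union> S2 \<and>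
      extension v (neighbour T L E) (edge_midpoint E) = extension v L (edge_midpoint E) \<and>
      (\<forall>E'\<in>edges (neighbour T L E). segment E' = segment E \<longrightarrow>
          \<beta> (neighbour T L E) * edge_height (neighbour T L E) E' (Pt (neighbour T L E)) = - (\<beta> L * edge_height L E (Pt L)))"
      using v LT L(2) unfolding weakly_continuous_def by blast
  qed (use t1 t2 in auto)
  moreover have "(\<Sum>L\<in>S1 \<union> S2. \<beta> L *\<^sub>R tri_moment v L (Pt L)) =
      (\<Sum>L\<in>S1. \<beta> L *\<^sub>R tri_moment v L (Pt L)) + (\<Sum>L\<in>S2. \<beta> L *\<^sub>R tri_moment v L (Pt L))"
    using tree_finite[OF t1(1)] tree_finite[OF t2(1)] disj by (intro sum.union_disjoint) auto
  moreover have "(\<Sum>L\<in>S1. \<beta> L *\<^sub>R tri_moment v L (Pt L)) = (1 / area K1) *\<^sub>R moment v S1 P1"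
    unfolding moment_def scaleR_sum_right by (intro sum.cong) (auto simp: \<beta>_def Pt_def)
  moreover have "(\<Sum>L\<in>S2. \<beta> L *\<^sub>R tri_moment v L (Pt L)) = - ((1 / area K2) *\<^sub>R moment v S2 P2)"
    unfolding moment_def scaleR_sum_right sum_negf[symmetric] using disj by (intro sum.cong) (auto simp: \<beta>_def Pt_def)
  ultimately show ?thesis by simp
qed

end

section \<open>A Poincare inequality on bisection trees\<close>

text \<open>An upper bound for the squared \<open>L2\<close> distance of \<open>v\<close> to the constant \<open>m\<close>; the sum over the vertices avoids
  integrals of quadratic polynomials.\<close>

definition spread :: "field \<Rightarrow> tri set \<Rightarrow> point \<Rightarrow> real" where
  "spread v S m = (\<Sum>L\<in>S. area L * (\<Sum>x\<in>vertices L. (norm (extension v L x - m))\<^sup>2))"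

definition energy :: "field \<Rightarrow> tri set \<Rightarrow> real" where
  "energy v S = (\<Sum>L\<in>S. area L * (norm (slope v L))\<^sup>2)"

definition mean_slope :: "field \<Rightarrow> tri \<Rightarrow> tri set \<Rightarrow> real^2^2" where
  "mean_slope v K S = (1 / area K) *\<^sub>R (\<Sum>L\<in>S. area L *\<^sub>R slope v L)"

lemma area_nonneg: "0 \<le> area K"
  by (simp add: area_def)

lemma energy_nonneg: "0 \<le> energy v S"
  unfolding energy_def by (intro sum_nonneg mult_nonneg_nonneg area_nonneg) auto

lemma size2_nonneg: "0 \<le> size2 K"
  by (cases K) simp

lemma norm_matrix_vector_le: "norm (A *v x) \<le> norm A * norm x" for A :: "real^'n^'m"
proof (rule power2_le_imp_le)
  have sq: "(norm y)\<^sup>2 = (\<Sum>i\<in>UNIV. (norm (y $ i))\<^sup>2)" for y :: "'b::real_normed_vector ^ 'k"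
    unfolding norm_vec_def L2_set_def by (simp add: sum_nonneg)
  have "(norm (A *v x))\<^sup>2 = (\<Sum>i\<in>UNIV. (A $ i \<bullet> x)\<^sup>2)"
    unfolding sq by (simp add: matrix_mult_dot)
  also have "\<dots> \<le> (\<Sum>i\<in>UNIV. (norm (A $ i))\<^sup>2 * (norm x)\<^sup>2)"
  proof (rule sum_mono)
    fix i
    have "\<bar>A $ i \<bullet> x\<bar>\<^sup>2 \<le> (norm (A $ i) * norm x)\<^sup>2"
      by (intro power_mono Cauchy_Schwarz_ineq2) auto
    then show "(A $ i \<bullet> x)\<^sup>2 \<le> (norm (A $ i))\<^sup>2 * (norm x)\<^sup>2" by (simp add: power_mult_distrib)
  qed
  also have "\<dots> = (norm A * norm x)\<^sup>2" unfolding sq[of A] power_mult_distrib by (simp add: sum_distrib_right)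
  finally show "(norm (A *v x))\<^sup>2 \<le> (norm A * norm x)\<^sup>2" .
qed auto

lemma norm_matrix_vector_sq: "(norm (A *v x))\<^sup>2 \<le> (norm A)\<^sup>2 * (norm x)\<^sup>2" for A :: "real^'n^'m"
  using power_mono[OF norm_matrix_vector_le[of A x], of 2] by (simp add: power_mult_distrib)

lemma norm_add_sq: "(norm (x + y))\<^sup>2 \<le> 2 * (norm x)\<^sup>2 + 2 * (norm y)\<^sup>2" for x y :: "'a::real_inner"
proof -
  have "0 \<le> (norm (x - y))\<^sup>2" by simp
  then show ?thesis by (simp add: power2_norm_eq_inner inner_add inner_diff inner_commute)
qed

lemma young_sq:
  fixes x y :: "'a::real_inner"
  assumes "\<delta> > 0"
  shows "(norm (x + y))\<^sup>2 \<le> (1 + \<delta>) * (norm x)\<^sup>2 + (1 + 1 / \<delta>) * (norm y)\<^sup>2"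
proof -
  have "0 \<le> (norm (\<delta> *\<^sub>R x - y))\<^sup>2 / \<delta>" using assms by simp
  also have "(norm (\<delta> *\<^sub>R x - y))\<^sup>2 / \<delta> = \<delta> * (norm x)\<^sup>2 + (1 / \<delta>) * (norm y)\<^sup>2 - 2 * (x \<bullet> y)"
    using assms by (simp add: power2_norm_eq_inner inner_diff inner_commute field_simps)
  finally show ?thesis by (simp add: power2_norm_eq_inner inner_add inner_commute algebra_simps)
qed

lemma card_vertices: "card (vertices K) \<le> 3"
  by (cases K) (simp add: card_insert_if)

lemma finite_vertices: "finite (vertices K)"
  by (cases K) simp

lemma tree_area_sum: "bis_tree K S \<Longrightarrow> tri_det K \<noteq> 0 \<Longrightarrow> (\<Sum>L\<in>S. area L) = area K"
proof (induction rule: bis_tree.induct)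
  case (node b c a S1 S2)
  note d = node.prems
  have "(\<Sum>L\<in>S1 \<union> S2. area L) = (\<Sum>L\<in>S1. area L) + (\<Sum>L\<in>S2. area L)"
    using tree_finite[OF node.hyps(1)] tree_finite[OF node.hyps(2)] tree_children_disjoint[OF d node.hyps]
    by (intro sum.union_disjoint) auto
  then show ?case using node.IH region_children(3,4)[OF d] by (simp add: area_children)
qed simp

lemma mean_slope_energy:
  assumes "bis_tree K S" "tri_det K \<noteq> 0"
  shows "area K * (norm (mean_slope v K S))\<^sup>2 \<le> energy v S"
proof -
  note fin = conjunct1[OF tree_finite[OF assms(1)]]
  note A = area_pos[OF assms(2)]
  have "norm (\<Sum>L\<in>S. area L *\<^sub>R slope v L) \<le> (\<Sum>L\<in>S. area L * norm (slope v L))"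
    by (rule order_trans[OF norm_sum]) (simp add: area_nonneg)
  also have "\<dots> = (\<Sum>L\<in>S. sqrt (area L) * (sqrt (area L) * norm (slope v L)))"
    by (intro sum.cong) (auto simp: mult.assoc[symmetric] area_nonneg)
  finally have "(norm (\<Sum>L\<in>S. area L *\<^sub>R slope v L))\<^sup>2 \<le> (\<Sum>L\<in>S. sqrt (area L) * (sqrt (area L) * norm (slope v L)))\<^sup>2"
    by (intro power_mono) auto
  also have "\<dots> \<le> (\<Sum>L\<in>S. (sqrt (area L))\<^sup>2) * (\<Sum>L\<in>S. (sqrt (area L) * norm (slope v L))\<^sup>2)"
    by (rule Cauchy_Schwarz_ineq_sum)
  also have "\<dots> = area K * energy v S"
    unfolding energy_def using tree_area_sum[OF assms] by (simp add: area_nonneg power_mult_distrib)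
  finally have *: "(norm (\<Sum>L\<in>S. area L *\<^sub>R slope v L))\<^sup>2 \<le> area K * energy v S" .
  have "area K * (norm (mean_slope v K S))\<^sup>2 = (1 / area K) * (norm (\<Sum>L\<in>S. area L *\<^sub>R slope v L))\<^sup>2"
    unfolding mean_slope_def using A by (simp add: power_mult_distrib power2_eq_square)
  also have "\<dots> \<le> (1 / area K) * (area K * energy v S)"
    using * A by (intro mult_left_mono) auto
  finally show ?thesis using A by simp
qed

lemma sum_matrix_vector: "(\<Sum>i\<in>I. A i) *v x = (\<Sum>i\<in>I. A i *v x)" for A :: "'i \<Rightarrow> real^'n^'m"
  by (induction I rule: infinite_finite_induct) (simp_all add: matrix_vector_mult_0 matrix_vector_mult_add_rdistrib)

text \<open>The means over two edges of \<open>K\<close> differ by the mean gradient times the difference of the edge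
  midpoints, which is half the difference of the opposite vertices.\<close>

lemma mean_diff:
  "(1 / area K) *\<^sub>R moment v S P = (1 / area K) *\<^sub>R moment v S Q + (1/2) *\<^sub>R (mean_slope v K S *v (Q - P))"
proof -
  have "tri_moment v L P = tri_moment v L Q + (1/2) *\<^sub>R ((area L *\<^sub>R slope v L) *v (Q - P))" for L
    unfolding tri_moment_def
    by (simp add: scaleR_matrix_vector_assoc[symmetric] matrix_vector_mult_diff_distrib algebra_simps)
  then have "moment v S P = moment v S Q + (1/2) *\<^sub>R ((\<Sum>L\<in>S. area L *\<^sub>R slope v L) *v (Q - P))"
    unfolding moment_def sum_matrix_vector scaleR_sum_right by (simp add: sum.distrib)
  then show ?thesis
    unfolding mean_slope_def by (simp add: scaleR_matrix_vector_assoc[symmetric] scaleR_add_right mult.commute)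
qed

lemma tri_moment_ext:
  assumes "tri_det L \<noteq> 0"
  shows "(1 / area L) *\<^sub>R tri_moment v L P = extension v L (centroid L + (1/2) *\<^sub>R (centroid L - P))"
  using area_pos[OF assms] unfolding tri_moment_def extension_def by (simp add: matrix_vector_mult_scaleR)

lemma vertices_coords:
  assumes "x \<in> vertices (a, b, c)"
  obtains s t where "s \<in> {0..1::real}" "t \<in> {0..1::real}" "x = a + s *\<^sub>R (b - a) + t *\<^sub>R (c - a)"
proof -
  consider "x = a" | "x = b" | "x = c" using assms by auto
  then show ?thesis
  proof cases
    case 1 then show ?thesis by (intro that[of 0 0]) auto
  next
    case 2 then show ?thesis by (intro that[of 1 0]) auto
  next
    case 3 then show ?thesis by (intro that[of 0 1]) auto
  qed
qed

lemma comb_size2: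
  assumes "\<bar>s\<bar> \<le> 1" "\<bar>t\<bar> \<le> 1"
  shows "(norm (s *\<^sub>R (b - a) + t *\<^sub>R (c - a)))\<^sup>2 \<le> 2 * size2 (a, b, c)"
proof -
  have "(norm (s *\<^sub>R (b - a) + t *\<^sub>R (c - a)))\<^sup>2 \<le> 2 * (norm (s *\<^sub>R (b - a)))\<^sup>2 + 2 * (norm (t *\<^sub>R (c - a)))\<^sup>2"
    by (rule norm_add_sq)
  also have "\<dots> = 2 * (s\<^sup>2 * (norm (b - a))\<^sup>2) + 2 * (t\<^sup>2 * (norm (c - a))\<^sup>2)"
    by (simp add: power_mult_distrib)
  also have "\<dots> \<le> 2 * (1 * (norm (b - a))\<^sup>2) + 2 * (1 * (norm (c - a))\<^sup>2)"
    using assms abs_le_square_iff[of s 1] abs_le_square_iff[of t 1]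
    by (intro add_mono mult_left_mono mult_right_mono) auto
  finally show ?thesis by simp
qed

lemma vertices_dist:
  assumes "x \<in> vertices K" "y \<in> vertices K" shows "(norm (x - y))\<^sup>2 \<le> 2 * size2 K"
proof -
  obtain a b c where K: "K = (a, b, c)" by (cases K)
  obtain s t where s: "s \<in> {0..1::real}" "t \<in> {0..1::real}" "x = a + s *\<^sub>R (b - a) + t *\<^sub>R (c - a)"
    using vertices_coords[OF assms(1)[unfolded K]] by blast
  obtain s' t' where s': "s' \<in> {0..1::real}" "t' \<in> {0..1::real}" "y = a + s' *\<^sub>R (b - a) + t' *\<^sub>R (c - a)"
    using vertices_coords[OF assms(2)[unfolded K]] by blast
  have "x - y = (s - s') *\<^sub>R (b - a) + (t - t') *\<^sub>R (c - a)" unfolding s(3) s'(3) by (simp add: algebra_simps)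
  then show ?thesis unfolding K using comb_size2[of "s - s'" "t - t'" b a c] s s' by auto
qed

text \<open>On a single triangle the mean is the value at the midpoint of the edge opposite to \<open>P\<close>.\<close>

lemma leaf_spread:
  assumes "tri_det K \<noteq> 0" "P \<in> vertices K"
  shows "spread v {K} ((1 / area K) *\<^sub>R moment v {K} P) \<le> 18 * size2 K * energy v {K}"
proof -
  obtain a b c where K: "K = (a, b, c)" by (cases K)
  have pt: "(norm (extension v K x - (1 / area K) *\<^sub>R tri_moment v K P))\<^sup>2 \<le> (norm (slope v K))\<^sup>2 * (2 * size2 K)"
    if xv: "x \<in> vertices K" for x
  proof -
    obtain s t where s: "s \<in> {0..1::real}" "t \<in> {0..1::real}" "x = a + s *\<^sub>R (b - a) + t *\<^sub>R (c - a)"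
      using vertices_coords[OF xv[unfolded K]] by blast
    obtain s' t' where s': "s' \<in> {0..1::real}" "t' \<in> {0..1::real}" "P = a + s' *\<^sub>R (b - a) + t' *\<^sub>R (c - a)"
      using vertices_coords[OF assms(2)[unfolded K]] by blast
    have "x - (centroid K + (1/2) *\<^sub>R (centroid K - P))
        = (s - 1/2 + s'/2) *\<^sub>R (b - a) + (t - 1/2 + t'/2) *\<^sub>R (c - a)"
      unfolding K s(3) s'(3) by (simp add: coords2 field_simps)
    moreover have "\<bar>s - 1/2 + s'/2\<bar> \<le> 1" "\<bar>t - 1/2 + t'/2\<bar> \<le> 1" using s s' by auto
    ultimately have "(norm (x - (centroid K + (1/2) *\<^sub>R (centroid K - P))))\<^sup>2 \<le> 2 * size2 K"
      using comb_size2[of _ _ b a c] unfolding K by metis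
    then show ?thesis unfolding tri_moment_ext[OF assms(1)] ext_diff
      by (intro order_trans[OF norm_matrix_vector_sq] mult_left_mono) auto
  qed
  have "(\<Sum>x\<in>vertices K. (norm (extension v K x - (1 / area K) *\<^sub>R tri_moment v K P))\<^sup>2)
      \<le> real (card (vertices K)) * ((norm (slope v K))\<^sup>2 * (2 * size2 K))"
    by (rule sum_bounded_above) (rule pt)
  also have "\<dots> \<le> 3 * ((norm (slope v K))\<^sup>2 * (2 * size2 K))"
    using card_vertices[of K] size2_nonneg[of K] by (intro mult_right_mono) auto
  finally have "area K * (\<Sum>x\<in>vertices K. (norm (extension v K x - (1 / area K) *\<^sub>R tri_moment v K P))\<^sup>2)
      \<le> area K * (3 * ((norm (slope v K))\<^sup>2 * (2 * size2 K)))"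
    by (rule mult_left_mono) (rule area_nonneg)
  also have "\<dots> = 6 * (size2 K * energy v {K})" by (simp add: energy_def)
  also have "\<dots> \<le> 18 * (size2 K * energy v {K})"
    by (intro mult_right_mono mult_nonneg_nonneg size2_nonneg energy_nonneg) simp
  finally show ?thesis by (simp add: spread_def moment_def)
qed

lemma spread_shift:
  assumes "finite S"
  shows "spread v S m' \<le> (4/3) * spread v S m + 12 * (\<Sum>L\<in>S. area L) * (norm (m - m'))\<^sup>2"
proof -
  have "area L * (\<Sum>x\<in>vertices L. (norm (extension v L x - m'))\<^sup>2)
      \<le> (4/3) * (area L * (\<Sum>x\<in>vertices L. (norm (extension v L x - m))\<^sup>2)) + area L * (12 * (norm (m - m'))\<^sup>2)" for L
  proof -
    have "(norm (extension v L x - m'))\<^sup>2 \<le> (4/3) * (norm (extension v L x - m))\<^sup>2 + 4 * (norm (m - m'))\<^sup>2" for x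
      using young_sq[of "1/3" "extension v L x - m" "m - m'"] by simp
    then have "(\<Sum>x\<in>vertices L. (norm (extension v L x - m'))\<^sup>2)
        \<le> (\<Sum>x\<in>vertices L. (4/3) * (norm (extension v L x - m))\<^sup>2 + 4 * (norm (m - m'))\<^sup>2)" by (rule sum_mono)
    also have "\<dots> = (4/3) * (\<Sum>x\<in>vertices L. (norm (extension v L x - m))\<^sup>2) + real (card (vertices L)) * (4 * (norm (m - m'))\<^sup>2)"
      by (simp add: sum.distrib sum_distrib_left)
    also have "\<dots> \<le> (4/3) * (\<Sum>x\<in>vertices L. (norm (extension v L x - m))\<^sup>2) + 3 * (4 * (norm (m - m'))\<^sup>2)"
      using card_vertices[of L] by (intro add_left_mono mult_right_mono) auto
    finally have "area L * (\<Sum>x\<in>vertices L. (norm (extension v L x - m'))\<^sup>2) \<le> area L * \<dots>"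
      by (rule mult_left_mono) (rule area_nonneg)
    then show ?thesis by (simp add: algebra_simps)
  qed
  then have "spread v S m' \<le> (\<Sum>L\<in>S. (4/3) * (area L * (\<Sum>x\<in>vertices L. (norm (extension v L x - m))\<^sup>2)) + area L * (12 * (norm (m - m'))\<^sup>2))"
    unfolding spread_def by (rule sum_mono)
  also have "\<dots> = (4/3) * spread v S m + (\<Sum>L\<in>S. area L) * (12 * (norm (m - m'))\<^sup>2)"
    unfolding spread_def by (simp add: sum.distrib sum_distrib_left sum_distrib_right)
  finally show ?thesis by (simp add: mult_ac)
qed

inductive descendant :: "tri \<Rightarrow> tri \<Rightarrow> bool" where
  self: "descendant K K"
| left: "descendant (midpoint b c, a, b) M \<Longrightarrow> descendant (a, b, c) M"
| right: "descendant (midpoint b c, c, a) M \<Longrightarrow> descendant (a, b, c) M"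

text \<open>On the bisector of every triangle below \<open>K\<close> the two children have the same mean of \<open>v\<close>. The vertices
  opposite to the bisector are \<open>b\<close> in the first and \<open>c\<close> in the second child.\<close>

definition matched :: "field \<Rightarrow> mesh \<Rightarrow> tri \<Rightarrow> bool" where
  "matched v T K \<longleftrightarrow> (\<forall>a b c S1 S2. descendant K (a, b, c) \<longrightarrow>
     bis_tree (midpoint b c, a, b) S1 \<longrightarrow> bis_tree (midpoint b c, c, a) S2 \<longrightarrow> S1 \<union> S2 \<subseteq> T \<longrightarrow>
     (1 / area (midpoint b c, a, b)) *\<^sub>R moment v S1 b = (1 / area (midpoint b c, c, a)) *\<^sub>R moment v S2 c)"

text \<open>Compare the mean over an edge with the common mean of the two children over the bisector. Around the
  latter, the induction hypothesis gives half of the asserted bound because \<open>size2\<close> is halved; the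
  difference of the two means is a combination of the mean gradients of the children. The factor
  \<open>18\<close> is a fixed point: with \<open>spread_shift\<close>, \<open>(4/3) * (18/2) + 12 * (1/2) = 18\<close>.\<close>

lemma tree_poincare:
  assumes "bis_tree K S" "tri_det K \<noteq> 0" "S \<subseteq> T" "matched v T K" "P \<in> vertices K"
  shows "spread v S ((1 / area K) *\<^sub>R moment v S P) \<le> 18 * size2 K * energy v S"
  using assms
proof (induction arbitrary: P rule: bis_tree.induct)
  case (leaf K)
  then show ?case using leaf_spread by blast
next
  case (node b c a S1 S2)
  define K where "K = (a, b, c)"
  define K1 where "K1 = (midpoint b c, a, b)"
  define K2 where "K2 = (midpoint b c, c, a)"
  note t = node.hyps[folded K1_def K2_def]
  note d = node.prems(1)
  note d12 = region_children(3,4)[OF d, folded K1_def K2_def]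
  have fin: "finite S1" "finite S2" using tree_finite t by auto
  have disj: "S1 \<inter> S2 = {}" using tree_children_disjoint[OF d node.hyps] .
  have "matched v T K1" "matched v T K2"
    using node.prems(3) unfolding matched_def K1_def K2_def by (meson descendant.left, meson descendant.right)
  note IH1 = node.IH(1)[folded K1_def, OF d12(1) _ this(1)] and IH2 = node.IH(2)[folded K2_def, OF d12(2) _ this(2)]
  have ar: "area K1 = area K / 2" "area K2 = area K / 2" unfolding K1_def K2_def K_def area_children by auto
  have sz: "size2 K1 = size2 K / 2" "size2 K2 = size2 K / 2" unfolding K1_def K2_def K_def size2_children by auto
  define m where "m = (1 / area K1) *\<^sub>R moment v S1 b"
  have m2: "m = (1 / area K2) *\<^sub>R moment v S2 c"
    using node.prems(3) descendant.self[of "(a,b,c)"] node.hyps node.prems(2)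
    unfolding matched_def m_def K1_def K2_def by blast
  have b1: "spread v S1 m \<le> 18 * size2 K1 * energy v S1"
    unfolding m_def using node.prems(2) by (intro IH1) (auto simp: K1_def)
  have b2: "spread v S2 m \<le> 18 * size2 K2 * energy v S2"
    unfolding m2 using node.prems(2) by (intro IH2) (auto simp: K2_def)
  have split: "spread v (S1 \<union> S2) x = spread v S1 x + spread v S2 x" "energy v (S1 \<union> S2) = energy v S1 + energy v S2"
    "moment v (S1 \<union> S2) y = moment v S1 y + moment v S2 y" for x y
    unfolding spread_def energy_def moment_def using fin disj by (simp_all add: sum.union_disjoint)
  have bm: "spread v (S1 \<union> S2) m \<le> 9 * size2 K * energy v (S1 \<union> S2)"
    using b1 b2 unfolding split sz by (simp add: algebra_simps)
  define G1 where "G1 = mean_slope v K1 S1"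
  define G2 where "G2 = mean_slope v K2 S2"
  define mP where "mP = (1 / area K) *\<^sub>R moment v (S1 \<union> S2) P"
  have "mP = (1/2) *\<^sub>R ((1 / area K1) *\<^sub>R moment v S1 P) + (1/2) *\<^sub>R ((1 / area K2) *\<^sub>R moment v S2 P)"
    unfolding mP_def split ar by (simp add: scaleR_add_right)
  also have "\<dots> = (1/2) *\<^sub>R (m + (1/2) *\<^sub>R (G1 *v (b - P))) + (1/2) *\<^sub>R (m + (1/2) *\<^sub>R (G2 *v (c - P)))"
    unfolding mean_diff[of K1 v S1 P b] mean_diff[of K2 v S2 P c] m_def[symmetric] m2[symmetric] G1_def G2_def by simp
  also have "\<dots> = m + (1/4) *\<^sub>R (G1 *v (b - P) + G2 *v (c - P))"
    by (simp add: coords2 field_simps)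
  finally have "m - mP = - (1/4) *\<^sub>R (G1 *v (b - P) + G2 *v (c - P))" by simp
  then have "(norm (m - mP))\<^sup>2 = (1/16) * (norm (G1 *v (b - P) + G2 *v (c - P)))\<^sup>2"
    by (simp add: power_mult_distrib power2_eq_square)
  also have "\<dots> \<le> (1/16) * (2 * (norm (G1 *v (b - P)))\<^sup>2 + 2 * (norm (G2 *v (c - P)))\<^sup>2)"
    using norm_add_sq by (intro mult_left_mono) auto
  also have "\<dots> \<le> (1/16) * (2 * ((norm G1)\<^sup>2 * (2 * size2 K)) + 2 * ((norm G2)\<^sup>2 * (2 * size2 K)))"
    using vertices_dist[of b K P] vertices_dist[of c K P] node.prems(4)
    by (intro mult_left_mono add_mono order_trans[OF norm_matrix_vector_sq]) (auto simp: K_def)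
  finally have nm: "(norm (m - mP))\<^sup>2 \<le> size2 K / 4 * ((norm G1)\<^sup>2 + (norm G2)\<^sup>2)" by (simp add: algebra_simps)
  have "area K * (norm (m - mP))\<^sup>2 \<le> area K * (size2 K / 4 * ((norm G1)\<^sup>2 + (norm G2)\<^sup>2))"
    using nm by (rule mult_left_mono) (rule area_nonneg)
  also have "\<dots> = size2 K / 2 * (area K1 * (norm G1)\<^sup>2 + area K2 * (norm G2)\<^sup>2)"
    unfolding ar by (simp add: algebra_simps)
  also have "\<dots> \<le> size2 K / 2 * (energy v S1 + energy v S2)"
    unfolding G1_def G2_def using size2_nonneg[of K]
    by (intro mult_left_mono add_mono mean_slope_energy t d12) auto
  finally have am: "area K * (norm (m - mP))\<^sup>2 \<le> size2 K / 2 * energy v (S1 \<union> S2)" unfolding split .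
  have "(\<Sum>L\<in>S1 \<union> S2. area L) = area K" unfolding K_def
    by (rule tree_area_sum[OF bis_tree.node[OF node.hyps] d])
  then have "spread v (S1 \<union> S2) mP \<le> (4/3) * spread v (S1 \<union> S2) m + 12 * area K * (norm (m - mP))\<^sup>2"
    using spread_shift[of "S1 \<union> S2" v mP m] fin by simp
  also have "\<dots> \<le> (4/3) * (9 * size2 K * energy v (S1 \<union> S2)) + 12 * (size2 K / 2 * energy v (S1 \<union> S2))"
    using bm am by linarith
  also have "\<dots> = 18 * size2 K * energy v (S1 \<union> S2)" by simp
  finally show ?case unfolding mP_def K_def .
qed

section \<open>A discrete Friedrichs inequality across two meshes\<close>

definition edge_mean :: "field \<Rightarrow> mesh \<Rightarrow> tri \<Rightarrow> point \<Rightarrow> point" where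
  "edge_mean v T K P = (1 / area K) *\<^sub>R moment v (leaves T K) P"

text \<open>The properties of a field on a refinement \<open>T\<close> of \<open>T0\<close> that the Friedrichs inequality uses. They refer to the
  bisection forest over \<open>T0\<close> and not to continuity across the edges of \<open>T\<close>; this is why Crouzeix-Raviart
  fields of coarser meshes have them as well.\<close>

definition mean_continuous :: "point set \<Rightarrow> mesh \<Rightarrow> mesh \<Rightarrow> field \<Rightarrow> bool" where
  "mean_continuous \<Omega> T0 T v \<longleftrightarrow> (\<forall>L\<in>T. affine_on v L) \<and> (\<forall>K\<in>T0. matched v T K) \<and>
    (\<forall>K\<in>T0. \<forall>E\<in>edges K. \<forall>P. apex K E P \<longrightarrow>
       (segment E \<subseteq> frontier \<Omega> \<longrightarrow> edge_mean v T K P = 0) \<and>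
       (\<not> segment E \<subseteq> frontier \<Omega> \<longrightarrow> (\<forall>E'\<in>edges (neighbour T0 K E). \<forall>P'. segment E' = segment E \<longrightarrow>
          apex (neighbour T0 K E) E' P' \<longrightarrow> edge_mean v T (neighbour T0 K E) P' = edge_mean v T K P)))"

lemma ext_const: 
  assumes "tri_det K \<noteq> 0" shows "extension (\<lambda>x. w) K x = w" "slope (\<lambda>x. w) K = 0"
  using affine_data[OF assms, of "\<lambda>x. w" 0 w] by (simp_all add: matrix_vector_mult_0)

text \<open>Otherwise all fluxes of the field \<open>x\<close>, with \<open>v\<close> constant, would cancel in \<open>B\<close>, and the area of
  the union of \<open>B\<close> would vanish.\<close>

lemma exposed_edge:
  assumes conf: "conforming_triangulation \<Omega> T" and op: "open \<Omega>" and B: "B \<subseteq> T" "B \<noteq> {}"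
  obtains K E where "K \<in> B" "E \<in> edges K" "segment E \<subseteq> frontier \<Omega> \<or> neighbour T K E \<notin> B"
proof (rule ccontr)
  assume "\<not> thesis"
  then have H: "\<not> segment E \<subseteq> frontier \<Omega> \<and> neighbour T K E \<in> B" if "K \<in> B" "E \<in> edges K" for K E
    using that \<open>\<not> thesis\<close> \<open>\<And>E K. \<lbrakk>K \<in> B; E \<in> edges K; segment E \<subseteq> frontier \<Omega> \<or> neighbour T K E \<notin> B\<rbrakk> \<Longrightarrow> thesis\<close> by blast
  define w :: point where "w = axis 1 1"
  have w: "w \<noteq> 0" by (simp add: w_def axis_eq_0_iff)
  have det: "tri_det L \<noteq> 0" if "L \<in> B" for L using that B conf_det[OF conf] by blast
  have "(\<Sum>L\<in>B. 1 *\<^sub>R tri_moment (\<lambda>x. w) L 0) = 0"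
  proof (rule flux_cancel[OF conf op B(1), where \<beta> = "\<lambda>L. 1" and Pt = "\<lambda>L. 0"])
    fix L E assume L: "L \<in> B" "E \<in> edges L"
    have LT: "L \<in> T" using L B by blast
    note h = H[OF L]
    note N = neighbour_props[OF conf op LT L(2) conjunct1[OF h]]
    show "\<not> segment E \<subseteq> frontier \<Omega> \<and> neighbour T L E \<in> B \<and>
      extension (\<lambda>x. w) (neighbour T L E) (edge_midpoint E) = extension (\<lambda>x. w) L (edge_midpoint E) \<and>
      (\<forall>E'\<in>edges (neighbour T L E). segment E' = segment E \<longrightarrow>
          1 * edge_height (neighbour T L E) E' 0 = - (1 * edge_height L E 0))"
      using h ext_const(1)[OF det[OF L(1)]] ext_const(1)[OF det[OF conjunct2[OF h]]]
        opposite_heights[OF conf LT N(1) N(2)[symmetric] L(2)] by auto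
  qed
  moreover have "tri_moment (\<lambda>x. w) L 0 = area L *\<^sub>R w" if "L \<in> B" for L
    unfolding tri_moment_def ext_const(2)[OF det[OF that]] by (simp add: matrix_vector_mult_0)
  ultimately have "(\<Sum>L\<in>B. area L) *\<^sub>R w = 0" by (simp add: scaleR_sum_left)
  then have "(\<Sum>L\<in>B. area L) = 0" using w by simp
  moreover have "0 < (\<Sum>L\<in>B. area L)"
    using B finite_subset[OF B(1) conf_finite[OF conf]] area_pos[OF det] by (intro sum_pos) auto
  ultimately show False by simp
qed

lemma sum_UN_le:
  fixes f :: "'b \<Rightarrow> real"
  assumes "finite I" "\<And>i. i \<in> I \<Longrightarrow> finite (A i)" "\<And>x. 0 \<le> f x"
  shows "sum f (\<Union>i\<in>I. A i) \<le> (\<Sum>i\<in>I. sum f (A i))"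
  using assms
proof (induction rule: finite_induct)
  case (insert i I)
  have "sum f (\<Union>j\<in>insert i I. A j) \<le> sum f (A i) + sum f (\<Union>j\<in>I. A j)"
    using insert by (simp add: sum_Un_nat sum_Un sum_nonneg)
  then show ?case using insert by force
qed simp

text \<open>Consider the triangles of \<open>T0\<close> whose edge means are not bounded by the energy, uniformly in the
  refinement and the field. If there were any, then one of them would have an edge on the boundary,
  where the mean is zero, or an edge in common with a triangle whose means are bounded; and by \<open>mean_diff\<close>
  a bound for one edge of a triangle implies one for all its edges.\<close>

lemma friedrichs:
  assumes conf0: "conforming_triangulation \<Omega> T0" and op: "open \<Omega>"
  obtains C where "C > 0" "\<And>T \<sigma> v. conforming_triangulation \<Omega> T \<Longrightarrow> forest T0 T \<sigma> \<Longrightarrow> mean_continuous \<Omega> T0 T v \<Longrightarrow>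
      spread v T 0 \<le> C * energy v T"
proof -
  define adm where "adm T v \<longleftrightarrow> conforming_triangulation \<Omega> T \<and> (\<exists>\<sigma>. forest T0 T \<sigma>) \<and> mean_continuous \<Omega> T0 T v" for T v
  define bd where "bd K C \<longleftrightarrow> (\<forall>T v. adm T v \<longrightarrow> (\<forall>P\<in>vertices K. (norm (edge_mean v T K P))\<^sup>2 \<le> C * energy v T))" for K C
  note det = conf_det[OF conf0]
  have tree: "bis_tree K (leaves T K)" "leaves T K \<subseteq> T" "T = (\<Union>K\<in>T0. leaves T K)" if "adm T v" "K \<in> T0" for T v K
  proof -
    obtain \<sigma> where \<sigma>: "forest T0 T \<sigma>" and conf: "conforming_triangulation \<Omega> T" using \<open>adm T v\<close> adm_def by auto
    have eq: "\<sigma> K = leaves T K" if "K \<in> T0" for K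
      using \<sigma> that unfolding forest_def by (intro tree_leaves[OF conf _ det[OF that]]) auto
    show "bis_tree K (leaves T K)" "leaves T K \<subseteq> T" "T = (\<Union>K\<in>T0. leaves T K)"
      using \<sigma> eq that unfolding forest_def leaves_def by auto
  qed
  have el: "energy v (leaves T K) \<le> energy v T" if "adm T v" for T v K
    unfolding energy_def using that conf_finite unfolding adm_def leaves_def
    by (intro sum_mono2) (auto simp: area_nonneg)
  have move: "(norm (edge_mean v T K P))\<^sup>2 \<le> 2 * (norm (edge_mean v T K Q))\<^sup>2 + size2 K / area K * energy v T"
    if a: "adm T v" and K: "K \<in> T0" and P: "P \<in> vertices K" and Q: "Q \<in> vertices K" for T v K P Q
  proof -
    define G where "G = mean_slope v K (leaves T K)"
    note A = area_pos[OF det[OF K]]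
    have "edge_mean v T K P = edge_mean v T K Q + (1/2) *\<^sub>R (G *v (Q - P))"
      unfolding edge_mean_def G_def by (rule mean_diff)
    then have "(norm (edge_mean v T K P))\<^sup>2 \<le> 2 * (norm (edge_mean v T K Q))\<^sup>2 + 2 * (norm ((1/2) *\<^sub>R (G *v (Q - P))))\<^sup>2"
      using norm_add_sq by metis
    also have "2 * (norm ((1/2) *\<^sub>R (G *v (Q - P))))\<^sup>2 = (1/2) * (norm (G *v (Q - P)))\<^sup>2"
      by (simp add: power_mult_distrib power2_eq_square)
    also have "\<dots> \<le> (1/2) * ((norm G)\<^sup>2 * (2 * size2 K))"
      using vertices_dist[OF Q P] by (intro mult_left_mono order_trans[OF norm_matrix_vector_sq]) auto
    also have "\<dots> = size2 K / area K * (area K * (norm G)\<^sup>2)" using A by simp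
    also have "\<dots> \<le> size2 K / area K * energy v T"
      using A size2_nonneg[of K] order_trans[OF mean_slope_energy[OF tree(1)[OF a K] det[OF K], of v] el[OF a]]
      unfolding G_def by (intro mult_left_mono) auto
    finally show ?thesis by simp
  qed
  have vert: "P \<in> vertices K" if "apex K E P" for K E P using that unfolding apex_def by blast
  have ap: "\<exists>P. apex K E P" if "E \<in> edges K" for K E using apex_exists[OF that] unfolding apex_def by metis
  have all: "\<exists>C. bd K C" if "K \<in> T0" for K
  proof (rule ccontr)
    assume "\<not> (\<exists>C. bd K C)"
    define B where "B = {K \<in> T0. \<not> (\<exists>C. bd K C)}"
    have "B \<subseteq> T0" "B \<noteq> {}" unfolding B_def using \<open>\<not> (\<exists>C. bd K C)\<close> that by blast+
    then obtain K E where KE: "K \<in> B" "E \<in> edges K" "segment E \<subseteq> frontier \<Omega> \<or> neighbour T0 K E \<notin> B"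
      using exposed_edge[OF conf0 op] by metis
    have K: "K \<in> T0" using KE(1) B_def by blast
    obtain Q where Q: "apex K E Q" using ap[OF KE(2)] by blast
    have "\<exists>C. \<forall>T v. adm T v \<longrightarrow> (norm (edge_mean v T K Q))\<^sup>2 \<le> C * energy v T"
    proof (cases "segment E \<subseteq> frontier \<Omega>")
      case True
      then have "edge_mean v T K Q = 0" if "adm T v" for T v
        using that K KE(2) Q unfolding adm_def mean_continuous_def by blast
      then show ?thesis by (intro exI[of _ 0]) auto
    next
      case False
      define N where "N = neighbour T0 K E"
      note np = neighbour_props[OF conf0 op K KE(2) False, folded N_def]
      have "N \<notin> B" using KE(3) False N_def by simp
      then obtain C where C: "bd N C" using np(1) unfolding B_def by blast
      obtain E' where E': "E' \<in> edges N" "segment E' = segment E" using np(3) by auto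
      obtain P' where P': "apex N E' P'" using ap[OF E'(1)] by blast
      have "edge_mean v T N P' = edge_mean v T K Q" if "adm T v" for T v
        using that K KE(2) Q False E' P' unfolding adm_def mean_continuous_def N_def by blast
      then show ?thesis using C vert[OF P'] unfolding bd_def by metis
    qed
    then obtain C where C: "\<And>T v. adm T v \<Longrightarrow> (norm (edge_mean v T K Q))\<^sup>2 \<le> C * energy v T" by blast
    have "bd K (2 * C + size2 K / area K)"
      unfolding bd_def
    proof (intro allI impI ballI)
      fix T v P assume "adm T v" "P \<in> vertices K"
      then show "(norm (edge_mean v T K P))\<^sup>2 \<le> (2 * C + size2 K / area K) * energy v T"
        using move[OF _ K _ vert[OF Q], of T v P] C[of T v] by (simp add: distrib_right)
    qed
    then show False using KE(1) unfolding B_def by blast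
  qed
  then obtain C where C: "\<And>K. K \<in> T0 \<Longrightarrow> bd K (C K)" by metis
  define D where "D K = 24 * size2 K + 12 * area K * C K" for K
  define M where "M = (\<Sum>K\<in>T0. \<bar>D K\<bar>) + 1"
  show ?thesis
  proof (rule that[of M])
    have "0 \<le> (\<Sum>K\<in>T0. \<bar>D K\<bar>)" by (simp add: sum_nonneg)
    then show "M > 0" unfolding M_def by linarith
    fix T \<sigma> v
    assume asm: "conforming_triangulation \<Omega> T" "forest T0 T \<sigma>" "mean_continuous \<Omega> T0 T v"
    then have a: "adm T v" unfolding adm_def by blast
    have each: "spread v (leaves T K) 0 \<le> \<bar>D K\<bar> * energy v T" if K: "K \<in> T0" for K
    proof -
      obtain P where P: "P \<in> vertices K" by (cases K) auto
      define m where "m = edge_mean v T K P"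
      note t = tree[OF a K]
      have "matched v T K" using asm(3) K unfolding mean_continuous_def by blast
      then have "spread v (leaves T K) m \<le> 18 * size2 K * energy v (leaves T K)"
        unfolding m_def edge_mean_def by (rule tree_poincare[OF t(1) det[OF K] t(2) _ P])
      also have "\<dots> \<le> 18 * size2 K * energy v T" using el[OF a] size2_nonneg by (intro mult_left_mono) auto
      finally have 1: "spread v (leaves T K) m \<le> 18 * size2 K * energy v T" .
      have "(norm m)\<^sup>2 \<le> C K * energy v T" using C[OF K] a P unfolding bd_def m_def by blast
      then have 2: "area K * (norm m)\<^sup>2 \<le> area K * (C K * energy v T)" by (rule mult_left_mono) (rule area_nonneg)
      have "spread v (leaves T K) 0 \<le> (4/3) * spread v (leaves T K) m + 12 * area K * (norm m)\<^sup>2"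
        using spread_shift[of "leaves T K" v 0 m] tree_finite[OF t(1)] tree_area_sum[OF t(1) det[OF K]] by simp
      also have "\<dots> \<le> D K * energy v T" using 1 2 unfolding D_def by (simp add: algebra_simps)
      also have "\<dots> \<le> \<bar>D K\<bar> * energy v T" by (intro mult_right_mono energy_nonneg) auto
      finally show ?thesis .
    qed
    show "spread v T 0 \<le> M * energy v T"
    proof (cases "T0 = {}")
      case True
      then have "T = {}" using asm(2) unfolding forest_def by simp
      then show ?thesis by (simp add: spread_def energy_def)
    next
      case False
      then obtain K0 where "K0 \<in> T0" by blast
      have "spread v T 0 = spread v (\<Union>K\<in>T0. leaves T K) 0" using tree(3)[OF a \<open>K0 \<in> T0\<close>] by simp
      also have "\<dots> \<le> (\<Sum>K\<in>T0. spread v (leaves T K) 0)"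
        unfolding spread_def using conf_finite[OF conf0] tree_finite[OF tree(1)[OF a]]
        by (intro sum_UN_le) (auto intro!: mult_nonneg_nonneg area_nonneg sum_nonneg)
      also have "\<dots> \<le> (\<Sum>K\<in>T0. \<bar>D K\<bar> * energy v T)" using each by (rule sum_mono)
      also have "\<dots> \<le> M * energy v T" unfolding M_def sum_distrib_right[symmetric]
        by (intro mult_right_mono energy_nonneg) simp
      finally show ?thesis .
    qed
  qed
qed

section \<open>Crouzeix-Raviart fields of nested meshes\<close>

lemma descendant_region:
  "descendant K M \<Longrightarrow> tri_det K \<noteq> 0 \<Longrightarrow> tri_det M \<noteq> 0 \<and> region M \<subseteq> region K"
proof (induction rule: descendant.induct)
  case (left b c a M)
  then show ?case using region_children[OF left.prems] by blast
next
  case (right b c a M)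
  then show ?case using region_children[OF right.prems] by blast
qed auto

lemma bisector_interior:
  assumes d: "tri_det (a, b, c) \<noteq> 0"
  shows "open_segment (midpoint b c) a \<subseteq> interior (region (a, b, c))"
proof
  fix x assume x: "x \<in> open_segment (midpoint b c) a"
  define K1 where "K1 = (midpoint b c, a, b)"
  note d1 = region_children(3)[OF d, folded K1_def]
  have e: "(midpoint b c, a) \<in> edges K1" by (simp add: K1_def)
  have ne: "(a, b) \<noteq> (midpoint b c, a)" "(b, midpoint b c) \<noteq> (midpoint b c, a)"
    using edge_distinct[OF d1, of "midpoint b c" a] edge_distinct[OF d1, of a b] e by (auto simp: K1_def)
  have "edge_height K1 (midpoint b c, a) x = 0" "0 < edge_height K1 (a, b) x" "0 < edge_height K1 (b, midpoint b c) x"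
    using open_segment_heights[OF d1 e x] ne by (auto simp: K1_def)
  then show "x \<in> interior (region (a, b, c))"
    unfolding interior_region[OF d] unfolding K1_def height_children by auto
qed

lemma apexI: "K = (a, b, c) \<Longrightarrow> tri_det K \<noteq> 0 \<Longrightarrow> apex K (a, b) c"
  "K = (a, b, c) \<Longrightarrow> tri_det K \<noteq> 0 \<Longrightarrow> apex K (c, a) b"
  unfolding apex_def by (auto simp: edge_height_vertices[OF refl])

lemma forest_leaves:
  assumes conf0: "conforming_triangulation \<Omega> T0" and conf: "conforming_triangulation \<Omega> T"
    and fo: "forest T0 T \<sigma>" and K: "K \<in> T0"
  shows "bis_tree K (leaves T K)" "\<sigma> K = leaves T K"
proof -
  show "\<sigma> K = leaves T K"
    using fo K unfolding forest_def by (intro tree_leaves[OF conf _ conf_det[OF conf0 K]]) auto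
  then show "bis_tree K (leaves T K)" using fo K unfolding forest_def by auto
qed

lemma leaves_subset: "leaves T K \<subseteq> T"
  by (auto simp: leaves_def)

lemma mean_continuous_fine:
  assumes conf0: "conforming_triangulation \<Omega> T0" and conf: "conforming_triangulation \<Omega> T" and op: "open \<Omega>"
    and fo: "forest T0 T \<sigma>" and v: "weakly_continuous \<Omega> T v"
  shows "mean_continuous \<Omega> T0 T v"
  unfolding mean_continuous_def
proof (intro conjI ballI allI impI)
  show "affine_on v L" if "L \<in> T" for L using v that unfolding weakly_continuous_def by blast
  show "matched v T K" if K: "K \<in> T0" for K
    unfolding matched_def
  proof (intro allI impI)
    fix a b c S1 S2
    assume M: "descendant K (a, b, c)" and t: "bis_tree (midpoint b c, a, b) S1" "bis_tree (midpoint b c, c, a) S2"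
      and S: "S1 \<union> S2 \<subseteq> T"
    define K1 where "K1 = (midpoint b c, a, b)"
    define K2 where "K2 = (midpoint b c, c, a)"
    have dM: "tri_det (a, b, c) \<noteq> 0" and rM: "region (a, b, c) \<subseteq> region K"
      using descendant_region[OF M conf_det[OF conf0 K]] by auto
    note d = region_children(3,4)[OF dM, folded K1_def K2_def]
    have int: "interior (region (a, b, c)) \<subseteq> \<Omega>"
      using interior_mono[OF rM] conf_interior[OF conf0 K] by blast
    have "region K1 \<subseteq> region (a, b, c)" "region K2 \<subseteq> region (a, b, c)"
      using region_children(1)[OF dM] unfolding K1_def K2_def by auto
    then have i: "interior (region K1) \<subseteq> \<Omega>" "interior (region K2) \<subseteq> \<Omega>"
      using int interior_mono by blast+
    show "(1 / area (midpoint b c, a, b)) *\<^sub>R moment v S1 b = (1 / area (midpoint b c, c, a)) *\<^sub>R moment v S2 c"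
      unfolding K1_def[symmetric] K2_def[symmetric]
    proof (rule edge_mean_match[OF conf op v t(1) _ _ _ t(2), folded K1_def K2_def])
      show "(midpoint b c, a) \<in> edges K1" "(a, midpoint b c) \<in> edges K2" by (simp_all add: K1_def K2_def)
      show "segment (midpoint b c, a) = segment (a, midpoint b c)" by (simp add: closed_segment_commute)
      show "edge_height K2 (a, midpoint b c) x = - edge_height K1 (midpoint b c, a) x" for x
        unfolding K1_def K2_def height_children by (simp add: field_simps)
      show "(midpoint b c, a) = (midpoint b c, a)" by simp
      show "open_segment (midpoint b c) a \<subseteq> \<Omega>" using bisector_interior[OF dM] int by blast
      show "apex K1 (midpoint b c, a) b" "apex K2 (a, midpoint b c) c"
        using apexI(1)[OF K1_def d(1)] apexI(2)[OF K2_def d(2)] by auto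
    qed (use d i S in auto)
  qed
next
  fix K E P assume K: "K \<in> T0" and E: "E \<in> edges K" and P: "apex K E P"
  have prep: "bis_tree M (leaves T M)" "tri_det M \<noteq> 0" "leaves T M \<subseteq> T" "interior (region M) \<subseteq> \<Omega>" if "M \<in> T0" for M
    using forest_leaves(1)[OF conf0 conf fo that] conf_det[OF conf0 that] leaves_subset conf_interior[OF conf0 that] by auto
  show "edge_mean v T K P = 0" if "segment E \<subseteq> frontier \<Omega>"
    unfolding edge_mean_def edge_mean_boundary[OF conf op v prep[OF K] P that] by simp
  assume nf: "\<not> segment E \<subseteq> frontier \<Omega>"
  fix E' P' assume E': "E' \<in> edges (neighbour T0 K E)" "segment E' = segment E" "apex (neighbour T0 K E) E' P'"
  note N = neighbour_props[OF conf0 op K E nf]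
  obtain p q where pq: "E = (p, q)" by (cases E)
  have "open_segment p q \<subseteq> \<Omega>" using interior_edge[OF conf0 K] E nf pq by simp
  then show "edge_mean v T (neighbour T0 K E) P' = edge_mean v T K P"
    unfolding edge_mean_def
    using edge_mean_match[OF conf op v prep[OF K] prep[OF N(1)] E E'(1) E'(2)[symmetric] _ pq _ P E'(3)]
      opposite_heights[OF conf0 K N(1) N(2)[symmetric] E E'(1,2)] by simp
qed

lemma tri_moment_affine:
  assumes K: "tri_det K \<noteq> 0" and L: "tri_det L \<noteq> 0" and v: "affine_on v K" and sub: "region L \<subseteq> region K"
  shows "tri_moment v L P = area L *\<^sub>R extension v K (centroid L + (1/2) *\<^sub>R (centroid L - P))"
proof -
  have "area L *\<^sub>R ((1 / area L) *\<^sub>R tri_moment v L P) = area L *\<^sub>R extension v K (centroid L + (1/2) *\<^sub>R (centroid L - P))"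
    unfolding tri_moment_ext[OF L] affine_on_subset(3)[OF K L v sub] ..
  then show ?thesis using area_pos[OF L] by simp
qed

lemma ext_average:
  assumes "x + y = 2 *\<^sub>R z" shows "extension v K x + extension v K y = 2 *\<^sub>R extension v K z"
proof -
  have "slope v K *v x + slope v K *v y = 2 *\<^sub>R (slope v K *v z)"
    using assms by (simp only: matrix_vector_right_distrib[symmetric] matrix_vector_mult_scaleR)
  then have *: "(slope v K *v x) $ i + (slope v K *v y) $ i = 2 * (slope v K *v z) $ i" for i
    by (metis vector_add_component vector_scaleR_component real_scaleR_def)
  show ?thesis
  proof (rule vec_eq_iff[THEN iffD2], rule allI)
    fix i
    show "(extension v K x + extension v K y) $ i = (2 *\<^sub>R extension v K z) $ i"
      using *[of i] unfolding extension_def matrix_vector_mult_diff_distrib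
      by (simp only: vector_add_component vector_scaleR_component vector_minus_component real_scaleR_def) (simp add: algebra_simps)
  qed
qed

lemma moment_union:
  assumes "finite S1" "finite S2" "S1 \<inter> S2 = {}"
  shows "moment v (S1 \<union> S2) P = moment v S1 P + moment v S2 P"
  unfolding moment_def using assms by (rule sum.union_disjoint)

text \<open>The integral of an affine function over \<open>K\<close> does not depend on how \<open>K\<close> is bisected.\<close>

lemma moment_affine_tree:
  assumes "bis_tree K S" "tri_det K \<noteq> 0" "affine_on v K"
  shows "moment v S P = tri_moment v K P"
  using assms
proof (induction rule: bis_tree.induct)
  case (node b c a S1 S2)
  define K where "K = (a, b, c)"
  define K1 where "K1 = (midpoint b c, a, b)"
  define K2 where "K2 = (midpoint b c, c, a)"
  note d = node.prems(1)[folded K_def] and v = node.prems(2)[folded K_def]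
  note d12 = region_children(3,4)[OF node.prems(1), folded K1_def K2_def]
  have sub: "region K1 \<subseteq> region K" "region K2 \<subseteq> region K"
    using region_children(1)[OF node.prems(1)] unfolding K_def K1_def K2_def by auto
  have ar: "area K1 = area K / 2" "area K2 = area K / 2" unfolding K1_def K2_def K_def area_children by auto
  have fin: "finite S1" "finite S2" using tree_finite node.hyps by auto
  have disj: "S1 \<inter> S2 = {}" using tree_children_disjoint[OF node.prems(1) node.hyps] .
  have "moment v (S1 \<union> S2) P = tri_moment v K1 P + tri_moment v K2 P"
    unfolding moment_union[OF fin disj]
    using node.IH[folded K1_def K2_def] d12 affine_on_subset(1)[OF d _ v] sub by auto
  also have "\<dots> = (area K / 2) *\<^sub>R (extension v K (centroid K1 + (1/2) *\<^sub>R (centroid K1 - P)) + extension v K (centroid K2 + (1/2) *\<^sub>R (centroid K2 - P)))"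
    unfolding tri_moment_affine[OF d d12(1) v sub(1)] tri_moment_affine[OF d d12(2) v sub(2)] ar by (simp add: scaleR_add_right)
  also have "\<dots> = (area K / 2) *\<^sub>R (2 *\<^sub>R extension v K (centroid K + (1/2) *\<^sub>R (centroid K - P)))"
    by (subst ext_average[where z = "centroid K + (1/2) *\<^sub>R (centroid K - P)"])
      (simp_all add: K_def K1_def K2_def coords2 midpoint_nth field_simps)
  also have "\<dots> = tri_moment v K P" unfolding tri_moment_affine[OF d d v subset_refl] by simp
  finally show ?case unfolding K_def .
qed (simp add: moment_def)

text \<open>Separates the nodes below the leaves, on which a field of the coarse mesh is affine, from those above,
  for which the means over coarse leaves are known.\<close>

lemma tree_descendant:
  assumes "bis_tree K R" "descendant K M"
  shows "(\<exists>r\<in>R. descendant r M) \<or>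
    (\<exists>a b c R1 R2. M = (a, b, c) \<and> bis_tree (midpoint b c, a, b) R1 \<and> bis_tree (midpoint b c, c, a) R2 \<and> R1 \<union> R2 \<subseteq> R)"
  using assms
proof (induction arbitrary: M rule: bis_tree.induct)
  case (node b c a S1 S2)
  from node.prems show ?case
  proof cases
    case self
    then show ?thesis using node.hyps by blast
  next
    case left
    then show ?thesis using node.IH(1)[of M] by blast
  next
    case right
    then show ?thesis using node.IH(2)[of M] by blast
  qed
qed auto

lemma moment_coarse:
  assumes conf: "conforming_triangulation \<Omega> T" and conf': "conforming_triangulation \<Omega> T'"
    and fo: "forest T T' \<tau>" and v: "\<And>K. K \<in> T \<Longrightarrow> affine_on v K"
    and K: "tri_det K \<noteq> 0" and R: "bis_tree K R" "R \<subseteq> T" and S: "bis_tree K S" "S \<subseteq> T'"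
  shows "moment v S P = moment v R P"
proof -
  have t: "bis_tree r (\<tau> r)" "\<tau> r \<subseteq> T'" "tri_det r \<noteq> 0" if "r \<in> R" for r
    using fo R(2) that conf_det[OF conf] unfolding forest_def by blast+
  have "bis_tree K (\<Union>r\<in>R. \<tau> r)" "(\<Union>r\<in>R. \<tau> r) \<subseteq> T'" using tree_subst[OF R(1)] t by blast+
  then have S': "S = (\<Union>r\<in>R. \<tau> r)" using tree_leaves[OF conf' _ K] S by metis
  have "moment v S P = (\<Sum>r\<in>R. moment v (\<tau> r) P)"
    unfolding moment_def S'
  proof (rule sum.UNION_disjoint)
    show "finite R" using tree_finite[OF R(1)] by simp
    show "\<forall>r\<in>R. finite (\<tau> r)" using tree_finite t by blast
    show "\<forall>r\<in>R. \<forall>s\<in>R. r \<noteq> s \<longrightarrow> \<tau> r \<inter> \<tau> s = {}"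
    proof (intro ballI impI, rule ccontr)
      fix r s assume rs: "r \<in> R" "s \<in> R" "r \<noteq> s" "\<tau> r \<inter> \<tau> s \<noteq> {}"
      then obtain L where L: "L \<in> \<tau> r" "L \<in> \<tau> s" by blast
      have "centroid L \<in> interior (region r)" "centroid L \<in> interior (region s)"
        using centroid_interior[OF tree_det[OF t(1,3)[OF rs(1)] L(1)]]
          tree_interior_mono(2)[OF t(1,3)[OF rs(1)] L(1)] tree_interior_mono(2)[OF t(1,3)[OF rs(2)] L(2)] by auto
      then show False using tree_disjoint[OF R(1) K rs(1,2,3)] by blast
    qed
  qed
  also have "\<dots> = (\<Sum>r\<in>R. tri_moment v r P)"
    using moment_affine_tree t v R(2) by (intro sum.cong) auto
  finally show ?thesis by (simp add: moment_def)
qed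

text \<open>Above the triangles of \<open>T\<close> the means over the leaves in \<open>T'\<close> are those over the leaves in \<open>T\<close>. Below a
  triangle of \<open>T\<close> the field is affine, and the mean over a bisector is its value at the midpoint.\<close>

lemma mean_continuous_coarse:
  assumes conf0: "conforming_triangulation \<Omega> T0" and conf: "conforming_triangulation \<Omega> T"
    and conf': "conforming_triangulation \<Omega> T'" and op: "open \<Omega>"
    and fo: "forest T0 T \<sigma>" and fo': "forest T T' \<tau>" and fo2: "forest T0 T' \<upsilon>"
    and v: "mean_continuous \<Omega> T0 T v"
  shows "mean_continuous \<Omega> T0 T' v"
proof -
  have aff: "affine_on v K" if "K \<in> T" for K using v that unfolding mean_continuous_def by blast
  have em: "edge_mean v T' K P = edge_mean v T K P" if "K \<in> T0" for K P
    unfolding edge_mean_def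
    using moment_coarse[OF conf conf' fo' aff conf_det[OF conf0 that] forest_leaves(1)[OF conf0 conf fo that] leaves_subset
      forest_leaves(1)[OF conf0 conf' fo2 that] leaves_subset] by simp
  have "affine_on v L" if L: "L \<in> T'" for L
  proof -
    obtain K where K: "K \<in> T" "L \<in> \<tau> K" using fo' L unfolding forest_def by blast
    then have "bis_tree K (\<tau> K)" using fo' unfolding forest_def by blast
    then show ?thesis
      using affine_on_subset(1)[OF conf_det[OF conf K(1)] conf_det[OF conf' L] aff[OF K(1)]]
        tree_interior_mono(1)[OF _ conf_det[OF conf K(1)] K(2)] by blast
  qed
  moreover have "matched v T' K" if K: "K \<in> T0" for K
    unfolding matched_def
  proof (intro allI impI)
    fix a b c S1 S2
    assume M: "descendant K (a, b, c)" and t: "bis_tree (midpoint b c, a, b) S1" "bis_tree (midpoint b c, c, a) S2"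
      and S: "S1 \<union> S2 \<subseteq> T'"
    define K1 where "K1 = (midpoint b c, a, b)"
    define K2 where "K2 = (midpoint b c, c, a)"
    have dM: "tri_det (a, b, c) \<noteq> 0" using descendant_region[OF M conf_det[OF conf0 K]] by auto
    note d = region_children(3,4)[OF dM, folded K1_def K2_def]
    have sub: "region K1 \<subseteq> region (a, b, c)" "region K2 \<subseteq> region (a, b, c)"
      using region_children(1)[OF dM] unfolding K1_def K2_def by auto
    have "bis_tree K (leaves T K)" by (rule forest_leaves(1)[OF conf0 conf fo K])
    from tree_descendant[OF this M]
    consider r where "r \<in> T" "descendant r (a, b, c)"
      | R1 R2 where "bis_tree K1 R1" "bis_tree K2 R2" "R1 \<union> R2 \<subseteq> T"
      unfolding K1_def K2_def using leaves_subset by blast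
    then have "(1 / area K1) *\<^sub>R moment v S1 b = (1 / area K2) *\<^sub>R moment v S2 c"
    proof cases
      case 1
      note dr = conf_det[OF conf 1(1)] and vr = aff[OF 1(1)]
      have "region (a, b, c) \<subseteq> region r" using descendant_region[OF 1(2) dr] by simp
      then have sr: "region K1 \<subseteq> region r" "region K2 \<subseteq> region r" using sub by auto
      have "centroid K1 + (1/2) *\<^sub>R (centroid K1 - b) = centroid K2 + (1/2) *\<^sub>R (centroid K2 - c)"
        by (simp add: K1_def K2_def coords2 midpoint_nth field_simps)
      then show ?thesis
        unfolding moment_affine_tree[OF t(1)[folded K1_def] d(1) affine_on_subset(1)[OF dr d(1) vr sr(1)]]
          moment_affine_tree[OF t(2)[folded K2_def] d(2) affine_on_subset(1)[OF dr d(2) vr sr(2)]]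
          tri_moment_ext[OF d(1)] tri_moment_ext[OF d(2)] affine_on_subset(3)[OF dr d(1) vr sr(1)] affine_on_subset(3)[OF dr d(2) vr sr(2)]
        by simp
    next
      case 2
      have "(1 / area K1) *\<^sub>R moment v R1 b = (1 / area K2) *\<^sub>R moment v R2 c"
        using v K M 2 unfolding mean_continuous_def matched_def K1_def K2_def by blast
      moreover have "moment v S1 b = moment v R1 b"
        using moment_coarse[OF conf conf' fo' aff d(1) 2(1) _ t(1)[folded K1_def]] 2(3) S by blast
      moreover have "moment v S2 c = moment v R2 c"
        using moment_coarse[OF conf conf' fo' aff d(2) 2(2) _ t(2)[folded K2_def]] 2(3) S by blast
      ultimately show ?thesis by simp
    qed
    then show "(1 / area (midpoint b c, a, b)) *\<^sub>R moment v S1 b = (1 / area (midpoint b c, c, a)) *\<^sub>R moment v S2 c"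
      unfolding K1_def K2_def .
  qed
  moreover have "edge_mean v T' (neighbour T0 K E) P' = edge_mean v T' K P \<and> edge_mean v T' K P = edge_mean v T K P"
    if "K \<in> T0" "E \<in> edges K" "apex K E P" "\<not> segment E \<subseteq> frontier \<Omega>"
      "E' \<in> edges (neighbour T0 K E)" "segment E' = segment E" "apex (neighbour T0 K E) E' P'" for K E P E' P'
  proof -
    have "edge_mean v T (neighbour T0 K E) P' = edge_mean v T K P"
      using v that unfolding mean_continuous_def by blast
    then show ?thesis using em[OF that(1)] em[OF neighbour_props(1)[OF conf0 op that(1,2,4)]] by simp
  qed
  moreover have "edge_mean v T' K P = 0" if "K \<in> T0" "E \<in> edges K" "apex K E P" "segment E \<subseteq> frontier \<Omega>" for K E P
  proof -
    have "edge_mean v T K P = 0" using v that unfolding mean_continuous_def by blast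
    then show ?thesis using em[OF that(1)] by simp
  qed
  ultimately show ?thesis unfolding mean_continuous_def by blast
qed

lemma mean_continuous_diff:
  assumes conf0: "conforming_triangulation \<Omega> T0" and conf: "conforming_triangulation \<Omega> T" and op: "open \<Omega>"
    and u: "mean_continuous \<Omega> T0 T u" and v: "mean_continuous \<Omega> T0 T v"
  shows "mean_continuous \<Omega> T0 T (\<lambda>x. u x - v x)"
proof -
  define w where "w = (\<lambda>x. u x - v x)"
  have aff: "affine_on u L" "affine_on v L" if "L \<in> T" for L using u v that unfolding mean_continuous_def by auto
  have mt: "tri_moment w L P = tri_moment u L P - tri_moment v L P" if "L \<in> T" for L P
    unfolding tri_moment_def w_def affine_on_diff(2)[OF conf_det[OF conf that] aff[OF that]]
    by (simp add: matrix_vector_mult_diff_rdistrib algebra_simps)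
  have mo: "moment w S P = moment u S P - moment v S P" if "S \<subseteq> T" for S P
  proof -
    have "moment w S P = (\<Sum>L\<in>S. tri_moment u L P - tri_moment v L P)"
      unfolding moment_def using that mt by (intro sum.cong) auto
    then show ?thesis by (simp add: moment_def sum_subtractf)
  qed
  have em: "edge_mean w T K P = edge_mean u T K P - edge_mean v T K P" for K P
    unfolding edge_mean_def mo[OF leaves_subset] by (simp add: scaleR_diff_right)
  have "matched w T K" if "K \<in> T0" for K
    unfolding matched_def
  proof (intro allI impI)
    fix a b c S1 S2
    assume M: "descendant K (a, b, c)" and t: "bis_tree (midpoint b c, a, b) S1" "bis_tree (midpoint b c, c, a) S2"
      and S: "S1 \<union> S2 \<subseteq> T"
    have *: "(1 / area (midpoint b c, a, b)) *\<^sub>R moment z S1 b = (1 / area (midpoint b c, c, a)) *\<^sub>R moment z S2 c"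
      if "z = u \<or> z = v" for z
      using u v that \<open>K \<in> T0\<close> M t S unfolding mean_continuous_def matched_def by blast
    have "S1 \<subseteq> T" "S2 \<subseteq> T" using S by auto
    then show "(1 / area (midpoint b c, a, b)) *\<^sub>R moment w S1 b = (1 / area (midpoint b c, c, a)) *\<^sub>R moment w S2 c"
      using *[of u] *[of v] mo by (simp add: scaleR_diff_right)
  qed
  moreover have "affine_on w L" if "L \<in> T" for L
    unfolding w_def using affine_on_diff(1)[OF conf_det[OF conf that] aff[OF that]] .
  moreover have "edge_mean w T (neighbour T0 K E) P' = edge_mean w T K P"
    if "K \<in> T0" "E \<in> edges K" "apex K E P" "\<not> segment E \<subseteq> frontier \<Omega>"
      "E' \<in> edges (neighbour T0 K E)" "segment E' = segment E" "apex (neighbour T0 K E) E' P'" for K E P E' P'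
  proof -
    have "edge_mean z T (neighbour T0 K E) P' = edge_mean z T K P" if "z = u \<or> z = v" for z
      using u v that \<open>K \<in> T0\<close> \<open>E \<in> edges K\<close> \<open>apex K E P\<close> \<open>\<not> segment E \<subseteq> frontier \<Omega>\<close>
        \<open>E' \<in> edges (neighbour T0 K E)\<close> \<open>segment E' = segment E\<close> \<open>apex (neighbour T0 K E) E' P'\<close>
      unfolding mean_continuous_def by blast
    from this[of u] this[of v] show ?thesis unfolding em by simp
  qed
  moreover have "edge_mean w T K P = 0" if "K \<in> T0" "E \<in> edges K" "apex K E P" "segment E \<subseteq> frontier \<Omega>" for K E P
  proof -
    have "edge_mean z T K P = 0" if "z = u \<or> z = v" for z
      using u v that \<open>K \<in> T0\<close> \<open>E \<in> edges K\<close> \<open>apex K E P\<close> \<open>segment E \<subseteq> frontier \<Omega>\<close>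
      unfolding mean_continuous_def by blast
    from this[of u] this[of v] show ?thesis unfolding em by simp
  qed
  ultimately show ?thesis unfolding mean_continuous_def w_def by blast
qed

section \<open>The jump terms\<close>

fun edge_length :: "edge \<Rightarrow> real" where
  "edge_length (p, q) = dist p q"

text \<open>The tangential jump of the gradient, which is constant along an edge.\<close>

definition slope_jump :: "point set \<Rightarrow> mesh \<Rightarrow> field \<Rightarrow> tri \<Rightarrow> edge \<Rightarrow> point" where
  "slope_jump \<Omega> T v K E =
     (if segment E \<subseteq> frontier \<Omega> then slope v K *v tangent E
      else slope v K *v tangent E - slope v (neighbour T K E) *v tangent E)"

lemma edge_length_nonneg: "0 \<le> edge_length E"
  by (cases E) simp

lemma meshsize_nonneg: "0 \<le> meshsize K"
  by (simp add: meshsize_eq area_nonneg)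

lemma edge_norm_const:
  fixes g :: "point \<Rightarrow> point"
  assumes "\<And>x. x \<in> segment E \<Longrightarrow> g x = c"
  shows "(edge_norm E g)\<^sup>2 = edge_length E * (norm c)\<^sup>2"
proof -
  obtain a b where E: "E = (a, b)" by (cases E)
  have "integral\<^sup>L (lebesgue_on {0..1}) (\<lambda>t. (norm (g (linepath a b t)))\<^sup>2)
      = integral\<^sup>L (lebesgue_on {0..1::real}) (\<lambda>t. (norm c)\<^sup>2)"
  proof (rule Bochner_Integration.integral_cong[OF refl])
    fix t :: real assume "t \<in> space (lebesgue_on {0..1})"
    then have "linepath a b t \<in> closed_segment a b" by (simp add: linepath_in_path)
    then show "(norm (g (linepath a b t)))\<^sup>2 = (norm c)\<^sup>2" using assms E by simp
  qed
  also have "\<dots> = (norm c)\<^sup>2" by (simp add: measure_restrict_space)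
  finally show ?thesis unfolding E by simp
qed

lemma jump_term_eq:
  assumes conf: "conforming_triangulation \<Omega> T" and op: "open \<Omega>" and v: "\<And>K. K \<in> T \<Longrightarrow> affine_on v K" and K: "K \<in> T"
  shows "jump_term \<Omega> T v K = (\<Sum>E\<in>edges K. meshsize K * (edge_length E * (norm (slope_jump \<Omega> T v K E))\<^sup>2))"
  unfolding jump_term_def
proof (rule sum.cong[OF refl])
  fix E assume E: "E \<in> edges K"
  have "jump \<Omega> T K E (\<lambda>x. grad v x *v tangent E) x = slope_jump \<Omega> T v K E" if x: "x \<in> segment E" for x
  proof -
    have xK: "x \<in> region K" using segment_subset_region[OF E] x by blast
    note iK = inner_trace_grad[OF conf_det[OF conf K] v[OF K] xK]
    show ?thesis
    proof (cases "segment E \<subseteq> frontier \<Omega>")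
      case True then show ?thesis using iK by (simp add: jump_def slope_jump_def)
    next
      case False
      note N = neighbour_props[OF conf op K E False]
      obtain E' where E': "E' \<in> edges (neighbour T K E)" "segment E' = segment E" using N(3) by auto
      have "x \<in> region (neighbour T K E)" using segment_subset_region[OF E'(1)] E'(2) x by blast
      then show ?thesis using iK inner_trace_grad[OF conf_det[OF conf N(1)] v[OF N(1)]] False
        by (simp add: jump_def slope_jump_def)
    qed
  qed
  then show "meshsize K * (edge_norm E (jump \<Omega> T K E (\<lambda>x. grad v x *v tangent E)))\<^sup>2
      = meshsize K * (edge_length E * (norm (slope_jump \<Omega> T v K E))\<^sup>2)"
    using edge_norm_const[of E "jump \<Omega> T K E (\<lambda>x. grad v x *v tangent E)" "slope_jump \<Omega> T v K E"] by simp
qed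

text \<open>A bisection replaces an edge by two halves of the same total length and adds two copies of the
  bisector, on which \<open>j\<close> vanishes.\<close>

lemma tree_edge_sum:
  fixes j :: "edge \<Rightarrow> real"
  assumes "bis_tree K S" "tri_det K \<noteq> 0" "\<And>E. 0 \<le> j E"
    and "\<And>a b c. descendant K (a, b, c) \<Longrightarrow> j (midpoint b c, a) = 0 \<and> j (a, midpoint b c) = 0 \<and>
        j (b, midpoint b c) \<le> j (b, c) \<and> j (midpoint b c, c) \<le> j (b, c)"
  shows "(\<Sum>L\<in>S. \<Sum>E\<in>edges L. edge_length E * j E) \<le> (\<Sum>E\<in>edges K. edge_length E * j E)"
  using assms
proof (induction rule: bis_tree.induct)
  case (node b c a S1 S2)
  define m where "m = midpoint b c"
  note d = node.prems(1)
  note d12 = region_children(3,4)[OF d, folded m_def]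
  have fin: "finite S1" "finite S2" using tree_finite node.hyps by auto
  have disj: "S1 \<inter> S2 = {}" using tree_children_disjoint[OF d node.hyps] .
  define f where "f E = edge_length E * j E" for E
  have IH1: "(\<Sum>L\<in>S1. \<Sum>E\<in>edges L. f E) \<le> (\<Sum>E\<in>edges (m, a, b). f E)"
    unfolding f_def m_def using node.prems descendant.left d12[unfolded m_def] by (intro node.IH(1)) blast+
  have IH2: "(\<Sum>L\<in>S2. \<Sum>E\<in>edges L. f E) \<le> (\<Sum>E\<in>edges (m, c, a). f E)"
    unfolding f_def m_def using node.prems descendant.right d12[unfolded m_def] by (intro node.IH(2)) blast+
  have j: "j (m, a) = 0" "j (a, m) = 0" "j (b, m) \<le> j (b, c)" "j (m, c) \<le> j (b, c)"
    using node.prems(3)[OF descendant.self] unfolding m_def by auto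
  have len: "dist b m = dist b c / 2" "dist m c = dist b c / 2" unfolding m_def dist_midpoint by auto
  have "f (b, m) \<le> dist b c / 2 * j (b, c)" "f (m, c) \<le> dist b c / 2 * j (b, c)"
    unfolding f_def using j by (auto simp: len intro!: mult_left_mono)
  then have half: "f (b, m) + f (m, c) \<le> f (b, c)" unfolding f_def by simp
  have z: "f (m, a) = 0" "f (a, m) = 0" unfolding f_def using j by auto
  have "(\<Sum>L\<in>S1 \<union> S2. \<Sum>E\<in>edges L. f E) = (\<Sum>L\<in>S1. \<Sum>E\<in>edges L. f E) + (\<Sum>L\<in>S2. \<Sum>E\<in>edges L. f E)"
    using fin disj by (rule sum.union_disjoint)
  also have "\<dots> \<le> (f (m, a) + f (a, b) + f (b, m)) + (f (m, c) + f (c, a) + f (a, m))"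
    using IH1 IH2 unfolding sum_edges[OF d12(1)] sum_edges[OF d12(2)] by linarith
  also have "\<dots> \<le> (\<Sum>E\<in>edges (a, b, c). f E)"
    unfolding sum_edges[OF d] using half z by linarith
  finally show ?case unfolding f_def .
qed simp

lemma norm_tangent_subsegment:
  assumes "segment (p', q') \<subseteq> segment (p, q)" "p' \<noteq> q'"
  shows "tangent (p', q') = tangent (p, q) \<or> tangent (p', q') = - tangent (p, q)"
proof -
  have "p' \<in> closed_segment p q" "q' \<in> closed_segment p q" using assms by auto
  then obtain k where k: "q' - p' = k *\<^sub>R (q - p)" using subsegment_det[of p' p q q'] by blast
  have k0: "k \<noteq> 0" and ne: "p \<noteq> q" using k assms(2) by auto
  have "dist p' q' = \<bar>k\<bar> * dist p q"
    unfolding dist_norm using k by (metis norm_minus_commute norm_scaleR)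
  then have "tangent (p', q') = (k / \<bar>k\<bar>) *\<^sub>R tangent (p, q)"
    using k k0 ne by (simp add: divide_simps)
  moreover have "k / \<bar>k\<bar> = 1 \<or> k / \<bar>k\<bar> = -1" using k0 by (auto simp: abs_if)
  ultimately show ?thesis by (metis scaleR_one scaleR_minus1_left)
qed

context
  fixes \<Omega> T T' \<tau> v
  assumes conf: "conforming_triangulation \<Omega> T" and conf': "conforming_triangulation \<Omega> T'" and op: "open \<Omega>"
    and fo: "forest T T' \<tau>" and v: "\<And>K. K \<in> T \<Longrightarrow> affine_on v K"
begin

lemma leaf_tree:
  assumes "K \<in> T" shows "bis_tree K (\<tau> K)" "tri_det K \<noteq> 0" "\<tau> K \<subseteq> T'" "interior (region K) \<subseteq> \<Omega>"
  using fo assms conf_det[OF conf] conf_interior[OF conf] unfolding forest_def by blast+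

lemma leaf_slope:
  assumes "K \<in> T" "L \<in> \<tau> K" shows "slope v L = slope v K" "affine_on v L"
  using affine_on_subset[OF leaf_tree(2) tree_det[OF leaf_tree(1,2)] v] tree_interior_mono(1)[OF leaf_tree(1,2)] assms by blast+

text \<open>Seen from a leaf, a coarse field has no gradient jump across edges inside the coarse triangle, and on
  a piece of a coarse edge it has the old one, since the fine neighbour lies in the coarse neighbour.\<close>

lemma slope_jump_leaf:
  assumes K: "K \<in> T" and L: "L \<in> \<tau> K" "E \<in> edges L"
  shows "slope_jump \<Omega> T' v L E = 0 \<or>
    (\<exists>F\<in>edges K. segment E \<subseteq> segment F \<and> norm (slope_jump \<Omega> T' v L E) = norm (slope_jump \<Omega> T v K F))"
proof -
  note t = leaf_tree[OF K]
  note dL = tree_det[OF t(1,2) L(1)] and sub = tree_interior_mono(1)[OF t(1,2) L(1)]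
  obtain p q where pq: "E = (p, q)" by (cases E)
  have "closed_segment p q \<subseteq> region K" using segment_subset_region[OF L(2)] sub pq by auto
  then have pqK: "p \<in> region K" "q \<in> region K" by auto
  have ne: "p \<noteq> q" using edge_distinct[OF dL] L(2) pq by auto
  show ?thesis
  proof (rule segment_in_edge_or_interior[OF t(2) pqK])
    assume "midpoint p q \<in> interior (region K)"
    then have "edge_midpoint E \<in> interior (region K)" using pq by simp
    note nb = neighbour_in_tree[OF conf' op t L this]
    show ?thesis unfolding slope_jump_def using nb(1) leaf_slope(1)[OF K L(1)] leaf_slope(1)[OF K nb(2)] by simp
  next
    fix F assume F: "F \<in> edges K" "closed_segment p q \<subseteq> segment F"
    obtain p1 q1 where pq1: "F = (p1, q1)" by (cases F)
    have EF: "segment E \<subseteq> segment F" using F(2) pq by simp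
    have tan: "tangent E = tangent F \<or> tangent E = - tangent F"
      using norm_tangent_subsegment ne EF unfolding pq pq1 by blast
    have neg: "A *v (- t) = - (A *v t)" for A :: "real^2^2" and t
      using matrix_vector_mult_scaleR[of A "-1" t] by simp
    have "norm (slope_jump \<Omega> T' v L E) = norm (slope_jump \<Omega> T v K F)"
    proof (cases "segment F \<subseteq> frontier \<Omega>")
      case True
      then have "segment E \<subseteq> frontier \<Omega>" using EF by blast
      then show ?thesis unfolding slope_jump_def leaf_slope(1)[OF K L(1)] using True tan neg by auto
    next
      case False
      define N where "N = neighbour T K F"
      note N = neighbour_props[OF conf op K F(1) False, folded N_def]
      obtain F' where F': "F' \<in> edges N" "segment F' = segment F" using N(3) by auto
      have opp: "edge_height N F' x = - edge_height K F x" for x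
        by (rule opposite_heights[OF conf K N(1) N(2)[symmetric] F(1) F'])
      have ins: "\<forall>p q. F = (p, q) \<longrightarrow> open_segment p q \<subseteq> \<Omega>"
        using interior_edge[OF conf K] F(1) False by (metis segment.simps)
      note nb = neighbour_across[OF conf' op t(1-3) leaf_tree(1-3)[OF N(1)] F(1) F'(1) F'(2)[symmetric] opp ins L EF]
      have "slope v (neighbour T' L E) = slope v N" using leaf_slope(1)[OF N(1) nb(2)] .
      then show ?thesis unfolding slope_jump_def leaf_slope(1)[OF K L(1)] N_def[symmetric] using False nb(1) tan
        by (auto simp: neg norm_minus_commute)
    qed
    then show ?thesis using F(1) EF by blast
  qed
qed

lemma jump_reduction:
  assumes K: "K \<in> T" "K \<notin> T'"
  shows "(\<Sum>L\<in>\<tau> K. jump_term \<Omega> T' v L) \<le> sqrt (1/2) * jump_term \<Omega> T v K"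
proof -
  note t = leaf_tree[OF K(1)]
  define J where "J F = (norm (slope_jump \<Omega> T v K F))\<^sup>2" for F
  \<comment> \<open>The squared coarse jump, as a function of pieces of edges; zero on segments inside \<open>K\<close>.\<close>
  define j where "j e = (\<Sum>F\<in>edges K. if segment e \<subseteq> segment F then J F else 0)" for e
  have finE: "finite (edges M)" for M by (cases M) auto
  have j0: "0 \<le> j e" for e unfolding j_def J_def by (intro sum_nonneg) auto
  have J0: "0 \<le> J F" for F unfolding J_def by simp
  have height_seg: "edge_height K F x = 0" if FK: "F \<in> edges K" and xF: "x \<in> segment F" for F x
  proof -
    obtain p q where F: "F = (p, q)" by (cases F)
    then obtain s where "x = (1 - s) *\<^sub>R p + s *\<^sub>R q" using xF by (auto simp: in_segment)
    then show ?thesis using edge_height_affine edge_height_edge_ends FK F by simp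
  qed
  have leafj: "(norm (slope_jump \<Omega> T' v L E))\<^sup>2 \<le> j E" if L: "L \<in> \<tau> K" "E \<in> edges L" for L E
    using slope_jump_leaf[OF K(1) L]
  proof
    assume "slope_jump \<Omega> T' v L E = 0" then show ?thesis using j0 by simp
  next
    assume "\<exists>F\<in>edges K. segment E \<subseteq> segment F \<and> norm (slope_jump \<Omega> T' v L E) = norm (slope_jump \<Omega> T v K F)"
    then obtain F where F: "F \<in> edges K" "segment E \<subseteq> segment F" "norm (slope_jump \<Omega> T' v L E) = norm (slope_jump \<Omega> T v K F)" by blast
    have "(if segment E \<subseteq> segment F then J F else 0) \<le> j E"
      unfolding j_def using J0 finE by (intro member_le_sum[OF F(1)]) auto
    then show ?thesis using F by (simp add: J_def)
  qed
  have rootj: "j E = J E" if E: "E \<in> edges K" for E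
  proof -
    have "\<not> segment E \<subseteq> segment F" if F: "F \<in> edges K" "F \<noteq> E" for F
    proof
      assume "segment E \<subseteq> segment F"
      then have z: "edge_height K F (edge_midpoint E) = 0" using height_seg[OF F(1)] edge_midpoint_in_segment by blast
      obtain p q where pq: "E = (p, q)" by (cases E)
      show False
        using open_segment_heights(2)[OF t(2) _ edge_midpoint_open[OF t(2)], of p q F] E F pq z by simp
    qed
    then have "j E = (\<Sum>F\<in>edges K. if F = E then J F else 0)" unfolding j_def by (intro sum.cong) auto
    then show ?thesis using E finE by simp
  qed
  have hyp: "j (midpoint b c, a) = 0 \<and> j (a, midpoint b c) = 0 \<and>
        j (b, midpoint b c) \<le> j (b, c) \<and> j (midpoint b c, c) \<le> j (b, c)" if D: "descendant K (a, b, c)" for a b c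
  proof -
    have dM: "tri_det (a, b, c) \<noteq> 0" and rM: "region (a, b, c) \<subseteq> region K" using descendant_region[OF D t(2)] by auto
    have ms: "closed_segment (midpoint b c) a \<subseteq> segment F \<Longrightarrow> False" if F: "F \<in> edges K" for F
    proof -
      assume sub: "closed_segment (midpoint b c) a \<subseteq> segment F"
      define x where "x = midpoint (midpoint b c) a"
      have "midpoint b c \<noteq> a"
        using edge_distinct[OF region_children(3)[OF dM], of "midpoint b c" a] by simp
      then have "x \<in> interior (region (a, b, c))" using bisector_interior[OF dM] unfolding x_def by auto
      then have "0 < edge_height K F x" using interior_mono[OF rM] F unfolding interior_region[OF t(2)] by blast
      moreover have "x \<in> segment F" using sub unfolding x_def by auto
      ultimately show False using height_seg[OF F] by simp
    qed
    have "b \<in> region K" "c \<in> region K" using rM vertices_subset_region[of "(a,b,c)"] by auto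
    have half: "closed_segment b c \<subseteq> segment F"
      if F: "F \<in> edges K" and sub: "closed_segment b (midpoint b c) \<subseteq> segment F \<or> closed_segment (midpoint b c) c \<subseteq> segment F" for F
    proof -
      have "midpoint b c \<in> segment F" using sub by auto
      then have m: "edge_height K F (midpoint b c) = 0" using height_seg[OF F] by blast
      have "0 \<le> edge_height K F b" "0 \<le> edge_height K F c"
        using \<open>b \<in> region K\<close> \<open>c \<in> region K\<close> F unfolding region_eq[OF t(2)] by auto
      then have "edge_height K F b = 0" "edge_height K F c = 0" using m unfolding edge_height_midpoint by auto
      then have "b \<in> segment F" "c \<in> segment F"
        using height_zero_segment[OF t(2) F] \<open>b \<in> region K\<close> \<open>c \<in> region K\<close> by auto
      then show ?thesis by (cases F) (simp add: subset_closed_segment)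
    qed
    have "\<not> segment (midpoint b c, a) \<subseteq> segment F" "\<not> segment (a, midpoint b c) \<subseteq> segment F" if "F \<in> edges K" for F
      using ms[OF that] by (simp_all add: closed_segment_commute) blast+
    then have "j (midpoint b c, a) = 0" "j (a, midpoint b c) = 0"
      unfolding j_def by (simp_all del: segment.simps)
    moreover have "j (b, midpoint b c) \<le> j (b, c)" "j (midpoint b c, c) \<le> j (b, c)"
      unfolding j_def using half J0 by (auto intro!: sum_mono)
    ultimately show ?thesis by blast
  qed
  have ms: "meshsize L \<le> sqrt (1/2) * meshsize K" if L: "L \<in> \<tau> K" for L
  proof -
    have "L \<noteq> K" using L t(3) K(2) by blast
    then have "area L \<le> 1/2 * area K" using tree_area_half[OF t(1) L] by simp
    then show ?thesis unfolding meshsize_eq real_sqrt_mult[symmetric] by (rule real_sqrt_le_mono)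
  qed
  have aff': "affine_on v L" if "L \<in> T'" for L
    using that fo leaf_slope(2) unfolding forest_def by blast
  have "(\<Sum>L\<in>\<tau> K. jump_term \<Omega> T' v L) \<le> (\<Sum>L\<in>\<tau> K. \<Sum>E\<in>edges L. sqrt (1/2) * meshsize K * (edge_length E * j E))"
  proof (rule sum_mono)
    fix L assume L: "L \<in> \<tau> K"
    then have "L \<in> T'" using t(3) by blast
    then have jt: "jump_term \<Omega> T' v L = (\<Sum>E\<in>edges L. meshsize L * (edge_length E * (norm (slope_jump \<Omega> T' v L E))\<^sup>2))"
      by (intro jump_term_eq[OF conf' op] aff')
    show "jump_term \<Omega> T' v L \<le> (\<Sum>E\<in>edges L. sqrt (1/2) * meshsize K * (edge_length E * j E))"
      unfolding jt
    proof (rule sum_mono)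
      fix E assume E: "E \<in> edges L"
      show "meshsize L * (edge_length E * (norm (slope_jump \<Omega> T' v L E))\<^sup>2) \<le> sqrt (1/2) * meshsize K * (edge_length E * j E)"
        using ms[OF L] leafj[OF L E] edge_length_nonneg[of E] meshsize_nonneg[of K]
        by (intro mult_mono mult_left_mono mult_nonneg_nonneg) auto
    qed
  qed
  also have "\<dots> = sqrt (1/2) * meshsize K * (\<Sum>L\<in>\<tau> K. \<Sum>E\<in>edges L. edge_length E * j E)"
    by (simp add: sum_distrib_left)
  also have "\<dots> \<le> sqrt (1/2) * meshsize K * (\<Sum>E\<in>edges K. edge_length E * j E)"
    using tree_edge_sum[OF t(1,2) j0 hyp] meshsize_nonneg[of K] by (intro mult_left_mono) auto
  also have "(\<Sum>E\<in>edges K. edge_length E * j E) = (\<Sum>E\<in>edges K. edge_length E * J E)" using rootj by simp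
  also have "sqrt (1/2) * meshsize K * (\<Sum>E\<in>edges K. edge_length E * J E) = sqrt (1/2) * jump_term \<Omega> T v K"
  proof -
    have "jump_term \<Omega> T v K = (\<Sum>E\<in>edges K. meshsize K * (edge_length E * J E))"
      unfolding J_def by (intro jump_term_eq[OF conf op] v K(1))
    then show ?thesis by (simp add: sum_distrib_left mult.assoc)
  qed
  finally show ?thesis .
qed

end

lemma cross2_le: "\<bar>cross2 u v\<bar> \<le> norm u * norm v"
proof (rule power2_le_imp_le)
  have "0 \<le> (u $ 1 * v $ 1 + u $ 2 * v $ 2)\<^sup>2" by simp
  then have "(cross2 u v)\<^sup>2 \<le> (norm u)\<^sup>2 * (norm v)\<^sup>2"
    unfolding norm_sq2 cross2_def by (simp add: power2_eq_square algebra_simps)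
  then show "\<bar>cross2 u v\<bar>\<^sup>2 \<le> (norm u * norm v)\<^sup>2" by (simp add: power_mult_distrib)
qed simp

lemma edge_length_le:
  assumes "E \<in> edges K" shows "(edge_length E)\<^sup>2 \<le> 2 * size2 K"
proof -
  obtain p q where E: "E = (p, q)" by (cases E)
  have "p \<in> vertices K" "q \<in> vertices K" using assms E by (cases K, auto)+
  then show ?thesis using vertices_dist[of p K q] by (simp add: E dist_norm)
qed

text \<open>Height and edge length are comparable in shape regular triangles; together with \<open>edge_length_le\<close> this
  compares the areas of neighbours through their common edge.\<close>

lemma area_le_edge:
  assumes "E \<in> edges K" and shape: "size2 K \<le> \<kappa> * area K"
  shows "area K \<le> \<kappa> / 2 * (edge_length E)\<^sup>2"
proof (cases "area K = 0")
  case False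
  then have A: "0 < area K" using area_nonneg[of K] by simp
  obtain p q where E: "E = (p, q)" by (cases E)
  obtain P where P: "P \<in> vertices K" "edge_height K E P = \<bar>tri_det K\<bar>" using apex_exists[OF assms(1)] by metis
  have pK: "p \<in> vertices K" using assms(1) E by (cases K) auto
  have "\<bar>tri_det K\<bar> \<le> \<bar>cross2 (q - p) (P - p)\<bar>"
    using P(2) unfolding E edge_height_def edge_det.simps by (auto simp: sgn_if split: if_splits)
  then have "2 * area K \<le> edge_length E * norm (P - p)"
    using cross2_le[of "q - p" "P - p"] by (simp add: area_def E dist_norm norm_minus_commute)
  then have "(2 * area K)\<^sup>2 \<le> (edge_length E * norm (P - p))\<^sup>2"
    using A by (intro power_mono) auto
  also have "\<dots> \<le> (edge_length E)\<^sup>2 * (2 * (\<kappa> * area K))"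
    using vertices_dist[OF P(1) pK] shape unfolding power_mult_distrib by (intro mult_left_mono) auto
  finally have "area K * (4 * area K) \<le> area K * ((edge_length E)\<^sup>2 * 2 * \<kappa>)"
    by (simp add: power2_eq_square algebra_simps)
  then show ?thesis using A by simp
next
  case True
  then have "0 \<le> size2 K" "size2 K \<le> 0" using shape size2_nonneg[of K] by auto
  then have "size2 K = 0" by simp
  then have "(edge_length E)\<^sup>2 \<le> 0" using edge_length_le[OF assms(1)] by simp
  then show ?thesis using True by simp
qed

lemma norm_tangent: "p \<noteq> q \<Longrightarrow> norm (tangent (p, q)) = 1"
  by (simp add: dist_norm norm_minus_commute)

text \<open>Passing from a triangle and an edge to the neighbour and the common edge is injective, so each triangle is
  counted at most three times.\<close>

lemma neighbour_sum_le:
  fixes e :: "tri \<Rightarrow> real"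
  assumes conf: "conforming_triangulation \<Omega> T" and op: "open \<Omega>" and e: "\<And>K. 0 \<le> e K"
  shows "(\<Sum>L\<in>T. \<Sum>E\<in>edges L. if segment E \<subseteq> frontier \<Omega> then 0 else e (neighbour T L E)) \<le> 3 * (\<Sum>L\<in>T. e L)"
proof -
  have finE: "finite (edges M)" for M by (cases M) auto
  have cardE: "card (edges M) \<le> 3" for M by (cases M) (simp add: card_insert_if)
  note fin = conf_finite[OF conf]
  define Y where "Y = Sigma T edges"
  define X where "X = {(L, E) \<in> Y. \<not> segment E \<subseteq> frontier \<Omega>}"
  define h where "h = (\<lambda>(L, E). (neighbour T L E, SOME E'. E' \<in> edges (neighbour T L E) \<and> segment E' = segment E))"
  have finY: "finite Y" unfolding Y_def using fin finE by blast
  have np: "neighbour T L E \<in> T" "neighbour T L E \<noteq> L" "snd (h (L, E)) \<in> edges (neighbour T L E)" "segment (snd (h (L, E))) = segment E"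
    if "(L, E) \<in> X" for L E
  proof -
    have LE: "L \<in> T" "E \<in> edges L" "\<not> segment E \<subseteq> frontier \<Omega>" using that unfolding X_def Y_def by auto
    note N = neighbour_props[OF conf op LE]
    show "neighbour T L E \<in> T" "neighbour T L E \<noteq> L" using N by auto
    have "\<exists>E'. E' \<in> edges (neighbour T L E) \<and> segment E' = segment E" using N(3) by (metis imageE)
    from someI_ex[OF this] show "snd (h (L, E)) \<in> edges (neighbour T L E)" "segment (snd (h (L, E))) = segment E"
      unfolding h_def by auto
  qed
  have inj: "inj_on h X"
  proof (rule inj_onI, clarify)
    fix L E L2 E2 :: "_ \<times> _" assume x: "(L, E) \<in> X" "(L2, E2) \<in> X" and eq: "h (L, E) = h (L2, E2)"
    have LE: "L \<in> T" "E \<in> edges L" "L2 \<in> T" "E2 \<in> edges L2" using x unfolding X_def Y_def by auto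
    have N: "neighbour T L E = neighbour T L2 E2" using eq unfolding h_def by auto
    have seg: "segment E = segment E2" using np(4)[OF x(1)] np(4)[OF x(2)] eq by simp
    have "L2 = L"
    proof (rule neighbour_unique[OF conf np(1)[OF x(1)] np(3)[OF x(1)]])
      show "L \<in> T" "L2 \<in> T" using LE by auto
      show "L \<noteq> neighbour T L E" "L2 \<noteq> neighbour T L E" using np(2)[OF x(1)] np(2)[OF x(2)] N by auto
      show "segment (snd (h (L, E))) \<in> segment ` edges L" "segment (snd (h (L, E))) \<in> segment ` edges L2"
        using np(4)[OF x(1)] seg LE by auto
    qed
    then show "L = L2 \<and> E = E2" using edges_segment_inj[OF conf_det[OF conf LE(1)] LE(2) _ seg] LE by simp
  qed
  have sub: "h ` X \<subseteq> Y"
  proof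
    fix z assume "z \<in> h ` X"
    then obtain L E where "(L, E) \<in> X" "z = h (L, E)" by auto
    then show "z \<in> Y" using np(1,3)[of L E] unfolding Y_def h_def by auto
  qed
  have "(\<Sum>L\<in>T. \<Sum>E\<in>edges L. if segment E \<subseteq> frontier \<Omega> then 0 else e (neighbour T L E))
      = (\<Sum>(L, E)\<in>Y. if segment E \<subseteq> frontier \<Omega> then 0 else e (neighbour T L E))"
    unfolding Y_def using fin finE by (subst sum.Sigma) auto
  also have "\<dots> = (\<Sum>(L, E)\<in>X. e (neighbour T L E))"
    unfolding X_def using finY by (intro sum.mono_neutral_cong_right) (auto split: if_split_asm)
  also have "\<dots> = (\<Sum>x\<in>X. e (fst (h x)))" by (intro sum.cong) (auto simp: h_def)
  also have "\<dots> = (\<Sum>y\<in>h ` X. e (fst y))" using sum.reindex[OF inj, of "\<lambda>y. e (fst y)"] by (simp add: o_def)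
  also have "\<dots> \<le> (\<Sum>y\<in>Y. e (fst y))" using finY sub e by (intro sum_mono2) auto
  also have "\<dots> = (\<Sum>L\<in>T. \<Sum>E\<in>edges L. e L)" unfolding Y_def using fin finE by (subst sum.Sigma) (auto simp: split_def)
  also have "\<dots> \<le> (\<Sum>L\<in>T. 3 * e L)"
    using cardE e by (intro sum_mono) (simp add: mult_right_mono)
  finally show ?thesis by (simp add: sum_distrib_left)
qed

text \<open>Gradients are constant on triangles, so a jump is bounded by the gradients on both sides; by shape
  regularity, mesh size times edge length is bounded by either area.\<close>

lemma jump_energy:
  assumes conf: "conforming_triangulation \<Omega> T" and op: "open \<Omega>" and w: "\<And>K. K \<in> T \<Longrightarrow> affine_on w K"
    and shape: "\<And>L. L \<in> T \<Longrightarrow> size2 L \<le> \<kappa> * area L" and \<kappa>: "1 \<le> \<kappa>"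
  shows "(\<Sum>L\<in>T. jump_term \<Omega> T w L) \<le> 24 * \<kappa>\<^sup>2 * energy w T"
proof -
  define e where "e L = area L * (norm (slope w L))\<^sup>2" for L
  have e0: "0 \<le> e L" for L unfolding e_def by (simp add: area_nonneg)
  have \<kappa>2: "\<kappa> \<le> \<kappa>\<^sup>2" using \<kappa> by (simp add: power2_eq_square)
  have amgm: "meshsize L * edge_length E \<le> (area L + (edge_length E)\<^sup>2) / 2" for L E
  proof -
    have "0 \<le> (meshsize L - edge_length E)\<^sup>2" by simp
    moreover have "(meshsize L)\<^sup>2 = area L" by (simp add: meshsize_eq area_nonneg)
    ultimately show ?thesis by (simp add: power2_eq_square algebra_simps)
  qed
  have termwise: "meshsize L * (edge_length E * (norm (slope_jump \<Omega> T w L E))\<^sup>2)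
      \<le> 4 * \<kappa>\<^sup>2 * e L + (if segment E \<subseteq> frontier \<Omega> then 0 else 4 * \<kappa>\<^sup>2 * e (neighbour T L E))"
    if L: "L \<in> T" and E: "E \<in> edges L" for L E
  proof -
    obtain p q where pq: "E = (p, q)" by (cases E)
    have t1: "norm (tangent E) = 1" using norm_tangent edge_distinct[OF conf_det[OF conf L], of p q] E pq by blast
    have st: "(norm (slope w K *v tangent E))\<^sup>2 \<le> (norm (slope w K))\<^sup>2" for K
      using norm_matrix_vector_sq[of "slope w K" "tangent E"] t1 by simp
    have hl0: "0 \<le> meshsize L * edge_length E" using meshsize_nonneg edge_length_nonneg by simp
    have "(edge_length E)\<^sup>2 \<le> 2 * (\<kappa> * area L)" using edge_length_le[OF E] shape[OF L] by simp
    moreover have "area L \<le> \<kappa> * area L" using mult_right_mono[OF \<kappa> area_nonneg[of L]] by simp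
    ultimately have "(area L + (edge_length E)\<^sup>2) / 2 \<le> 2 * (\<kappa> * area L)" using area_nonneg[of L] by argo
    then have "meshsize L * edge_length E \<le> 2 * (\<kappa> * area L)" using amgm[of L E] by (rule order_trans[rotated])
    also have "\<dots> \<le> 2 * (\<kappa>\<^sup>2 * area L)" using \<kappa>2 area_nonneg[of L] by (intro mult_left_mono mult_right_mono) auto
    finally have hl: "meshsize L * edge_length E \<le> 2 * (\<kappa>\<^sup>2 * area L)" .
    show ?thesis
    proof (cases "segment E \<subseteq> frontier \<Omega>")
      case True
      have "meshsize L * edge_length E * (norm (slope_jump \<Omega> T w L E))\<^sup>2 \<le> 2 * (\<kappa>\<^sup>2 * area L) * (norm (slope w L))\<^sup>2"
        by (rule mult_mono[OF hl]) (use True st[of L] area_nonneg[of L] in \<open>auto simp: slope_jump_def\<close>)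
      also have "\<dots> = 2 * (\<kappa>\<^sup>2 * e L)" unfolding e_def by simp
      also have "\<dots> \<le> 4 * (\<kappa>\<^sup>2 * e L)" using e0[of L] by simp
      finally show ?thesis using True by (simp add: mult.assoc)
    next
      case False
      define N where "N = neighbour T L E"
      note np = neighbour_props[OF conf op L E False, folded N_def]
      obtain E' where E': "E' \<in> edges N" "segment E' = segment E" using np(3) by auto
      have "edge_length E' = edge_length E"
        using E'(2) segment_eq_iff[of E' p q] pq by (auto simp: dist_commute)
      then have len: "(edge_length E)\<^sup>2 \<le> 2 * (\<kappa> * area N)" using edge_length_le[OF E'(1)] shape[OF np(1)] by simp
      have "\<kappa> / 2 * (edge_length E)\<^sup>2 \<le> \<kappa> / 2 * (2 * (\<kappa> * area N))"
        using len \<kappa> by (intro mult_left_mono) auto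
      then have "area L \<le> \<kappa> / 2 * (2 * (\<kappa> * area N))"
        using area_le_edge[OF E shape[OF L]] by linarith
      moreover note len
      moreover have "\<kappa> * area N \<le> \<kappa>\<^sup>2 * area N" using \<kappa>2 area_nonneg by (intro mult_right_mono) auto
      ultimately have hn: "meshsize L * edge_length E \<le> 2 * (\<kappa>\<^sup>2 * area N)"
        using amgm[of L E] mult_nonneg_nonneg[OF zero_le_power2[of \<kappa>] area_nonneg[of N]]
        by (simp add: power2_eq_square mult.assoc)
      have "(norm (slope_jump \<Omega> T w L E))\<^sup>2 \<le> 2 * (norm (slope w L *v tangent E))\<^sup>2 + 2 * (norm (slope w N *v tangent E))\<^sup>2"
        unfolding slope_jump_def N_def using False norm_add_sq[of "slope w L *v tangent E" "- (slope w (neighbour T L E) *v tangent E)"] by simp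
      also have "\<dots> \<le> 2 * (norm (slope w L))\<^sup>2 + 2 * (norm (slope w N))\<^sup>2" using st by (intro add_mono mult_left_mono) auto
      finally have "meshsize L * edge_length E * (norm (slope_jump \<Omega> T w L E))\<^sup>2
          \<le> meshsize L * edge_length E * (2 * (norm (slope w L))\<^sup>2 + 2 * (norm (slope w N))\<^sup>2)"
        using hl0 by (rule mult_left_mono)
      also have "\<dots> = 2 * (meshsize L * edge_length E * (norm (slope w L))\<^sup>2) + 2 * (meshsize L * edge_length E * (norm (slope w N))\<^sup>2)"
        by (simp add: algebra_simps)
      also have "\<dots> \<le> 2 * (2 * (\<kappa>\<^sup>2 * area L) * (norm (slope w L))\<^sup>2) + 2 * (2 * (\<kappa>\<^sup>2 * area N) * (norm (slope w N))\<^sup>2)"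
        using hl hn by (intro add_mono mult_left_mono mult_right_mono) auto
      also have "\<dots> = 4 * \<kappa>\<^sup>2 * e L + 4 * \<kappa>\<^sup>2 * e N" unfolding e_def by simp
      finally show ?thesis using False unfolding N_def by (simp add: mult.assoc)
    qed
  qed
  have cardE: "card (edges M) \<le> 3" for M by (cases M) (simp add: card_insert_if)
  have "(\<Sum>L\<in>T. jump_term \<Omega> T w L) \<le> (\<Sum>L\<in>T. \<Sum>E\<in>edges L.
      4 * \<kappa>\<^sup>2 * e L + (if segment E \<subseteq> frontier \<Omega> then 0 else 4 * \<kappa>\<^sup>2 * e (neighbour T L E)))"
  proof (rule sum_mono)
    fix L assume L: "L \<in> T"
    show "jump_term \<Omega> T w L \<le> (\<Sum>E\<in>edges L. 4 * \<kappa>\<^sup>2 * e L + (if segment E \<subseteq> frontier \<Omega> then 0 else 4 * \<kappa>\<^sup>2 * e (neighbour T L E)))"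
    proof -
      have "jump_term \<Omega> T w L = (\<Sum>E\<in>edges L. meshsize L * (edge_length E * (norm (slope_jump \<Omega> T w L E))\<^sup>2))"
        by (intro jump_term_eq[OF conf op] w L)
      also have "\<dots> \<le> (\<Sum>E\<in>edges L. 4 * \<kappa>\<^sup>2 * e L + (if segment E \<subseteq> frontier \<Omega> then 0 else 4 * \<kappa>\<^sup>2 * e (neighbour T L E)))"
        using termwise[OF L] by (rule sum_mono)
      finally show ?thesis .
    qed
  qed
  also have "\<dots> = (\<Sum>L\<in>T. \<Sum>E\<in>edges L. 4 * \<kappa>\<^sup>2 * e L) +
      (\<Sum>L\<in>T. \<Sum>E\<in>edges L. if segment E \<subseteq> frontier \<Omega> then 0 else 4 * \<kappa>\<^sup>2 * e (neighbour T L E))"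
    by (simp add: sum.distrib)
  also have "\<dots> \<le> (\<Sum>L\<in>T. 3 * (4 * \<kappa>\<^sup>2 * e L)) + 3 * (\<Sum>L\<in>T. 4 * \<kappa>\<^sup>2 * e L)"
  proof (rule add_mono)
    show "(\<Sum>L\<in>T. \<Sum>E\<in>edges L. 4 * \<kappa>\<^sup>2 * e L) \<le> (\<Sum>L\<in>T. 3 * (4 * \<kappa>\<^sup>2 * e L))"
    proof (rule sum_mono)
      fix L show "(\<Sum>E\<in>edges L. 4 * \<kappa>\<^sup>2 * e L) \<le> 3 * (4 * \<kappa>\<^sup>2 * e L)"
        unfolding sum_constant using cardE[of L] e0[of L] by (intro mult_right_mono) auto
    qed
    show "(\<Sum>L\<in>T. \<Sum>E\<in>edges L. if segment E \<subseteq> frontier \<Omega> then 0 else 4 * \<kappa>\<^sup>2 * e (neighbour T L E)) \<le> 3 * (\<Sum>L\<in>T. 4 * \<kappa>\<^sup>2 * e L)"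
      using e0 by (intro neighbour_sum_le[OF conf op]) auto
  qed
  also have "\<dots> = 24 * \<kappa>\<^sup>2 * (\<Sum>L\<in>T. e L)" by (simp add: sum_distrib_left mult.assoc)
  also have "(\<Sum>L\<in>T. e L) = energy w T" by (simp add: energy_def e_def)
  finally show ?thesis .
qed

section \<open>Square integrals over triangles\<close>

definition sq_integral :: "point set \<Rightarrow> (point \<Rightarrow> 'a::euclidean_space) \<Rightarrow> real" where
  "sq_integral A g = set_lebesgue_integral lebesgue A (\<lambda>x. (norm (g x))\<^sup>2)"

lemma open_sets_lebesgue: "open A \<Longrightarrow> A \<in> sets lebesgue" for A :: "'a::euclidean_space set"
  by (auto intro!: sets_completionI_sets)

lemma interior_sets_lebesgue: "interior A \<in> sets lebesgue" for A :: "'a::euclidean_space set"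
  by (rule open_sets_lebesgue) simp

lemma L2_set_integrable:
  assumes "g \<in> L2 S" "S \<in> sets lebesgue"
  shows "set_integrable lebesgue S (\<lambda>x. (norm (g x))\<^sup>2)"
  using assms unfolding L2_def set_integrable_def by (simp add: integrable_restrict_space)

lemma L2_set_integrable_subset:
  assumes "g \<in> L2 S" "S \<in> sets lebesgue" "A \<in> sets lebesgue" "A \<subseteq> S"
  shows "set_integrable lebesgue A (\<lambda>x. (norm (g x))\<^sup>2)"
  using set_integrable_subset[OF L2_set_integrable[OF assms(1,2)] assms(3,4)] .

lemma L2_norm_sq: "(L2_norm S g)\<^sup>2 = integral\<^sup>L (lebesgue_on S) (\<lambda>x. (norm (g x))\<^sup>2)"
proof -
  have "L2_inner S g g = integral\<^sup>L (lebesgue_on S) (\<lambda>x. (norm (g x))\<^sup>2)"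
    unfolding L2_inner_def power2_norm_eq_inner ..
  moreover have "0 \<le> integral\<^sup>L (lebesgue_on S) (\<lambda>x. (norm (g x))\<^sup>2)" by simp
  ultimately show ?thesis unfolding L2_norm_def by simp
qed

lemma L2_norm_set:
  assumes "S \<in> sets lebesgue" shows "(L2_norm S g)\<^sup>2 = sq_integral S g"
  unfolding L2_norm_sq sq_integral_def set_lebesgue_integral_def using assms by (simp add: integral_restrict_space)

lemma sq_integral_nonneg: "0 \<le> sq_integral A g"
  unfolding sq_integral_def set_lebesgue_integral_def by (intro integral_nonneg_AE) simp

text \<open>The two domains differ by a null set. On the boundary of the triangle, which may leave \<open>\<Omega>\<close>,
  nothing is known about \<open>h\<close>; its measurability there is a consequence of completeness.\<close>

lemma region_integral:
  fixes h :: "point \<Rightarrow> real"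
  assumes "set_integrable lebesgue (interior (region K)) h"
  shows "integral\<^sup>L (lebesgue_on (region K)) h = set_lebesgue_integral lebesgue (interior (region K)) h"
proof -
  define f where "f x = indicator (interior (region K)) x *\<^sub>R h x" for x
  define g where "g x = indicator (region K) x *\<^sub>R h x" for x
  have f: "f \<in> borel_measurable lebesgue"
    using assms unfolding set_integrable_def f_def[symmetric] by (rule borel_measurable_integrable)
  have "AE x in lebesgue. x \<notin> region K - interior (region K)"
    by (rule AE_not_in[OF null_region_frontier])
  then have ae: "AE x in lebesgue. f x = g x"
    unfolding f_def g_def by (elim AE_mp) (use interior_subset[of "region K"] in \<open>auto simp: indicator_def\<close>)
  then have g: "g \<in> borel_measurable lebesgue" using borel_measurable_AE[OF f] by blast
  have "region K \<in> sets lebesgue" using compact_region[of K] by (simp add: lmeasurable_compact fmeasurableD)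
  then have "integral\<^sup>L (lebesgue_on (region K)) h = integral\<^sup>L lebesgue g"
    unfolding g_def by (simp add: integral_restrict_space)
  also have "\<dots> = integral\<^sup>L lebesgue f" using ae by (intro integral_cong_AE g f) auto
  finally show ?thesis unfolding f_def set_lebesgue_integral_def .
qed

lemma measure_interior_region: "measure lebesgue (interior (region K)) = area K"
  and finite_interior_region: "emeasure lebesgue (interior (region K)) < \<infinity>"
proof -
  have fin: "region K \<in> fmeasurable lebesgue" by (rule lmeasurable_compact[OF compact_region])
  show f: "emeasure lebesgue (interior (region K)) < \<infinity>"
    using fmeasurableI2[OF fin interior_subset interior_sets_lebesgue] by (simp add: fmeasurable_def)
  have "interior (region K) = region K - (region K - interior (region K))" using interior_subset by blast
  then have "measure lebesgue (interior (region K)) = measure lebesgue (region K)"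
    using measure_Diff_null_set[OF fmeasurableD[OF fin] null_region_frontier] by metis
  then show "measure lebesgue (interior (region K)) = area K" by (simp add: measure_region)
qed

lemma set_integral_const_region:
  fixes c :: real
  shows "set_integrable lebesgue (interior (region K)) (\<lambda>x. c)"
    "set_lebesgue_integral lebesgue (interior (region K)) (\<lambda>x. c) = area K * c"
  using finite_interior_region[of K] interior_sets_lebesgue[of "region K"] measure_interior_region[of K]
  by (simp_all add: set_integrable_def set_lebesgue_integral_def)

lemma grad_integral:
  assumes K: "tri_det K \<noteq> 0" and v: "affine_on v K"
  shows "integral\<^sup>L (lebesgue_on (region K)) (\<lambda>x. (norm (grad v x))\<^sup>2) = area K * (norm (slope v K))\<^sup>2"
proof -
  have eq: "indicator (interior (region K)) x *\<^sub>R (norm (grad v x))\<^sup>2 = indicator (interior (region K)) x *\<^sub>R (norm (slope v K))\<^sup>2" for x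
    using affine_ext(2)[OF K v] by (cases "x \<in> interior (region K)") auto
  have "set_integrable lebesgue (interior (region K)) (\<lambda>x. (norm (grad v x))\<^sup>2)"
    using set_integral_const_region(1)[of K "(norm (slope v K))\<^sup>2"] unfolding set_integrable_def eq .
  then show ?thesis
    unfolding region_integral[OF \<open>set_integrable lebesgue (interior (region K)) (\<lambda>x. (norm (grad v x))\<^sup>2)\<close>]
    using set_integral_const_region(2)[of K "(norm (slope v K))\<^sup>2"] unfolding set_lebesgue_integral_def eq by simp
qed

lemma pw_norm_energy:
  assumes "conforming_triangulation \<Omega> T" "\<And>K. K \<in> T \<Longrightarrow> affine_on v K"
  shows "(pw_norm T v)\<^sup>2 = energy v T"
proof -
  have "(\<Sum>K\<in>T. integral\<^sup>L (lebesgue_on (region K)) (\<lambda>x. (norm (grad v x))\<^sup>2)) = energy v T"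
    unfolding energy_def using grad_integral[OF conf_det[OF assms(1)] assms(2)] by (intro sum.cong) auto
  then show ?thesis unfolding pw_norm_def using energy_nonneg[of v T] by simp
qed

lemma volume_term_eq:
  assumes "g \<in> L2 \<Omega>" "open \<Omega>" "interior (region K) \<subseteq> \<Omega>"
  shows "volume_term g K = area K * sq_integral (interior (region K)) g"
proof -
  have "(L2_norm (region K) g)\<^sup>2 = sq_integral (interior (region K)) g"
    unfolding L2_norm_sq sq_integral_def
    by (intro region_integral L2_set_integrable_subset[OF assms(1) open_sets_lebesgue[OF assms(2)] interior_sets_lebesgue assms(3)])
  then show ?thesis unfolding volume_term_def meshsize_eq by (simp add: area_nonneg)
qed

lemma L2_add_scaled:
  assumes "g \<in> L2 S" "h \<in> L2 S" shows "(\<lambda>x. g x + r *\<^sub>R h x) \<in> L2 S"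
proof -
  have m: "g \<in> borel_measurable (lebesgue_on S)" "h \<in> borel_measurable (lebesgue_on S)"
    and i: "integrable (lebesgue_on S) (\<lambda>x. (norm (g x))\<^sup>2)" "integrable (lebesgue_on S) (\<lambda>x. (norm (h x))\<^sup>2)"
    using assms unfolding L2_def by auto
  have "integrable (lebesgue_on S) (\<lambda>x. (norm (g x + r *\<^sub>R h x))\<^sup>2)"
  proof (rule Bochner_Integration.integrable_bound)
    show "integrable (lebesgue_on S) (\<lambda>x. 2 * (norm (g x))\<^sup>2 + 2 * r\<^sup>2 * (norm (h x))\<^sup>2)" using i by auto
    show "(\<lambda>x. (norm (g x + r *\<^sub>R h x))\<^sup>2) \<in> borel_measurable (lebesgue_on S)" using m by measurable
    show "AE x in lebesgue_on S. norm ((norm (g x + r *\<^sub>R h x))\<^sup>2) \<le> norm (2 * (norm (g x))\<^sup>2 + 2 * r\<^sup>2 * (norm (h x))\<^sup>2)"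
    proof (rule AE_I2)
      fix x
      have "(norm (g x + r *\<^sub>R h x))\<^sup>2 \<le> 2 * (norm (g x))\<^sup>2 + 2 * (norm (r *\<^sub>R h x))\<^sup>2" by (rule norm_add_sq)
      then show "norm ((norm (g x + r *\<^sub>R h x))\<^sup>2) \<le> norm (2 * (norm (g x))\<^sup>2 + 2 * r\<^sup>2 * (norm (h x))\<^sup>2)"
        by (simp add: power_mult_distrib mult.assoc)
    qed
  qed
  moreover have "(\<lambda>x. g x + r *\<^sub>R h x) \<in> borel_measurable (lebesgue_on S)" using m by measurable
  ultimately show ?thesis unfolding L2_def by simp
qed

lemma L2_add: "g \<in> L2 S \<Longrightarrow> h \<in> L2 S \<Longrightarrow> (\<lambda>x. g x + h x) \<in> L2 S"
  using L2_add_scaled[of g S h 1] by simp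

lemma L2_diff: "g \<in> L2 S \<Longrightarrow> h \<in> L2 S \<Longrightarrow> (\<lambda>x. g x - h x) \<in> L2 S"
  using L2_add_scaled[of g S h "-1"] by simp

lemma L2_inner_integrable:
  assumes "g \<in> L2 S" "h \<in> L2 S" shows "integrable (lebesgue_on S) (\<lambda>x. g x \<bullet> h x)"
proof -
  have m: "g \<in> borel_measurable (lebesgue_on S)" "h \<in> borel_measurable (lebesgue_on S)"
    and i: "integrable (lebesgue_on S) (\<lambda>x. (norm (g x))\<^sup>2)" "integrable (lebesgue_on S) (\<lambda>x. (norm (h x))\<^sup>2)"
    using assms unfolding L2_def by auto
  show ?thesis
  proof (rule Bochner_Integration.integrable_bound)
    show "integrable (lebesgue_on S) (\<lambda>x. (norm (g x))\<^sup>2 + (norm (h x))\<^sup>2)" using i by auto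
    show "(\<lambda>x. g x \<bullet> h x) \<in> borel_measurable (lebesgue_on S)" using m by measurable
    show "AE x in lebesgue_on S. norm (g x \<bullet> h x) \<le> norm ((norm (g x))\<^sup>2 + (norm (h x))\<^sup>2)"
    proof (rule AE_I2)
      fix x
      have "\<bar>g x \<bullet> h x\<bar> \<le> norm (g x) * norm (h x)" by (rule Cauchy_Schwarz_ineq2)
      moreover have "0 \<le> (norm (g x) - norm (h x))\<^sup>2" "0 \<le> (norm (g x) + norm (h x))\<^sup>2" by simp_all
      ultimately show "norm (g x \<bullet> h x) \<le> norm ((norm (g x))\<^sup>2 + (norm (h x))\<^sup>2)"
        by (simp add: power2_eq_square algebra_simps)
    qed
  qed
qed

lemma sq_integral_young:
  assumes g: "set_integrable lebesgue A (\<lambda>x. (norm (g x))\<^sup>2)" and d: "set_integrable lebesgue A (\<lambda>x. (norm (d x))\<^sup>2)"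
    and s: "set_integrable lebesgue A (\<lambda>x. (norm (g x + d x))\<^sup>2)" and \<delta>: "\<delta> > 0"
  shows "sq_integral A (\<lambda>x. g x + d x) \<le> (1 + \<delta>) * sq_integral A g + (1 + 1 / \<delta>) * sq_integral A d"
proof -
  have gi: "set_integrable lebesgue A (\<lambda>x. (1 + \<delta>) * (norm (g x))\<^sup>2)" "set_integrable lebesgue A (\<lambda>x. (1 + 1 / \<delta>) * (norm (d x))\<^sup>2)"
    using g d by auto
  have "sq_integral A (\<lambda>x. g x + d x) \<le> set_lebesgue_integral lebesgue A (\<lambda>x. (1 + \<delta>) * (norm (g x))\<^sup>2 + (1 + 1 / \<delta>) * (norm (d x))\<^sup>2)"
    unfolding sq_integral_def using young_sq[OF \<delta>] by (intro set_integral_mono s set_integral_add(1)[OF gi]) auto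
  also have "\<dots> = (1 + \<delta>) * sq_integral A g + (1 + 1 / \<delta>) * sq_integral A d"
    unfolding sq_integral_def by (simp add: set_integral_add(2)[OF gi])
  finally show ?thesis .
qed

lemma sum_sq_integral_le:
  assumes fin: "finite I" and dis: "disjoint_family_on A I" and B: "set_integrable lebesgue B (\<lambda>x. (norm (g x))\<^sup>2)"
    and A: "\<And>i. i \<in> I \<Longrightarrow> A i \<in> sets lebesgue" "\<And>i. i \<in> I \<Longrightarrow> A i \<subseteq> B"
  shows "(\<Sum>i\<in>I. sq_integral (A i) g) \<le> sq_integral B g"
proof -
  define h where "h x = (norm (g x))\<^sup>2" for x
  have int: "integrable lebesgue (\<lambda>x. indicator (A i) x *\<^sub>R h x)" if "i \<in> I" for i
    using set_integrable_subset[OF B A(1)[OF that] A(2)[OF that]] unfolding set_integrable_def h_def .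
  have "(\<Sum>i\<in>I. sq_integral (A i) g) = (\<integral>x. (\<Sum>i\<in>I. indicator (A i) x *\<^sub>R h x) \<partial>lebesgue)"
    unfolding sq_integral_def set_lebesgue_integral_def h_def[symmetric] using int by (simp add: Bochner_Integration.integral_sum)
  also have "\<dots> \<le> (\<integral>x. indicator B x *\<^sub>R h x \<partial>lebesgue)"
  proof (rule integral_mono)
    show "integrable lebesgue (\<lambda>x. \<Sum>i\<in>I. indicator (A i) x *\<^sub>R h x)" using int by (rule Bochner_Integration.integrable_sum)
    show "integrable lebesgue (\<lambda>x. indicator B x *\<^sub>R h x)" using B unfolding set_integrable_def h_def .
    fix x
    have "(\<Sum>i\<in>I. indicator (A i) x *\<^sub>R h x) = indicator (\<Union>i\<in>I. A i) x *\<^sub>R h x"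
      unfolding indicator_UN_disjoint[OF fin dis] by (simp add: sum_distrib_right)
    also have "\<dots> \<le> indicator B x *\<^sub>R h x" using A(2) by (auto simp: indicator_def h_def)
    finally show "(\<Sum>i\<in>I. indicator (A i) x *\<^sub>R h x) \<le> indicator B x *\<^sub>R h x" .
  qed
  finally show ?thesis unfolding sq_integral_def set_lebesgue_integral_def h_def .
qed

text \<open>The norm of an affine field on a triangle is at most its maximum over the vertices.\<close>

lemma affine_sq_integral_le:
  assumes K: "tri_det K \<noteq> 0" and v: "affine_on v K"
    and i: "set_integrable lebesgue (interior (region K)) (\<lambda>x. (norm (v x))\<^sup>2)"
  shows "sq_integral (interior (region K)) v \<le> area K * (\<Sum>x\<in>vertices K. (norm (extension v K x - 0))\<^sup>2)"
proof -
  define M where "M = (\<Sum>x\<in>vertices K. (norm (extension v K x - 0))\<^sup>2)"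
  have M0: "0 \<le> M" unfolding M_def by (simp add: sum_nonneg)
  have aff: "extension v K ((1 - t) *\<^sub>R x + t *\<^sub>R y) = (1 - t) *\<^sub>R extension v K x + t *\<^sub>R extension v K y" for t x y
  proof -
    have "extension v K ((1 - t) *\<^sub>R x + t *\<^sub>R y) = v (centroid K) + ((1 - t) *\<^sub>R (slope v K *v x) + t *\<^sub>R (slope v K *v y)) - slope v K *v centroid K"
      unfolding extension_def by (simp add: matrix_vector_mult_diff_distrib matrix_vector_right_distrib matrix_vector_mult_scaleR)
    then show ?thesis unfolding extension_def by (simp add: matrix_vector_mult_diff_distrib algebra_simps)
  qed
  have "convex {x. extension v K x \<in> cball 0 (sqrt M)}"
    unfolding convex_alt mem_Collect_eq aff using convex_cball[of 0 "sqrt M"] unfolding convex_alt by blast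
  moreover have "vertices K \<subseteq> {x. extension v K x \<in> cball 0 (sqrt M)}"
  proof
    fix x assume "x \<in> vertices K"
    then have "(norm (extension v K x - 0))\<^sup>2 \<le> M" unfolding M_def by (intro member_le_sum) (auto simp: finite_vertices)
    then show "x \<in> {x. extension v K x \<in> cball 0 (sqrt M)}" by (simp add: real_le_rsqrt)
  qed
  ultimately have sub: "region K \<subseteq> {x. extension v K x \<in> cball 0 (sqrt M)}" unfolding region_def by (rule hull_minimal[rotated])
  have pt: "(norm (v x))\<^sup>2 \<le> M" if "x \<in> interior (region K)" for x
  proof -
    have "x \<in> region K" using that interior_subset by blast
    then have "norm (v x) \<le> sqrt M" using sub affine_ext(1)[OF K v that] by auto
    then show ?thesis using M0 by (metis norm_ge_zero power_mono real_sqrt_pow2)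
  qed
  have "sq_integral (interior (region K)) v \<le> set_lebesgue_integral lebesgue (interior (region K)) (\<lambda>x. M)"
    unfolding sq_integral_def using pt by (intro set_integral_mono i set_integral_const_region(1)) auto
  then show ?thesis unfolding set_integral_const_region(2) M_def .
qed

lemma sq_integral_domain:
  assumes conf: "conforming_triangulation \<Omega> T" and op: "open \<Omega>" and g: "g \<in> L2 \<Omega>"
  shows "sq_integral \<Omega> g \<le> (\<Sum>L\<in>T. sq_integral (interior (region L)) g)"
proof -
  define h where "h x = (norm (g x))\<^sup>2" for x
  note So = open_sets_lebesgue[OF op]
  have int: "integrable lebesgue (\<lambda>x. indicator (interior (region L)) x *\<^sub>R h x)" if "L \<in> T" for L
    using L2_set_integrable_subset[OF g So interior_sets_lebesgue conf_interior[OF conf that]] unfolding set_integrable_def h_def .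
  have "AE x in lebesgue. \<forall>L\<in>T. x \<notin> region L - interior (region L)"
    using conf_finite[OF conf] by (intro AE_finite_allI AE_not_in null_region_frontier)
  then have ae: "AE x in lebesgue. indicator \<Omega> x *\<^sub>R h x \<le> (\<Sum>L\<in>T. indicator (interior (region L)) x *\<^sub>R h x)"
  proof (rule AE_mp, intro AE_I2 impI)
    fix x assume nx: "\<forall>L\<in>T. x \<notin> region L - interior (region L)"
    show "indicator \<Omega> x *\<^sub>R h x \<le> (\<Sum>L\<in>T. indicator (interior (region L)) x *\<^sub>R h x)"
    proof (cases "x \<in> \<Omega>")
      case True
      then have "x \<in> (\<Union>L\<in>T. region L)" using conf_cover[OF conf] closure_subset by blast
      then obtain L where L: "L \<in> T" "x \<in> interior (region L)" using nx by blast
      have "indicator (interior (region L)) x *\<^sub>R h x \<le> (\<Sum>L\<in>T. indicator (interior (region L)) x *\<^sub>R h x)"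
        using conf_finite[OF conf] by (intro member_le_sum[OF L(1)]) (auto simp: h_def)
      then show ?thesis using L True by simp
    next
      case False
      then show ?thesis by (auto simp: h_def intro!: sum_nonneg)
    qed
  qed
  have "integrable lebesgue (\<lambda>x. indicator \<Omega> x *\<^sub>R h x)" using L2_set_integrable[OF g So] unfolding set_integrable_def h_def .
  then have "(\<integral>x. indicator \<Omega> x *\<^sub>R h x \<partial>lebesgue) \<le> (\<integral>x. (\<Sum>L\<in>T. indicator (interior (region L)) x *\<^sub>R h x) \<partial>lebesgue)"
    using ae int by (intro integral_mono_AE Bochner_Integration.integrable_sum) auto
  then show ?thesis
    unfolding sq_integral_def set_lebesgue_integral_def h_def[symmetric] using int by (simp add: Bochner_Integration.integral_sum)
qed

lemma sq_integral_spread: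
  assumes conf: "conforming_triangulation \<Omega> T" and op: "open \<Omega>" and w: "w \<in> L2 \<Omega>" "\<And>L. L \<in> T \<Longrightarrow> affine_on w L"
  shows "sq_integral \<Omega> w \<le> spread w T 0"
proof -
  have "(\<Sum>L\<in>T. sq_integral (interior (region L)) w) \<le> spread w T 0"
    unfolding spread_def
    by (intro sum_mono affine_sq_integral_le conf_det[OF conf] w(2)
        L2_set_integrable_subset[OF w(1) open_sets_lebesgue[OF op] interior_sets_lebesgue conf_interior[OF conf]])
  then show ?thesis using sq_integral_domain[OF conf op w(1)] by linarith
qed

lemma disjoint_interiors:
  assumes conf: "conforming_triangulation \<Omega> T" and S: "S \<subseteq> T"
  shows "disjoint_family_on (\<lambda>L. interior (region L)) S"
  unfolding disjoint_family_on_def using conf_disjoint[OF conf] S interior_subset by blast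

lemma sum_volume_le:
  assumes conf: "conforming_triangulation \<Omega> T" and op: "open \<Omega>" and g: "g \<in> L2 \<Omega>" and A: "\<And>L. L \<in> T \<Longrightarrow> area L \<le> A"
  shows "(\<Sum>L\<in>T. area L * sq_integral (interior (region L)) g) \<le> A * sq_integral \<Omega> g"
proof (cases "T = {}")
  case False
  then have A0: "0 \<le> A" using A area_nonneg order_trans by blast
  have "(\<Sum>L\<in>T. area L * sq_integral (interior (region L)) g) \<le> (\<Sum>L\<in>T. A * sq_integral (interior (region L)) g)"
    using A sq_integral_nonneg by (intro sum_mono mult_right_mono) auto
  also have "\<dots> = A * (\<Sum>L\<in>T. sq_integral (interior (region L)) g)" by (simp add: sum_distrib_left)
  also have "\<dots> \<le> A * sq_integral \<Omega> g"
    using A0 conf_interior[OF conf]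
    by (intro mult_left_mono sum_sq_integral_le conf_finite[OF conf] disjoint_interiors[OF conf]
        L2_set_integrable[OF g open_sets_lebesgue[OF op]] interior_sets_lebesgue) auto
  finally show ?thesis .
next
  case True
  show ?thesis
  proof (cases "\<Omega> = {}")
    case True then show ?thesis using \<open>T = {}\<close> by (simp add: sq_integral_def set_lebesgue_integral_def)
  next
    case False
    then show ?thesis using conf_cover[OF conf] \<open>T = {}\<close> closure_subset[of \<Omega>] by auto
  qed
qed

lemma volume_reduction:
  assumes conf: "conforming_triangulation \<Omega> T" and conf': "conforming_triangulation \<Omega> T'" and op: "open \<Omega>"
    and fo: "forest T T' \<tau>" and K: "K \<in> T" "K \<notin> T'" and g: "g \<in> L2 \<Omega>"
  shows "(\<Sum>L\<in>\<tau> K. volume_term g L) \<le> 1/2 * volume_term g K"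
proof -
  have t: "bis_tree K (\<tau> K)" "\<tau> K \<subseteq> T'" using fo K(1) unfolding forest_def by blast+
  note dK = conf_det[OF conf K(1)] and iK = conf_interior[OF conf K(1)]
  have sub: "interior (region L) \<subseteq> interior (region K)" if "L \<in> \<tau> K" for L using tree_interior_mono(2)[OF t(1) dK that] .
  have "(\<Sum>L\<in>\<tau> K. volume_term g L) \<le> (\<Sum>L\<in>\<tau> K. area K / 2 * sq_integral (interior (region L)) g)"
  proof (rule sum_mono)
    fix L assume L: "L \<in> \<tau> K"
    have "L \<noteq> K" using L t(2) K(2) by blast
    have "interior (region L) \<subseteq> \<Omega>" using sub[OF L] iK by blast
    from volume_term_eq[OF g op this] show "volume_term g L \<le> area K / 2 * sq_integral (interior (region L)) g"
      using mult_right_mono[OF tree_area_half[OF t(1) L \<open>L \<noteq> K\<close>] sq_integral_nonneg] by metis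
  qed
  also have "\<dots> = area K / 2 * (\<Sum>L\<in>\<tau> K. sq_integral (interior (region L)) g)" by (simp add: sum_distrib_left)
  also have "\<dots> \<le> area K / 2 * sq_integral (interior (region K)) g"
    using sub area_nonneg[of K] tree_finite[OF t(1)]
    by (intro mult_left_mono sum_sq_integral_le disjoint_interiors[OF conf' t(2)] interior_sets_lebesgue
        L2_set_integrable_subset[OF g open_sets_lebesgue[OF op] interior_sets_lebesgue iK]) auto
  finally show ?thesis unfolding volume_term_eq[OF g op iK] by simp
qed

text \<open>Each control is admissible in the variational inequality of the other one. The sum of the two
  inequalities gives \<open>\<alpha> |u' - u|^2 \<le> (p - p', u' - u)\<close>.\<close>

lemma control_stability:
  fixes u u' p p' :: field
  assumes u: "u \<in> L2 \<Omega>" "u' \<in> L2 \<Omega>" and p: "p \<in> L2 \<Omega>" "p' \<in> L2 \<Omega>" and \<alpha>: "\<alpha> > 0" and \<Omega>: "\<Omega> \<in> sets lebesgue"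
    and vi: "0 \<le> L2_inner \<Omega> (\<lambda>x. \<alpha> *\<^sub>R u x + p x) (\<lambda>x. u' x - u x)"
    and vi': "0 \<le> L2_inner \<Omega> (\<lambda>x. \<alpha> *\<^sub>R u' x + p' x) (\<lambda>x. u x - u' x)"
  shows "sq_integral \<Omega> (\<lambda>x. u' x - u x) \<le> (1 / \<alpha>\<^sup>2) * sq_integral \<Omega> (\<lambda>x. p' x - p x)"
proof -
  define M where "M = lebesgue_on \<Omega>"
  have l: "(\<lambda>x. \<alpha> *\<^sub>R u x + p x) \<in> L2 \<Omega>" "(\<lambda>x. \<alpha> *\<^sub>R u' x + p' x) \<in> L2 \<Omega>"
    using L2_add_scaled[OF p(1) u(1), of \<alpha>] L2_add_scaled[OF p(2) u(2), of \<alpha>] by (simp_all add: add.commute)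
  have d: "(\<lambda>x. u' x - u x) \<in> L2 \<Omega>" "(\<lambda>x. u x - u' x) \<in> L2 \<Omega>" "(\<lambda>x. p' x - p x) \<in> L2 \<Omega>"
    using L2_diff u p by blast+
  have i: "integrable M (\<lambda>x. (\<alpha> *\<^sub>R u x + p x) \<bullet> (u' x - u x))" "integrable M (\<lambda>x. (\<alpha> *\<^sub>R u' x + p' x) \<bullet> (u x - u' x))"
    unfolding M_def using L2_inner_integrable l d by blast+
  have s: "integrable M (\<lambda>x. (norm (u' x - u x))\<^sup>2)" "integrable M (\<lambda>x. (norm (p' x - p x))\<^sup>2)"
    using d unfolding L2_def M_def by auto
  have "0 \<le> integral\<^sup>L M (\<lambda>x. (\<alpha> *\<^sub>R u x + p x) \<bullet> (u' x - u x) + (\<alpha> *\<^sub>R u' x + p' x) \<bullet> (u x - u' x))"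
    using vi vi' unfolding L2_inner_def M_def[symmetric] by (simp add: Bochner_Integration.integral_add[OF i])
  also have "\<dots> \<le> integral\<^sup>L M (\<lambda>x. 1 / (2 * \<alpha>) * (norm (p' x - p x))\<^sup>2 - \<alpha> / 2 * (norm (u' x - u x))\<^sup>2)"
  proof (rule integral_mono)
    show "integrable M (\<lambda>x. (\<alpha> *\<^sub>R u x + p x) \<bullet> (u' x - u x) + (\<alpha> *\<^sub>R u' x + p' x) \<bullet> (u x - u' x))"
      using i by (rule Bochner_Integration.integrable_add)
    show "integrable M (\<lambda>x. 1 / (2 * \<alpha>) * (norm (p' x - p x))\<^sup>2 - \<alpha> / 2 * (norm (u' x - u x))\<^sup>2)" using s by auto
    fix x
    define d where "d = u' x - u x"
    define e where "e = p' x - p x"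
    have "(\<alpha> *\<^sub>R u x + p x) \<bullet> (u' x - u x) + (\<alpha> *\<^sub>R u' x + p' x) \<bullet> (u x - u' x) = - \<alpha> * (norm d)\<^sup>2 - e \<bullet> d"
      unfolding d_def e_def power2_norm_eq_inner by (simp add: inner_diff inner_add inner_commute algebra_simps)
    moreover have "0 \<le> (norm (e + \<alpha> *\<^sub>R d))\<^sup>2 / (2 * \<alpha>)" using \<alpha> by simp
    moreover have "(norm (e + \<alpha> *\<^sub>R d))\<^sup>2 / (2 * \<alpha>) = 1 / (2 * \<alpha>) * (norm e)\<^sup>2 + \<alpha> / 2 * (norm d)\<^sup>2 + e \<bullet> d"
      using \<alpha> unfolding power2_norm_eq_inner by (simp add: inner_add inner_commute field_simps)
    ultimately show "(\<alpha> *\<^sub>R u x + p x) \<bullet> (u' x - u x) + (\<alpha> *\<^sub>R u' x + p' x) \<bullet> (u x - u' x)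
        \<le> 1 / (2 * \<alpha>) * (norm (p' x - p x))\<^sup>2 - \<alpha> / 2 * (norm (u' x - u x))\<^sup>2"
      unfolding d_def[symmetric] e_def[symmetric] by linarith
  qed
  also have "\<dots> = 1 / (2 * \<alpha>) * integral\<^sup>L M (\<lambda>x. (norm (p' x - p x))\<^sup>2) - \<alpha> / 2 * integral\<^sup>L M (\<lambda>x. (norm (u' x - u x))\<^sup>2)"
    using s by simp
  finally have "\<alpha> / 2 * integral\<^sup>L M (\<lambda>x. (norm (u' x - u x))\<^sup>2) \<le> 1 / (2 * \<alpha>) * integral\<^sup>L M (\<lambda>x. (norm (p' x - p x))\<^sup>2)" by simp
  moreover have sq: "integral\<^sup>L M (\<lambda>x. (norm (g x))\<^sup>2) = sq_integral \<Omega> g" for g :: field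
    using L2_norm_sq[of \<Omega> g] L2_norm_set[OF \<Omega>, of g] unfolding M_def by simp
  ultimately have "\<alpha> / 2 * sq_integral \<Omega> (\<lambda>x. u' x - u x) \<le> 1 / (2 * \<alpha>) * sq_integral \<Omega> (\<lambda>x. p' x - p x)"
    by (simp only: sq[of "\<lambda>x. u' x - u x"] sq[of "\<lambda>x. p' x - p x"])
  then have "(2 / \<alpha>) * (\<alpha> / 2 * sq_integral \<Omega> (\<lambda>x. u' x - u x)) \<le> (2 / \<alpha>) * (1 / (2 * \<alpha>) * sq_integral \<Omega> (\<lambda>x. p' x - p x))"
    using \<alpha> by (intro mult_left_mono) auto
  then show ?thesis using \<alpha> by (simp add: power2_eq_square)
qed

text \<open>The gradient does not see the piecewise constant control.\<close>

lemma control_term_eq: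
  assumes K: "tri_det K \<noteq> 0" and u: "\<forall>x\<in>interior (region K). control X x = c" and p: "affine_on (adjoint_state X) K"
  shows "control_term \<alpha> X K = area K * (area K * (norm (slope (adjoint_state X) K))\<^sup>2) / \<alpha>\<^sup>2"
proof -
  have u': "\<forall>x\<in>interior (region K). control X x = 0 *v x + c" using u by (simp add: matrix_vector_mult_0)
  then have au: "affine_on (control X) K" unfolding affine_on_def by blast
  define z where "z = (\<lambda>x. control X x - (1 / \<alpha>) *\<^sub>R adjoint_state X x)"
  have z: "affine_on z K" "slope z K = - ((1 / \<alpha>) *\<^sub>R slope (adjoint_state X) K)"
    using affine_on_comb(1,2)[OF K au p, of "1 / \<alpha>"] affine_data(1)[OF K u'] unfolding z_def by auto
  have "(L2_norm (region K) (grad z))\<^sup>2 = area K * (norm (slope z K))\<^sup>2"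
    unfolding L2_norm_sq using grad_integral[OF K z(1)] .
  then show ?thesis unfolding control_term_def z_def[symmetric] z(2) meshsize_eq
    by (simp add: area_nonneg power_mult_distrib power_divide)
qed

section \<open>Reduction of the estimator\<close>

text \<open>The contribution of one triangle to the squared estimator.\<close>

definition local_estimator :: "approach \<Rightarrow> point set \<Rightarrow> field \<Rightarrow> field \<Rightarrow> real \<Rightarrow> mesh \<Rightarrow> discrete_fields \<Rightarrow> tri \<Rightarrow> real" where
  "local_estimator ap \<Omega> f yd \<alpha> T X K =
     volume_term (\<lambda>x. f x + control X x) K + jump_term \<Omega> T (state X) K +
     volume_term (\<lambda>x. state X x - yd x) K + jump_term \<Omega> T (adjoint_state X) K +
     (case ap of Variational \<Rightarrow> 0 | Discretised \<Rightarrow> control_term \<alpha> X K)"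

lemma crouzeix_raviart_affine: "v \<in> crouzeix_raviart \<Omega> T \<Longrightarrow> K \<in> T \<Longrightarrow> affine_on v K"
  unfolding crouzeix_raviart_def affine_on_def by blast

lemma volume_term_nonneg: "0 \<le> volume_term g K"
  unfolding volume_term_def by simp

lemma jump_term_nonneg: "0 \<le> jump_term \<Omega> T v K"
  unfolding jump_term_def by (intro sum_nonneg mult_nonneg_nonneg meshsize_nonneg) auto

lemma control_term_nonneg: "0 \<le> control_term \<alpha> X K"
  unfolding control_term_def by simp

lemma local_estimator_nonneg: "0 \<le> local_estimator ap \<Omega> f yd \<alpha> T X K"
  unfolding local_estimator_def
  by (auto intro!: add_nonneg_nonneg volume_term_nonneg jump_term_nonneg control_term_nonneg split: approach.split)

lemma jump_term_young:
  assumes conf: "conforming_triangulation \<Omega> T" and op: "open \<Omega>" and L: "L \<in> T" and \<delta>: "\<delta> > 0"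
    and v: "\<And>K. K \<in> T \<Longrightarrow> affine_on v K" and v': "\<And>K. K \<in> T \<Longrightarrow> affine_on v' K"
  shows "jump_term \<Omega> T v' L \<le> (1 + \<delta>) * jump_term \<Omega> T v L + (1 + 1 / \<delta>) * jump_term \<Omega> T (\<lambda>x. v' x - v x) L"
proof -
  define w where "w = (\<lambda>x. v' x - v x)"
  have w: "affine_on w K" "slope w K = slope v' K - slope v K" if "K \<in> T" for K
    using affine_on_diff(1,2)[OF conf_det[OF conf that] v'[OF that] v[OF that]] unfolding w_def by auto
  have sj: "slope_jump \<Omega> T v' L E = slope_jump \<Omega> T v L E + slope_jump \<Omega> T w L E" if E: "E \<in> edges L" for E
  proof (cases "segment E \<subseteq> frontier \<Omega>")
    case True
    then show ?thesis unfolding slope_jump_def w(2)[OF L] by (simp add: matrix_vector_mult_diff_rdistrib)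
  next
    case False
    then show ?thesis unfolding slope_jump_def w(2)[OF L] w(2)[OF neighbour_props(1)[OF conf op L E False]]
      by (simp add: matrix_vector_mult_diff_rdistrib)
  qed
  have eq: "jump_term \<Omega> T u L = (\<Sum>E\<in>edges L. meshsize L * (edge_length E * (norm (slope_jump \<Omega> T u L E))\<^sup>2))"
    if "\<And>K. K \<in> T \<Longrightarrow> affine_on u K" for u
    using that L by (intro jump_term_eq[OF conf op])
  have "jump_term \<Omega> T v' L \<le> (\<Sum>E\<in>edges L. meshsize L * (edge_length E *
      ((1 + \<delta>) * (norm (slope_jump \<Omega> T v L E))\<^sup>2 + (1 + 1 / \<delta>) * (norm (slope_jump \<Omega> T w L E))\<^sup>2)))"
  proof -
    have "jump_term \<Omega> T v' L = (\<Sum>E\<in>edges L. meshsize L * (edge_length E * (norm (slope_jump \<Omega> T v L E + slope_jump \<Omega> T w L E))\<^sup>2))"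
      using eq[of v'] v' sj by simp
    also have "\<dots> \<le> (\<Sum>E\<in>edges L. meshsize L * (edge_length E *
      ((1 + \<delta>) * (norm (slope_jump \<Omega> T v L E))\<^sup>2 + (1 + 1 / \<delta>) * (norm (slope_jump \<Omega> T w L E))\<^sup>2)))"
      by (intro sum_mono mult_left_mono young_sq[OF \<delta>] meshsize_nonneg edge_length_nonneg)
    finally show ?thesis .
  qed
  also have "\<dots> = (1 + \<delta>) * (\<Sum>E\<in>edges L. meshsize L * (edge_length E * (norm (slope_jump \<Omega> T v L E))\<^sup>2))
      + (1 + 1 / \<delta>) * (\<Sum>E\<in>edges L. meshsize L * (edge_length E * (norm (slope_jump \<Omega> T w L E))\<^sup>2))"
    unfolding sum_distrib_left sum.distrib[symmetric] by (intro sum.cong) (auto simp: algebra_simps)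
  also have "\<dots> = (1 + \<delta>) * jump_term \<Omega> T v L + (1 + 1 / \<delta>) * jump_term \<Omega> T w L"
    using eq[of v] eq[of w] v w(1) by simp
  finally show ?thesis unfolding w_def .
qed

lemma volume_term_young:
  assumes g: "g \<in> L2 \<Omega>" "g' \<in> L2 \<Omega>" and op: "open \<Omega>" and K: "interior (region K) \<subseteq> \<Omega>" and \<delta>: "\<delta> > 0"
  shows "volume_term g' K \<le> (1 + \<delta>) * volume_term g K
    + (1 + 1 / \<delta>) * (area K * sq_integral (interior (region K)) (\<lambda>x. g' x - g x))"
proof -
  note int = L2_set_integrable_subset[OF _ open_sets_lebesgue[OF op] interior_sets_lebesgue K]
  have "sq_integral (interior (region K)) (\<lambda>x. g x + (g' x - g x)) \<le> (1 + \<delta>) * sq_integral (interior (region K)) g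
      + (1 + 1 / \<delta>) * sq_integral (interior (region K)) (\<lambda>x. g' x - g x)"
  proof (rule sq_integral_young[OF int[OF g(1)] int[OF L2_diff[OF g(2,1)]] _ \<delta>])
    show "set_integrable lebesgue (interior (region K)) (\<lambda>x. (norm (g x + (g' x - g x)))\<^sup>2)" using int[OF g(2)] by simp
  qed
  then have "area K * sq_integral (interior (region K)) g' \<le> area K * ((1 + \<delta>) * sq_integral (interior (region K)) g
      + (1 + 1 / \<delta>) * sq_integral (interior (region K)) (\<lambda>x. g' x - g x))"
    by (intro mult_left_mono area_nonneg) simp
  then show ?thesis unfolding volume_term_eq[OF g(1) op K] volume_term_eq[OF g(2) op K] by (simp add: algebra_simps)
qed

lemma refined_triangle:
  assumes conf: "conforming_triangulation \<Omega> T" and conf': "conforming_triangulation \<Omega> T'"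
    and fo: "forest T T' \<tau>" and L: "L \<in> T'" "L \<notin> T"
  obtains K where "K \<in> T" "K \<notin> T'" "L \<in> \<tau> K"
proof -
  obtain K where K: "K \<in> T" "L \<in> \<tau> K" using fo L unfolding forest_def by blast
  have t: "bis_tree K (\<tau> K)" "\<tau> K \<subseteq> T'" using fo K(1) unfolding forest_def by blast+
  have "K \<notin> T'"
  proof
    assume "K \<in> T'"
    have "interior (region L) \<subseteq> region K"
      using tree_interior_mono(1)[OF t(1) conf_det[OF conf K(1)] K(2)] interior_subset by blast
    then have "L = K"
      using conf_disjoint[OF conf' L(1) \<open>K \<in> T'\<close> centroid_interior[OF conf_det[OF conf' L(1)]]]
        centroid_interior[OF conf_det[OF conf' L(1)]] by blast
    then show False using K(1) L(2) by simp
  qed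
  then show ?thesis using K that by blast
qed

context
  fixes ap :: approach and \<Omega> :: "point set" and f yd :: field and \<alpha> :: real and ua ub :: point
    and T T' :: mesh and \<tau> :: "tri \<Rightarrow> tri set" and X X' :: discrete_fields
  assumes conf: "conforming_triangulation \<Omega> T" and conf': "conforming_triangulation \<Omega> T'" and op: "open \<Omega>"
    and fo: "forest T T' \<tau>" and f: "f \<in> L2 \<Omega>" and yd: "yd \<in> L2 \<Omega>" and \<alpha>: "\<alpha> > 0"
    and X: "discrete_solution ap \<Omega> f yd \<alpha> ua ub T X" and X': "discrete_solution ap \<Omega> f yd \<alpha> ua ub T' X'"
begin

lemma solution_L2:
  "state X \<in> L2 \<Omega>" "adjoint_state X \<in> L2 \<Omega>" "control X \<in> L2 \<Omega>"
  "state X' \<in> L2 \<Omega>" "adjoint_state X' \<in> L2 \<Omega>" "control X' \<in> L2 \<Omega>"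
  using X X' unfolding discrete_solution_def crouzeix_raviart_def U_h_def U_ad_def
  by (auto split: approach.splits)

lemma solution_affine:
  "K \<in> T \<Longrightarrow> affine_on (state X) K" "K \<in> T \<Longrightarrow> affine_on (adjoint_state X) K"
  "L \<in> T' \<Longrightarrow> affine_on (state X') L" "L \<in> T' \<Longrightarrow> affine_on (adjoint_state X') L"
  using X X' crouzeix_raviart_affine unfolding discrete_solution_def by metis+

lemma coarse_affine: 
  "L \<in> T' \<Longrightarrow> affine_on (state X) L" "L \<in> T' \<Longrightarrow> affine_on (adjoint_state X) L"
proof -
  assume "L \<in> T'"
  then obtain K where K: "K \<in> T" "L \<in> \<tau> K" using fo unfolding forest_def by blast
  show "affine_on (state X) L"
    using leaf_slope(2)[OF conf conf' op fo _ K] solution_affine(1) by blast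
  show "affine_on (adjoint_state X) L"
    using leaf_slope(2)[OF conf conf' op fo _ K] solution_affine(2) by blast
qed

lemma control_const:
  assumes "ap = Discretised"
  shows "K \<in> T \<Longrightarrow> \<exists>c. \<forall>x\<in>interior (region K). control X x = c" "L \<in> T' \<Longrightarrow> \<exists>c. \<forall>x\<in>interior (region L). control X' x = c"
  using X X' assms unfolding discrete_solution_def U_h_def P0_def by auto

lemma control_const_leaf:
  assumes "ap = Discretised" "L \<in> T'" shows "\<exists>c. \<forall>x\<in>interior (region L). control X x = c"
proof -
  obtain K where K: "K \<in> T" "L \<in> \<tau> K" using fo assms unfolding forest_def by blast
  have "bis_tree K (\<tau> K)" using fo K unfolding forest_def by blast
  from tree_interior_mono(2)[OF this conf_det[OF conf K(1)] K(2)] show ?thesis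
    using control_const(1)[OF assms(1) K(1)] by blast
qed

text \<open>The local estimator of the difference \<open>X' - X\<close>, in which the data \<open>f\<close> and \<open>yd\<close> cancel.\<close>

definition change_term :: "tri \<Rightarrow> real" where
  "change_term L = area L * sq_integral (interior (region L)) (\<lambda>x. control X' x - control X x)
     + jump_term \<Omega> T' (\<lambda>x. state X' x - state X x) L
     + area L * sq_integral (interior (region L)) (\<lambda>x. state X' x - state X x)
     + jump_term \<Omega> T' (\<lambda>x. adjoint_state X' x - adjoint_state X x) L
     + (case ap of Variational \<Rightarrow> 0
        | Discretised \<Rightarrow> area L * (area L * (norm (slope (\<lambda>x. adjoint_state X' x - adjoint_state X x) L))\<^sup>2) / \<alpha>\<^sup>2)"

lemma change_term_nonneg: "0 \<le> change_term L"
  unfolding change_term_def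
  by (auto intro!: add_nonneg_nonneg mult_nonneg_nonneg area_nonneg sq_integral_nonneg jump_term_nonneg divide_nonneg_nonneg split: approach.split)

lemma local_estimator_young:
  assumes L: "L \<in> T'" and \<delta>: "\<delta> > 0"
  shows "local_estimator ap \<Omega> f yd \<alpha> T' X' L \<le> (1 + \<delta>) * local_estimator ap \<Omega> f yd \<alpha> T' X L + (1 + 1 / \<delta>) * change_term L"
proof -
  note iL = conf_interior[OF conf' L]
  have 1: "volume_term (\<lambda>x. f x + control X' x) L \<le> (1 + \<delta>) * volume_term (\<lambda>x. f x + control X x) L
      + (1 + 1 / \<delta>) * (area L * sq_integral (interior (region L)) (\<lambda>x. control X' x - control X x))"
    using volume_term_young[OF L2_add[OF f solution_L2(3)] L2_add[OF f solution_L2(6)] op iL \<delta>] by simp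
  have 2: "jump_term \<Omega> T' (state X') L \<le> (1 + \<delta>) * jump_term \<Omega> T' (state X) L
      + (1 + 1 / \<delta>) * jump_term \<Omega> T' (\<lambda>x. state X' x - state X x) L"
    by (intro jump_term_young[OF conf' op L \<delta>] coarse_affine solution_affine)
  have 3: "volume_term (\<lambda>x. state X' x - yd x) L \<le> (1 + \<delta>) * volume_term (\<lambda>x. state X x - yd x) L
      + (1 + 1 / \<delta>) * (area L * sq_integral (interior (region L)) (\<lambda>x. state X' x - state X x))"
    using volume_term_young[OF L2_diff[OF solution_L2(1) yd] L2_diff[OF solution_L2(4) yd] op iL \<delta>] by simp
  have 4: "jump_term \<Omega> T' (adjoint_state X') L \<le> (1 + \<delta>) * jump_term \<Omega> T' (adjoint_state X) L
      + (1 + 1 / \<delta>) * jump_term \<Omega> T' (\<lambda>x. adjoint_state X' x - adjoint_state X x) L"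
    by (intro jump_term_young[OF conf' op L \<delta>] coarse_affine solution_affine)
  have 5: "control_term \<alpha> X' L \<le> (1 + \<delta>) * control_term \<alpha> X L
      + (1 + 1 / \<delta>) * (area L * (area L * (norm (slope (\<lambda>x. adjoint_state X' x - adjoint_state X x) L))\<^sup>2) / \<alpha>\<^sup>2)"
    if D: "ap = Discretised"
  proof -
    note dL = conf_det[OF conf' L]
    obtain c where c: "\<forall>x\<in>interior (region L). control X x = c" using control_const_leaf[OF D L] by blast
    obtain c' where c': "\<forall>x\<in>interior (region L). control X' x = c'" using control_const(2)[OF D L] by blast
    note sl = affine_on_diff(2)[OF dL solution_affine(4)[OF L] coarse_affine(2)[OF L]]
    define A where "A = area L * area L / \<alpha>\<^sup>2"
    have "0 \<le> A" unfolding A_def using area_nonneg[of L] by simp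
    then have "A * (norm (slope (adjoint_state X') L))\<^sup>2 \<le> A * ((1 + \<delta>) * (norm (slope (adjoint_state X) L))\<^sup>2
       + (1 + 1 / \<delta>) * (norm (slope (\<lambda>x. adjoint_state X' x - adjoint_state X x) L))\<^sup>2)"
      using young_sq[OF \<delta>, of "slope (adjoint_state X) L" "slope (adjoint_state X') L - slope (adjoint_state X) L"]
      unfolding sl by (intro mult_left_mono) auto
    moreover have "A * (d1 * n + d2 * m) = d1 * (A * n) + d2 * (A * m)" for d1 d2 n m
      by (simp add: algebra_simps)
    ultimately have "A * (norm (slope (adjoint_state X') L))\<^sup>2 \<le> (1 + \<delta>) * (A * (norm (slope (adjoint_state X) L))\<^sup>2)
       + (1 + 1 / \<delta>) * (A * (norm (slope (\<lambda>x. adjoint_state X' x - adjoint_state X x) L))\<^sup>2)" by metis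
    moreover have "area L * (area L * n) / \<alpha>\<^sup>2 = A * n" for n unfolding A_def by simp
    ultimately show ?thesis
      unfolding control_term_eq[OF dL c coarse_affine(2)[OF L]] control_term_eq[OF dL c' solution_affine(4)[OF L]]
      by metis
  qed
  show ?thesis
  proof (cases ap)
    case Variational
    then show ?thesis using 1 2 3 4 unfolding local_estimator_def change_term_def by (simp add: distrib_left)
  next
    case Discretised
    then show ?thesis using 1 2 3 4 5 unfolding local_estimator_def change_term_def by (simp add: distrib_left)
  qed
qed

lemma local_estimator_reduction:
  assumes K: "K \<in> T" "K \<notin> T'"
  shows "(\<Sum>L\<in>\<tau> K. local_estimator ap \<Omega> f yd \<alpha> T' X L) \<le> sqrt (1/2) * local_estimator ap \<Omega> f yd \<alpha> T X K"
proof -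
  have t: "bis_tree K (\<tau> K)" "\<tau> K \<subseteq> T'" using fo K(1) unfolding forest_def by blast+
  note dK = conf_det[OF conf K(1)]
  have h: "1/2 \<le> sqrt (1/2::real)" by (rule real_le_rsqrt) (simp add: power2_eq_square)
  have vol: "(\<Sum>L\<in>\<tau> K. volume_term g L) \<le> sqrt (1/2) * volume_term g K" if "g \<in> L2 \<Omega>" for g :: field
    using volume_reduction[OF conf conf' op fo K that] mult_right_mono[OF h volume_term_nonneg[of g K]] by linarith
  have jmp: "(\<Sum>L\<in>\<tau> K. jump_term \<Omega> T' v L) \<le> sqrt (1/2) * jump_term \<Omega> T v K" if "\<And>K. K \<in> T \<Longrightarrow> affine_on v K" for v
    using that by (intro jump_reduction[OF conf conf' op fo _ K])
  have ctrl: "(\<Sum>L\<in>\<tau> K. control_term \<alpha> X L) \<le> sqrt (1/2) * control_term \<alpha> X K" if D: "ap = Discretised"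
  proof -
    define s where "s = (norm (slope (adjoint_state X) K))\<^sup>2 / \<alpha>\<^sup>2"
    have s0: "0 \<le> s" unfolding s_def by simp
    obtain c where c: "\<forall>x\<in>interior (region K). control X x = c" using control_const(1)[OF D K(1)] by blast
    have cK: "control_term \<alpha> X K = area K * (area K * s)"
      unfolding control_term_eq[OF dK c solution_affine(2)[OF K(1)]] s_def by simp
    have cL: "control_term \<alpha> X L \<le> area L * (area K / 2 * s)" if L: "L \<in> \<tau> K" for L
    proof -
      have LT: "L \<in> T'" using L t(2) by blast
      obtain c where c: "\<forall>x\<in>interior (region L). control X x = c" using control_const_leaf[OF D LT] by blast
      have "L \<noteq> K" using LT K(2) by blast
      have "slope (adjoint_state X) L = slope (adjoint_state X) K"
        using leaf_slope(1)[OF conf conf' op fo _ K(1) L] solution_affine(2) by blast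
      then have "control_term \<alpha> X L = area L * (area L * s)"
        unfolding control_term_eq[OF conf_det[OF conf' LT] c coarse_affine(2)[OF LT]] s_def by simp
      also have "\<dots> \<le> area L * (area K / 2 * s)"
        using tree_area_half[OF t(1) L \<open>L \<noteq> K\<close>] s0 area_nonneg[of L] by (intro mult_left_mono mult_right_mono) auto
      finally show ?thesis .
    qed
    have "(\<Sum>L\<in>\<tau> K. control_term \<alpha> X L) \<le> (\<Sum>L\<in>\<tau> K. area L * (area K / 2 * s))" using cL by (rule sum_mono)
    also have "\<dots> = 1/2 * control_term \<alpha> X K"
      unfolding sum_distrib_right[symmetric] tree_area_sum[OF t(1) dK] cK by simp
    also have "\<dots> \<le> sqrt (1/2) * control_term \<alpha> X K" by (rule mult_right_mono[OF h control_term_nonneg])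
    finally show ?thesis .
  qed
  have "(\<Sum>L\<in>\<tau> K. case ap of Variational \<Rightarrow> 0 | Discretised \<Rightarrow> control_term \<alpha> X L)
      \<le> sqrt (1/2) * (case ap of Variational \<Rightarrow> 0 | Discretised \<Rightarrow> control_term \<alpha> X K)"
    using ctrl by (cases ap) auto
  then show ?thesis
    unfolding local_estimator_def sum.distrib distrib_left
    by (intro add_mono vol jmp L2_add L2_diff f yd solution_L2 solution_affine)
qed

lemma change_sum:
  assumes A: "\<And>L. L \<in> T' \<Longrightarrow> area L \<le> A" "0 \<le> A"
    and shape: "\<And>L. L \<in> T' \<Longrightarrow> size2 L \<le> \<kappa> * area L" and \<kappa>: "1 \<le> \<kappa>" and C: "0 \<le> C"
    and fr: "spread (\<lambda>x. state X' x - state X x) T' 0 \<le> C * energy (\<lambda>x. state X' x - state X x) T'"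
      "spread (\<lambda>x. adjoint_state X' x - adjoint_state X x) T' 0 \<le> C * energy (\<lambda>x. adjoint_state X' x - adjoint_state X x) T'"
  shows "(\<Sum>L\<in>T'. change_term L) \<le>
    (A * (1 + C / \<alpha>\<^sup>2) + 24 * \<kappa>\<^sup>2 + A * C + A / \<alpha>\<^sup>2) * (mesh_distance ap \<Omega> T' X X')\<^sup>2"
proof -
  define dy where "dy = (\<lambda>x. state X' x - state X x)"
  define dp where "dp = (\<lambda>x. adjoint_state X' x - adjoint_state X x)"
  define du where "du = (\<lambda>x. control X' x - control X x)"
  define Ey where "Ey = energy dy T'"
  define Ep where "Ep = energy dp T'"
  define Eu where "Eu = (case ap of Variational \<Rightarrow> 0 | Discretised \<Rightarrow> sq_integral \<Omega> du)"
  have aff: "affine_on dy L" "affine_on dp L" if "L \<in> T'" for L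
    unfolding dy_def dp_def
    using affine_on_diff(1)[OF conf_det[OF conf' that]] solution_affine(3,4) coarse_affine that by auto
  have L2: "dy \<in> L2 \<Omega>" "dp \<in> L2 \<Omega>" "du \<in> L2 \<Omega>" unfolding dy_def dp_def du_def using L2_diff solution_L2 by auto
  note So = open_sets_lebesgue[OF op]
  have E0: "0 \<le> Ey" "0 \<le> Ep" "0 \<le> Eu" unfolding Ey_def Ep_def Eu_def
    by (auto simp: energy_nonneg sq_integral_nonneg split: approach.split)
  have dist: "(mesh_distance ap \<Omega> T' X X')\<^sup>2 = Ey + Ep + Eu"
  proof -
    have "(pw_norm T' dy)\<^sup>2 + (pw_norm T' dp)\<^sup>2 + (case ap of Variational \<Rightarrow> 0 | Discretised \<Rightarrow> (L2_norm \<Omega> du)\<^sup>2) = Ey + Ep + Eu"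
      unfolding Ey_def Ep_def Eu_def L2_norm_set[OF So] using pw_norm_energy[OF conf'] aff by auto
    then show ?thesis using E0 unfolding mesh_distance_def dy_def[symmetric] dp_def[symmetric] du_def[symmetric] by simp
  qed
  have qy: "sq_integral \<Omega> dy \<le> C * Ey" unfolding Ey_def
    using sq_integral_spread[OF conf' op L2(1) aff(1)] fr(1) unfolding dy_def by linarith
  have qp: "sq_integral \<Omega> dp \<le> C * Ep" unfolding Ep_def
    using sq_integral_spread[OF conf' op L2(2) aff(2)] fr(2) unfolding dp_def by linarith
  have qu: "sq_integral \<Omega> du \<le> Eu + C / \<alpha>\<^sup>2 * Ep"
  proof (cases ap)
    case Variational
    have U: "control X \<in> U_ad \<Omega> ua ub" "control X' \<in> U_ad \<Omega> ua ub"
      and vi: "\<And>z. z \<in> U_ad \<Omega> ua ub \<Longrightarrow> 0 \<le> L2_inner \<Omega> (\<lambda>x. \<alpha> *\<^sub>R control X x + adjoint_state X x) (\<lambda>x. z x - control X x)"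
        "\<And>z. z \<in> U_ad \<Omega> ua ub \<Longrightarrow> 0 \<le> L2_inner \<Omega> (\<lambda>x. \<alpha> *\<^sub>R control X' x + adjoint_state X' x) (\<lambda>x. z x - control X' x)"
      using X X' Variational unfolding discrete_solution_def U_h_def by auto
    have "sq_integral \<Omega> du \<le> (1 / \<alpha>\<^sup>2) * sq_integral \<Omega> dp"
      unfolding du_def dp_def using solution_L2
      by (intro control_stability[OF _ _ _ _ \<alpha> So vi(1)[OF U(2)] vi(2)[OF U(1)]])
    also have "\<dots> \<le> (1 / \<alpha>\<^sup>2) * (C * Ep)" using qp by (intro mult_left_mono) auto
    finally show ?thesis using E0 by simp
  next
    case Discretised
    then have "Eu = sq_integral \<Omega> du" by (simp add: Eu_def)
    moreover have "0 \<le> C / \<alpha>\<^sup>2 * Ep" using C E0 by simp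
    ultimately show ?thesis by simp
  qed
  have vol: "(\<Sum>L\<in>T'. area L * sq_integral (interior (region L)) g) \<le> A * sq_integral \<Omega> g" if "g \<in> L2 \<Omega>" for g :: field
    by (rule sum_volume_le[OF conf' op that A(1)])
  have 1: "(\<Sum>L\<in>T'. area L * sq_integral (interior (region L)) du) \<le> A * (Eu + C / \<alpha>\<^sup>2 * Ep)"
    using vol[OF L2(3)] mult_left_mono[OF qu A(2)] by linarith
  have 2: "(\<Sum>L\<in>T'. area L * sq_integral (interior (region L)) dy) \<le> A * (C * Ey)"
    using vol[OF L2(1)] mult_left_mono[OF qy A(2)] by linarith
  have jmp: "(\<Sum>L\<in>T'. jump_term \<Omega> T' w L) \<le> 24 * \<kappa>\<^sup>2 * energy w T'" if "\<And>K. K \<in> T' \<Longrightarrow> affine_on w K" for w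
    using that shape \<kappa> by (intro jump_energy[OF conf' op])
  have 3: "(\<Sum>L\<in>T'. jump_term \<Omega> T' dy L) \<le> 24 * \<kappa>\<^sup>2 * Ey" "(\<Sum>L\<in>T'. jump_term \<Omega> T' dp L) \<le> 24 * \<kappa>\<^sup>2 * Ep"
    unfolding Ey_def Ep_def using jmp aff by auto
  have 4: "(\<Sum>L\<in>T'. case ap of Variational \<Rightarrow> 0 | Discretised \<Rightarrow> area L * (area L * (norm (slope dp L))\<^sup>2) / \<alpha>\<^sup>2) \<le> A / \<alpha>\<^sup>2 * Ep"
  proof -
    have "(case ap of Variational \<Rightarrow> 0 | Discretised \<Rightarrow> area L * (area L * (norm (slope dp L))\<^sup>2) / \<alpha>\<^sup>2)
        \<le> A / \<alpha>\<^sup>2 * (area L * (norm (slope dp L))\<^sup>2)" if "L \<in> T'" for L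
    proof -
      have "area L * (area L * (norm (slope dp L))\<^sup>2) / \<alpha>\<^sup>2 \<le> A * (area L * (norm (slope dp L))\<^sup>2) / \<alpha>\<^sup>2"
        using A(1)[OF that] area_nonneg[of L] by (intro divide_right_mono mult_right_mono) auto
      moreover have "0 \<le> A * (area L * (norm (slope dp L))\<^sup>2) / \<alpha>\<^sup>2" using A(2) area_nonneg[of L] by simp
      ultimately show ?thesis by (auto split: approach.split)
    qed
    then have "(\<Sum>L\<in>T'. case ap of Variational \<Rightarrow> 0 | Discretised \<Rightarrow> area L * (area L * (norm (slope dp L))\<^sup>2) / \<alpha>\<^sup>2)
        \<le> (\<Sum>L\<in>T'. A / \<alpha>\<^sup>2 * (area L * (norm (slope dp L))\<^sup>2))" by (rule sum_mono)
    then show ?thesis unfolding Ep_def energy_def sum_distrib_left .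
  qed
  have "(\<Sum>L\<in>T'. change_term L) \<le> A * (Eu + C / \<alpha>\<^sup>2 * Ep) + 24 * \<kappa>\<^sup>2 * Ey + A * (C * Ey) + 24 * \<kappa>\<^sup>2 * Ep + A / \<alpha>\<^sup>2 * Ep"
    unfolding change_term_def dy_def[symmetric] dp_def[symmetric] du_def[symmetric] sum.distrib
    using 1 2 3 4 by linarith
  also have "\<dots> \<le> (A * (1 + C / \<alpha>\<^sup>2) + 24 * \<kappa>\<^sup>2 + A * C + A / \<alpha>\<^sup>2) * (Ey + Ep + Eu)"
  proof -
    define a where "a = A * (C / \<alpha>\<^sup>2)"
    define k where "k = 24 * \<kappa>\<^sup>2"
    define b where "b = A * C"
    define c where "c = A / \<alpha>\<^sup>2"
    have n: "0 \<le> a" "0 \<le> k" "0 \<le> b" "0 \<le> c" using A(2) C unfolding a_def k_def b_def c_def by auto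
    have "A * (Eu + C / \<alpha>\<^sup>2 * Ep) + 24 * \<kappa>\<^sup>2 * Ey + A * (C * Ey) + 24 * \<kappa>\<^sup>2 * Ep + A / \<alpha>\<^sup>2 * Ep
        = A * Eu + a * Ep + k * Ey + b * Ey + k * Ep + c * Ep"
      unfolding a_def k_def b_def c_def by (simp add: algebra_simps)
    also have "\<dots> \<le> (A + a + k + b + c) * Eu + (A + a + k + b + c) * Ep + (A + a + k + b + c) * Ey"
      using n A(2) E0 by (simp add: distrib_right)
    also have "\<dots> = (A + a + k + b + c) * (Ey + Ep + Eu)" by (simp add: algebra_simps)
    also have "A + a = A * (1 + C / \<alpha>\<^sup>2)" unfolding a_def by (simp add: distrib_left)
    finally show ?thesis unfolding k_def b_def c_def .
  qed
  finally show ?thesis unfolding dist .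
qed

lemma estimator_bound:
  assumes C: "(\<Sum>L\<in>T'. change_term L) \<le> C * (mesh_distance ap \<Omega> T' X X')\<^sup>2" and C0: "0 \<le> C"
  shows "estimator ap \<Omega> f yd \<alpha> T' X' (T' - T)
     \<le> sqrt (3/4) * estimator ap \<Omega> f yd \<alpha> T X (T - T') + sqrt (21 * C) * mesh_distance ap \<Omega> T' X X'"
proof -
  define i where "i = local_estimator ap \<Omega> f yd \<alpha> T' X"
  define \<eta> where "\<eta> = (\<Sum>K\<in>T - T'. local_estimator ap \<Omega> f yd \<alpha> T X K)"
  define d where "d = mesh_distance ap \<Omega> T' X X'"
  have i0: "0 \<le> i L" for L unfolding i_def by (rule local_estimator_nonneg)
  have \<eta>0: "0 \<le> \<eta>" unfolding \<eta>_def by (intro sum_nonneg local_estimator_nonneg)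
  have d0: "0 \<le> d" unfolding d_def mesh_distance_def
    by (auto intro!: add_nonneg_nonneg split: approach.split)
  have fin: "finite T" "finite T'" using conf_finite conf conf' by auto
  have ft: "finite (\<tau> K)" if "K \<in> T" for K using fo that tree_finite unfolding forest_def by blast
  have "(\<Sum>L\<in>T' - T. i L) \<le> (\<Sum>L\<in>(\<Union>K\<in>T - T'. \<tau> K). i L)"
  proof (rule sum_mono2)
    show "finite (\<Union>K\<in>T - T'. \<tau> K)" using fin ft by blast
    show "T' - T \<subseteq> (\<Union>K\<in>T - T'. \<tau> K)" using refined_triangle[OF conf conf' fo] by blast
  qed (rule i0)
  also have "\<dots> \<le> (\<Sum>K\<in>T - T'. \<Sum>L\<in>\<tau> K. i L)" using fin ft i0 by (intro sum_UN_le) auto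
  also have "\<dots> \<le> (\<Sum>K\<in>T - T'. sqrt (1/2) * local_estimator ap \<Omega> f yd \<alpha> T X K)"
    unfolding i_def using local_estimator_reduction by (intro sum_mono) auto
  also have "\<dots> = sqrt (1/2) * \<eta>" unfolding \<eta>_def by (simp add: sum_distrib_left)
  also have "\<dots> \<le> 71/100 * \<eta>"
    using \<eta>0 by (intro mult_right_mono real_le_lsqrt) (auto simp: power2_eq_square)
  finally have red: "(\<Sum>L\<in>T' - T. i L) \<le> 71/100 * \<eta>" .
  \<comment> \<open>Young with \<open>\<delta> = 1/20\<close>, so that \<open>(1 + \<delta>) * (71/100) \<le> 3/4\<close> and \<open>1 + 1/\<delta> = 21\<close>.\<close>
  have "(\<Sum>L\<in>T' - T. local_estimator ap \<Omega> f yd \<alpha> T' X' L) \<le> (\<Sum>L\<in>T' - T. (21/20) * i L + 21 * change_term L)"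
    using local_estimator_young[of _ "1/20"] unfolding i_def by (intro sum_mono) auto
  also have "\<dots> = (21/20) * (\<Sum>L\<in>T' - T. i L) + 21 * (\<Sum>L\<in>T' - T. change_term L)"
    by (simp add: sum.distrib sum_distrib_left)
  also have "(\<Sum>L\<in>T' - T. change_term L) \<le> (\<Sum>L\<in>T'. change_term L)"
    using fin change_term_nonneg by (intro sum_mono2) auto
  finally have "(\<Sum>L\<in>T' - T. local_estimator ap \<Omega> f yd \<alpha> T' X' L) \<le> (21/20) * (71/100 * \<eta>) + 21 * (C * d\<^sup>2)"
    using red C unfolding d_def by linarith
  also have "\<dots> \<le> 3/4 * \<eta> + 21 * C * d\<^sup>2" using \<eta>0 by simp
  finally have "estimator ap \<Omega> f yd \<alpha> T' X' (T' - T) \<le> sqrt (3/4 * \<eta> + 21 * C * d\<^sup>2)"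
    unfolding estimator_def local_estimator_def[symmetric] by (rule real_sqrt_le_mono)
  also have "\<dots> \<le> sqrt (3/4 * \<eta>) + sqrt (21 * C * d\<^sup>2)"
    using \<eta>0 C0 by (intro sqrt_add_le_add_sqrt) auto
  also have "\<dots> = sqrt (3/4) * sqrt \<eta> + sqrt (21 * C) * d"
    unfolding real_sqrt_mult using d0 by simp
  also have "sqrt \<eta> = estimator ap \<Omega> f yd \<alpha> T X (T - T')"
    unfolding estimator_def local_estimator_def[symmetric] \<eta>_def ..
  finally show ?thesis unfolding d_def .
qed

end

theorem mainTheorem10:
  fixes ap :: approach
    and \<Omega> :: "(real^2) set"
    and f yd :: "real^2 \<Rightarrow> real^2"
    and \<alpha> :: real
    and ua ub :: "real^2"
    and T0 :: mesh
  assumes "polygonal_domain \<Omega>"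
    and "f \<in> L2 \<Omega>" and "yd \<in> L2 \<Omega>"
    and "\<alpha> > 0"
    and "conforming_triangulation \<Omega> T0"
  shows "\<exists>\<rho> \<Lambda>\<^sub>2. 0 < \<rho> \<and> \<rho> < 1 \<and> 0 < \<Lambda>\<^sub>2 \<and>
    (\<forall>T \<in> refinements \<Omega> T0. \<forall>T' \<in> refinements \<Omega> T. \<forall>X X'.
       discrete_solution ap \<Omega> f yd \<alpha> ua ub T X \<longrightarrow>
       discrete_solution ap \<Omega> f yd \<alpha> ua ub T' X' \<longrightarrow>
       estimator ap \<Omega> f yd \<alpha> T' X' (T' - T)
         \<le> \<rho> * estimator ap \<Omega> f yd \<alpha> T X (T - T') + \<Lambda>\<^sub>2 * mesh_distance ap \<Omega> T' X X')"
proof -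
  note conf0 = assms(5)
  have op: "open \<Omega>" using assms(1) unfolding polygonal_domain_def by blast
  obtain C where C: "C > 0" "\<And>T \<sigma> v. conforming_triangulation \<Omega> T \<Longrightarrow> forest T0 T \<sigma> \<Longrightarrow> mean_continuous \<Omega> T0 T v \<Longrightarrow>
      spread v T 0 \<le> C * energy v T"
    using friedrichs[OF conf0 op] by blast
  define A where "A = (\<Sum>K\<in>T0. area K)"
  define \<kappa> where "\<kappa> = 1 + (\<Sum>K\<in>T0. size2 K / area K)"
  have A0: "0 \<le> A" unfolding A_def by (intro sum_nonneg area_nonneg)
  have q0: "0 \<le> size2 K / area K" for K using size2_nonneg area_nonneg by simp
  then have \<kappa>: "1 \<le> \<kappa>" unfolding \<kappa>_def using sum_nonneg[of T0 "\<lambda>K. size2 K / area K"] by simp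
  define M where "M = A * (1 + C / \<alpha>\<^sup>2) + 24 * \<kappa>\<^sup>2 + A * C + A / \<alpha>\<^sup>2"
  have "0 < 24 * \<kappa>\<^sup>2" using \<kappa> by simp
  moreover have "0 \<le> A * (1 + C / \<alpha>\<^sup>2)" "0 \<le> A * C" "0 \<le> A / \<alpha>\<^sup>2" using A0 C(1) by auto
  ultimately have M: "0 < M" unfolding M_def by linarith
  have "estimator ap \<Omega> f yd \<alpha> T' X' (T' - T)
      \<le> sqrt (3/4) * estimator ap \<Omega> f yd \<alpha> T X (T - T') + sqrt (21 * M) * mesh_distance ap \<Omega> T' X X'"
    if T: "T \<in> refinements \<Omega> T0" and T': "T' \<in> refinements \<Omega> T"
      and X: "discrete_solution ap \<Omega> f yd \<alpha> ua ub T X" and X': "discrete_solution ap \<Omega> f yd \<alpha> ua ub T' X'" for T T' X X'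
  proof -
    have conf: "conforming_triangulation \<Omega> T" "conforming_triangulation \<Omega> T'"
      and b: "bisects\<^sup>*\<^sup>* T0 T" "bisects\<^sup>*\<^sup>* T T'" using T T' unfolding refinements_def by auto
    obtain \<sigma> where \<sigma>: "forest T0 T \<sigma>" using bisects_forest[OF b(1)] by blast
    obtain \<tau> where \<tau>: "forest T T' \<tau>" using bisects_forest[OF b(2)] by blast
    obtain \<upsilon> where \<upsilon>: "forest T0 T' \<upsilon>" using bisects_forest[OF rtranclp_trans[OF b]] by blast
    have cr: "state X \<in> crouzeix_raviart \<Omega> T" "adjoint_state X \<in> crouzeix_raviart \<Omega> T"
      "state X' \<in> crouzeix_raviart \<Omega> T'" "adjoint_state X' \<in> crouzeix_raviart \<Omega> T'"
      using X X' unfolding discrete_solution_def by auto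
    have fine: "mean_continuous \<Omega> T0 T' v" if "v \<in> crouzeix_raviart \<Omega> T'" for v
      by (rule mean_continuous_fine[OF conf0 conf(2) op \<upsilon> crouzeix_raviart_weakly_continuous[OF conf(2) op that]])
    have coarse: "mean_continuous \<Omega> T0 T' v" if "v \<in> crouzeix_raviart \<Omega> T" for v
      by (rule mean_continuous_coarse[OF conf0 conf op \<sigma> \<tau> \<upsilon>
            mean_continuous_fine[OF conf0 conf(1) op \<sigma> crouzeix_raviart_weakly_continuous[OF conf(1) op that]]])
    have fr: "spread (\<lambda>x. v' x - v x) T' 0 \<le> C * energy (\<lambda>x. v' x - v x) T'"
      if "v \<in> crouzeix_raviart \<Omega> T" "v' \<in> crouzeix_raviart \<Omega> T'" for v v'
      by (rule C(2)[OF conf(2) \<upsilon> mean_continuous_diff[OF conf0 conf(2) op fine[OF that(2)] coarse[OF that(1)]]])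
    have small: "area L \<le> A \<and> size2 L \<le> \<kappa> * area L" if LT: "L \<in> T'" for L
    proof -
      obtain K where K: "K \<in> T0" "L \<in> \<upsilon> K" using \<upsilon> LT unfolding forest_def by blast
      have t: "bis_tree K (\<upsilon> K)" using \<upsilon> K(1) unfolding forest_def by blast
      have "area K \<le> A" unfolding A_def using K(1) conf_finite[OF conf0] by (intro member_le_sum) (auto simp: area_nonneg)
      then have 1: "area L \<le> A" using tree_area_le[OF t K(2)] by linarith
      have "size2 K / area K \<le> (\<Sum>K\<in>T0. size2 K / area K)"
        using K(1) conf_finite[OF conf0] q0 by (intro member_le_sum) auto
      then have "size2 K / area K \<le> \<kappa>" unfolding \<kappa>_def by linarith
      then have "size2 K / area K * area L \<le> \<kappa> * area L" by (intro mult_right_mono area_nonneg)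
      moreover have "size2 K / area K * area L = size2 L"
        using tree_shape[OF t K(2)] area_pos[OF conf_det[OF conf0 K(1)]] by (simp add: field_simps)
      ultimately show ?thesis using 1 by simp
    qed
    show ?thesis
    proof (rule estimator_bound[OF conf op \<tau> assms(2,3,4) X X'])
      show "(\<Sum>L\<in>T'. change_term ap \<Omega> \<alpha> T' X X' L) \<le> M * (mesh_distance ap \<Omega> T' X X')\<^sup>2"
        unfolding M_def using small \<kappa> C(1) A0 fr cr
        by (intro change_sum[OF conf op \<tau> assms(2,3,4) X X']) auto
      show "0 \<le> M" using M by simp
    qed
  qed
  moreover have "0 < sqrt (3/4::real)" "sqrt (3/4::real) < 1" "0 < sqrt (21 * M)" using M by auto
  ultimately show ?thesis by blast
qed

end
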